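(* Let $M$ be a finitely generated graded $S$-module with initially linear syzygies, and fix a presentation $0\to\ker\eta\to\bigoplus_j S\cdot g_j\xrightarrow{\eta}M\to 0$ having initially linear syzygies with respect to a term order $\prec$. Let $G_\bullet$ be the complex with $G_p=\bigoplus_{j}\bigoplus_{I\subseteq\mathrm{crit}(g_j),\,|I|=p}S\cdot e_Ig_j$ and differential $d_G=\pi(d_F-d_F\varphi d_F)$ associated with this presentation (see context). Then $G_\bullet$ is the minimal free resolution of $M$.
   Context: Let $k$ be a field, $S=k[x_1,\dots,x_n]$ with the standard grading, $\mathfrak m=(x_1,\dots,x_n)$, $[n]=\{1,\dots,n\}$. For a finitely generated graded $S$-module $M$, a presentation $0\to\ker\eta\to\bigoplus_{j=1}^r S\cdot g_j\xrightarrow{\eta}M\to0$ (free module with homogeneous basis $g_1,\dots,g_r$, $\eta$ degree-preserving) has initially linear syzygies with respect to a term order $\prec$ on $\bigoplus_j S\cdot g_j$ if $\ker\eta\subseteq\bigoplus_j\mathfrak m\cdot g_j$ and the initial module $\mathrm{in}_\prec(\ker\eta)$ is generated by terms of the form $x_ig_j$. $M$ has initially linear syzygies if it has such a presentation for some choice of generators and term order. Put $\mathrm{crit}(g_j)=\{i\mid x_ig_j\in\mathrm{in}_\prec(\ker\eta)\}$ and $\mathrm{ncrit}(g_j)=[n]\setminus\mathrm{crit}(g_j)$. Writing $x^\alpha g_j$ also for $\eta(x^\alpha g_j)$, the elements $x^\alpha g_j$ with $\mathrm{supp}\,\alpha\subseteq\mathrm{ncrit}(g_j)$ form a $k$-basis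 of $M$. Let $V$ be the $k$-vector space with basis $e_1,\dots,e_n$; for $I=\{i_1<\dots<i_p\}\subseteq[n]$ put $e_I=e_{i_1}\wedge\dots\wedge e_{i_p}$. Let $F_p=S\otimes_k\Lambda^pV\otimes_kM$, an $S$-module via the left factor; write $e_Im$ for $1\otimes e_I\otimes m$. The differential is $d_F(e_Im)=\sum_{i\in I}\varepsilon(i;I)\,(x_i\,e_{I\setminus i}m-e_{I\setminus i}(x_im))$, $\varepsilon(i;I)=(-1)^{|\{j\in I\mid j<i\}|}$. The elements $e_Ix^\alpha g_j$ with $\mathrm{supp}\,\alpha\subseteq\mathrm{ncrit}(g_j)$ form an $S$-basis of $F_\bullet$. For such a basis element put $\iota(\alpha)=\max(\mathrm{supp}\,\alpha)$. Define $\varphi_0(e_Ix^\alpha g_j)=-\varepsilon(\iota(\alpha);I\cup\iota(\alpha))\,e_{I\cup\iota(\alpha)}\frac{x^\alpha}{x_{\iota(\alpha)}}g_j$ if $\alpha\ne0$ and $\iota(\alpha)>\max(I\cap\mathrm{ncrit}(g_j))$ (with $\max\emptyset=-\infty$), and $\varphi_0(e_Ix^\alpha g_j)=0$ otherwise. The $S$-linear map $\varphi:F_\bullet\to F_{\bullet+1}$ is defined recursively on basis elements $b$ by $\varphi(b)=0$ if $\varphi_0(b)=0$, and $\varphi(b)=\varphi_0(b)-\varphi(d_F\varphi_0(b)-b)$ otherwise. The $S$-linear map $\pi:F_\bullet\to G_\bullet$ fixes the basis elements $e_Ig_j$ with $I\subseteq\mathrm{crit}(g_j)$ and sends all other basis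 elements to $0$; $G_\bullet$ is regarded as a graded $S$-submodule of $F_\bullet$ when forming $d_G$. The augmentation $G_0=\bigoplus_jS\cdot g_j\to M$ is $\eta$. *)

theory Defs
  imports Complex_Main "HOL-Library.Poly_Mapping"
begin

section \<open>The graded polynomial ring\<close>

text \<open>The variables are indexed by a finite linear order \<open>'n\<close>, playing the role of
  \<open>1 < \<dots> < n\<close>. The polynomial ring \<open>S\<close> is the type \<open>('n, 'k) mpoly\<close>, a \<open>comm_ring_1\<close>
  through the convolution product of \<open>Poly_Mapping\<close>; \<open>keys \<alpha>\<close> is the support of the exponent \<open>\<alpha>\<close>.\<close>

type_synonym 'n mon = "'n \<Rightarrow>\<^sub>0 nat"
type_synonym ('n, 'k) mpoly = "'n mon \<Rightarrow>\<^sub>0 'k"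

definition mdeg :: "('n::finite) mon \<Rightarrow> nat" where
  "mdeg \<alpha> = (\<Sum>i\<in>UNIV. Poly_Mapping.lookup \<alpha> i)"

definition vexp :: "'n \<Rightarrow> 'n mon" where
  "vexp i = Poly_Mapping.single i 1"

definition monom :: "'n mon \<Rightarrow> ('n, 'k::field) mpoly" where
  "monom \<alpha> = Poly_Mapping.single \<alpha> 1"

definition var :: "'n \<Rightarrow> ('n, 'k::field) mpoly" where
  "var i = monom (vexp i)"

definition const :: "'k \<Rightarrow> ('n, 'k::field) mpoly" where
  "const c = Poly_Mapping.single 0 c"

definition homog :: "nat \<Rightarrow> ('n::finite, 'k::field) mpoly set" where
  "homog d = {p. \<forall>\<alpha>\<in>Poly_Mapping.keys p. mdeg \<alpha> = d}"

definition irrelevant :: "('n, 'k::field) mpoly set" where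
  "irrelevant = module.span (*) {var i | i. True}"


section \<open>Graded modules\<close>

definition graded_module ::
  "(('n::finite, 'k::field) mpoly \<Rightarrow> 'm::ab_group_add \<Rightarrow> 'm) \<Rightarrow> (int \<Rightarrow> 'm set) \<Rightarrow> bool" where
  "graded_module scale Mg \<longleftrightarrow>
     module scale \<and>
     (\<forall>e. 0 \<in> Mg e \<and> (\<forall>x\<in>Mg e. \<forall>y\<in>Mg e. x + y \<in> Mg e)) \<and>
     (\<forall>d e. \<forall>p\<in>homog d. \<forall>x\<in>Mg e. scale p x \<in> Mg (int d + e)) \<and>
     (\<forall>x. \<exists>!c :: int \<Rightarrow>\<^sub>0 'm. (\<forall>e. Poly_Mapping.lookup c e \<in> Mg e) \<and>
        x = (\<Sum>e\<in>Poly_Mapping.keys c. Poly_Mapping.lookup c e))"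

definition finitely_generated ::
  "(('n, 'k::field) mpoly \<Rightarrow> 'm::ab_group_add \<Rightarrow> 'm) \<Rightarrow> bool" where
  "finitely_generated scale \<longleftrightarrow> (\<exists>B. finite B \<and> module.span scale B = UNIV)"

definition linear_on ::
  "'b set \<Rightarrow> ('a \<Rightarrow> 'b::plus \<Rightarrow> 'b) \<Rightarrow> ('a \<Rightarrow> 'c::plus \<Rightarrow> 'c) \<Rightarrow> ('b \<Rightarrow> 'c) \<Rightarrow> bool" where
  "linear_on A s1 s2 f \<longleftrightarrow>
     (\<forall>x\<in>A. \<forall>y\<in>A. f (x + y) = f x + f y) \<and> (\<forall>a. \<forall>x\<in>A. f (s1 a x) = s2 a (f x))"

text \<open>Minimal graded free resolutions of the graded module given by \<open>scale\<close> and \<open>Mg\<close>. The modules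
  \<open>G p\<close> are submodules of one ambient graded module \<open>(sC, Cg)\<close>; the differential \<open>d\<close> and the
  augmentation \<open>aug\<close> matter only on them.\<close>

definition minimal_free_resolution ::
  "(('n::finite, 'k::field) mpoly \<Rightarrow> 'm::ab_group_add \<Rightarrow> 'm) \<Rightarrow> (int \<Rightarrow> 'm set) \<Rightarrow>
   (('n, 'k) mpoly \<Rightarrow> 'c::ab_group_add \<Rightarrow> 'c) \<Rightarrow> (int \<Rightarrow> 'c set) \<Rightarrow>
   (nat \<Rightarrow> 'c set) \<Rightarrow> ('c \<Rightarrow> 'c) \<Rightarrow> ('c \<Rightarrow> 'm) \<Rightarrow> bool" where
  "minimal_free_resolution scale Mg sC Cg G d aug \<longleftrightarrow>
     graded_module scale Mg \<and> graded_module sC Cg \<and>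
     (\<forall>p. \<exists>B. finite B \<and> (\<forall>b\<in>B. \<exists>e. b \<in> Cg e) \<and>
        \<not> module.dependent sC B \<and> module.span sC B = G p) \<and>
     (\<forall>p. linear_on (G (Suc p)) sC sC d \<and> d ` G (Suc p) \<subseteq> G p \<and>
        (\<forall>e. d ` (G (Suc p) \<inter> Cg e) \<subseteq> Cg e)) \<and>
     linear_on (G 0) sC scale aug \<and> (\<forall>e. aug ` (G 0 \<inter> Cg e) \<subseteq> Mg e) \<and>
     aug ` G 0 = UNIV \<and>
     {x \<in> G 0. aug x = 0} = d ` G 1 \<and>
     (\<forall>p. {x \<in> G (Suc p). d x = 0} = d ` G (Suc (Suc p))) \<and>
     (\<forall>p. d ` G (Suc p) \<subseteq> module.span sC {sC a g | a g. a \<in> irrelevant \<and> g \<in> G p})"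


section \<open>Presentations with initially linear syzygies\<close>

text \<open>The free module with basis \<open>g\<^sub>0, \<dots>, g\<^bsub>r-1\<^esub>\<close> is the submodule \<open>free_mod r\<close> of \<open>nat \<Rightarrow>\<^sub>0 S\<close>
  (so \<open>r = 0\<close>, hence \<open>M = 0\<close>, is allowed). The term \<open>x\<^sup>\<alpha> g\<^sub>j\<close> is encoded as \<open>(\<alpha>, j)\<close>.\<close>

type_synonym ('n, 'k) fmod = "nat \<Rightarrow>\<^sub>0 ('n, 'k) mpoly"

definition free_mod :: "nat \<Rightarrow> ('n, 'k::field) fmod set" where
  "free_mod r = {f. Poly_Mapping.keys f \<subseteq> {..<r}}"

definition free_scale :: "('n, 'k::field) mpoly \<Rightarrow> ('n, 'k) fmod \<Rightarrow> ('n, 'k) fmod" where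
  "free_scale p f = Poly_Mapping.map (\<lambda>q. p * q) f"

definition fterm :: "'n mon \<Rightarrow> nat \<Rightarrow> ('n, 'k::field) fmod" where
  "fterm \<alpha> j = Poly_Mapping.single j (monom \<alpha>)"

definition terms :: "('n, 'k::field) fmod \<Rightarrow> ('n mon \<times> nat) set" where
  "terms f = {(\<alpha>, j). \<alpha> \<in> Poly_Mapping.keys (Poly_Mapping.lookup f j)}"

definition free_homog :: "nat \<Rightarrow> (nat \<Rightarrow> int) \<Rightarrow> int \<Rightarrow> ('n::finite, 'k::field) fmod set" where
  "free_homog r dg e = {f \<in> free_mod r. \<forall>(\<alpha>, j)\<in>terms f. int (mdeg \<alpha>) + dg j = e}"

definition term_order :: "nat \<Rightarrow> ('n mon \<times> nat \<Rightarrow> 'n mon \<times> nat \<Rightarrow> bool) \<Rightarrow> bool" where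
  "term_order r prec \<longleftrightarrow>
     (\<forall>\<alpha>. \<forall>i<r. \<not> prec (\<alpha>, i) (\<alpha>, i)) \<and>
     (\<forall>\<alpha> \<beta> \<gamma>. \<forall>i<r. \<forall>j<r. \<forall>l<r.
        prec (\<alpha>, i) (\<beta>, j) \<longrightarrow> prec (\<beta>, j) (\<gamma>, l) \<longrightarrow> prec (\<alpha>, i) (\<gamma>, l)) \<and>
     (\<forall>\<alpha> \<beta>. \<forall>i<r. \<forall>j<r. (\<alpha>, i) \<noteq> (\<beta>, j) \<longrightarrow> prec (\<alpha>, i) (\<beta>, j) \<or> prec (\<beta>, j) (\<alpha>, i)) \<and>
     (\<forall>\<alpha> \<beta> \<gamma>. \<forall>i<r. \<forall>j<r. prec (\<alpha>, i) (\<beta>, j) \<longrightarrow> prec (\<alpha> + \<gamma>, i) (\<beta> + \<gamma>, j)) \<and>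
     (\<forall>\<alpha> \<gamma>. \<forall>i<r. \<gamma> \<noteq> 0 \<longrightarrow> prec (\<alpha>, i) (\<alpha> + \<gamma>, i))"

definition is_lead_term ::
  "('n mon \<times> nat \<Rightarrow> 'n mon \<times> nat \<Rightarrow> bool) \<Rightarrow> ('n, 'k::field) fmod \<Rightarrow> 'n mon \<times> nat \<Rightarrow> bool" where
  "is_lead_term prec f t \<longleftrightarrow> t \<in> terms f \<and> (\<forall>u\<in>terms f. u \<noteq> t \<longrightarrow> prec u t)"

definition initial_module ::
  "('n mon \<times> nat \<Rightarrow> 'n mon \<times> nat \<Rightarrow> bool) \<Rightarrow> ('n, 'k::field) fmod set \<Rightarrow> ('n, 'k) fmod set" where
  "initial_module prec N =
     module.span free_scale {fterm \<alpha> j | \<alpha> j. \<exists>f\<in>N. is_lead_term prec f (\<alpha>, j)}"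

definition syz :: "nat \<Rightarrow> (('n, 'k::field) fmod \<Rightarrow> 'm::zero) \<Rightarrow> ('n, 'k) fmod set" where
  "syz r eta = {f \<in> free_mod r. eta f = 0}"

definition graded_presentation ::
  "(('n::finite, 'k::field) mpoly \<Rightarrow> 'm::ab_group_add \<Rightarrow> 'm) \<Rightarrow> (int \<Rightarrow> 'm set) \<Rightarrow>
   nat \<Rightarrow> (nat \<Rightarrow> int) \<Rightarrow> (('n, 'k) fmod \<Rightarrow> 'm) \<Rightarrow> bool" where
  "graded_presentation scale Mg r dg eta \<longleftrightarrow>
     linear_on (free_mod r) free_scale scale eta \<and>
     eta ` free_mod r = UNIV \<and>
     (\<forall>e. eta ` free_homog r dg e \<subseteq> Mg e)"

definition initially_linear_syzygies ::
  "nat \<Rightarrow> (('n, 'k::field) fmod \<Rightarrow> 'm::zero) \<Rightarrow>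
   ('n mon \<times> nat \<Rightarrow> 'n mon \<times> nat \<Rightarrow> bool) \<Rightarrow> bool" where
  "initially_linear_syzygies r eta prec \<longleftrightarrow>
     (\<forall>f\<in>syz r eta. \<forall>j<r. Poly_Mapping.lookup f j \<in> irrelevant) \<and>
     (\<exists>X. X \<subseteq> {fterm (vexp i) j | i j. j < r} \<and>
          initial_module prec (syz r eta) = module.span free_scale X)"

definition crit ::
  "nat \<Rightarrow> (('n, 'k::field) fmod \<Rightarrow> 'm::zero) \<Rightarrow>
   ('n mon \<times> nat \<Rightarrow> 'n mon \<times> nat \<Rightarrow> bool) \<Rightarrow> nat \<Rightarrow> 'n set" where
  "crit r eta prec j = {i. fterm (vexp i) j \<in> initial_module prec (syz r eta)}"

definition ncrit ::
  "nat \<Rightarrow> (('n, 'k::field) fmod \<Rightarrow> 'm::zero) \<Rightarrow>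
   ('n mon \<times> nat \<Rightarrow> 'n mon \<times> nat \<Rightarrow> bool) \<Rightarrow> nat \<Rightarrow> 'n set" where
  "ncrit r eta prec j = - crit r eta prec j"


section \<open>The complex \<open>F\<close>\<close>

text \<open>Since \<open>S \<otimes>\<^sub>k \<Lambda>V\<close> has the \<open>k\<close>-basis \<open>x\<^sup>\<beta> \<otimes> e\<^sub>I\<close>, the tensor product
  \<open>F = S \<otimes>\<^sub>k \<Lambda>V \<otimes>\<^sub>k M\<close> is the module of finitely supported families of elements of \<open>M\<close> indexed by
  the pairs \<open>(\<beta>, I)\<close>: the family \<open>u\<close> represents the sum of all \<open>x\<^sup>\<beta> \<otimes> e\<^sub>I \<otimes> u (\<beta>, I)\<close>. The ring
  acts on the left factor only, while \<open>k\<close> acts on the coefficients in \<open>M\<close>.\<close>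

type_synonym ('n, 'm) fcx = "('n mon \<times> 'n set) \<Rightarrow>\<^sub>0 'm"

definition F_scale ::
  "(('n, 'k::field) mpoly \<Rightarrow> 'm::ab_group_add \<Rightarrow> 'm) \<Rightarrow>
   ('n, 'k) mpoly \<Rightarrow> ('n, 'm) fcx \<Rightarrow> ('n, 'm) fcx" where
  "F_scale scale p u =
     (\<Sum>\<gamma>\<in>Poly_Mapping.keys p. \<Sum>(\<beta>, I)\<in>Poly_Mapping.keys u.
        Poly_Mapping.single (\<gamma> + \<beta>, I) (scale (const (Poly_Mapping.lookup p \<gamma>)) (Poly_Mapping.lookup u (\<beta>, I))))"

definition F_grading :: "(int \<Rightarrow> 'm set) \<Rightarrow> int \<Rightarrow> ('n::finite, 'm::zero) fcx set" where
  "F_grading Mg e =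
     {u. \<forall>(\<beta>, I)\<in>Poly_Mapping.keys u.
        Poly_Mapping.lookup u (\<beta>, I) \<in> Mg (e - int (mdeg \<beta>) - int (card I))}"

definition e_elt :: "'n set \<Rightarrow> 'm \<Rightarrow> ('n, 'm::zero) fcx" where
  "e_elt I m = Poly_Mapping.single (0, I) m"

definition eps :: "'n::linorder \<Rightarrow> 'n set \<Rightarrow> ('n, 'k::field) mpoly" where
  "eps i I = (- 1) ^ card {j \<in> I. j < i}"

definition d_F ::
  "(('n::{finite, linorder}, 'k::field) mpoly \<Rightarrow> 'm::ab_group_add \<Rightarrow> 'm) \<Rightarrow>
   ('n, 'm) fcx \<Rightarrow> ('n, 'm) fcx" where
  "d_F scale u =
     (\<Sum>(\<beta>, I)\<in>Poly_Mapping.keys u. F_scale scale (monom \<beta>)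
        (\<Sum>i\<in>I. F_scale scale (eps i I)
           (F_scale scale (var i) (e_elt (I - {i}) (Poly_Mapping.lookup u (\<beta>, I)))
            - e_elt (I - {i}) (scale (var i) (Poly_Mapping.lookup u (\<beta>, I))))))"


section \<open>The maps \<open>\<phi>\<close> and \<open>\<pi>\<close> and the complex \<open>G\<close>\<close>

definition F_elt ::
  "(('n, 'k::field) fmod \<Rightarrow> 'm::zero) \<Rightarrow> 'n set \<Rightarrow> 'n mon \<Rightarrow> nat \<Rightarrow> ('n, 'm) fcx" where
  "F_elt eta I \<alpha> j = e_elt I (eta (fterm \<alpha> j))"

definition top_index :: "'n::linorder mon \<Rightarrow> 'n" where
  "top_index \<alpha> = Max (Poly_Mapping.keys \<alpha>)"

definition phi0 ::
  "(('n::{finite, linorder}, 'k::field) mpoly \<Rightarrow> 'm::ab_group_add \<Rightarrow> 'm) \<Rightarrow> nat \<Rightarrow>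
   (('n, 'k) fmod \<Rightarrow> 'm) \<Rightarrow> ('n mon \<times> nat \<Rightarrow> 'n mon \<times> nat \<Rightarrow> bool) \<Rightarrow>
   'n set \<Rightarrow> 'n mon \<Rightarrow> nat \<Rightarrow> ('n, 'm) fcx" where
  "phi0 scale r eta prec I \<alpha> j =
     (if \<alpha> \<noteq> 0 \<and> (\<forall>i \<in> I \<inter> ncrit r eta prec j. i < top_index \<alpha>)
      then - F_scale scale (eps (top_index \<alpha>) (insert (top_index \<alpha>) I))
               (F_elt eta (insert (top_index \<alpha>) I) (\<alpha> - vexp (top_index \<alpha>)) j)
      else 0)"

text \<open>The recursion for \<open>\<phi>\<close> is stated on the \<open>S\<close>-basis of \<open>F\<close> formed by the elements
  \<open>F_elt eta I \<alpha> j\<close> with \<open>j < r\<close> and \<open>keys \<alpha> \<subseteq> ncrit r eta prec j\<close>. Its right-hand side applies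
  \<open>\<phi>\<close> to arbitrary elements of \<open>F\<close>, so \<open>\<phi>\<close> is introduced as the unique \<open>S\<close>-linear map satisfying
  the recursion.\<close>

definition phi_recursion ::
  "(('n::{finite, linorder}, 'k::field) mpoly \<Rightarrow> 'm::ab_group_add \<Rightarrow> 'm) \<Rightarrow> nat \<Rightarrow>
   (('n, 'k) fmod \<Rightarrow> 'm) \<Rightarrow> ('n mon \<times> nat \<Rightarrow> 'n mon \<times> nat \<Rightarrow> bool) \<Rightarrow>
   (('n, 'm) fcx \<Rightarrow> ('n, 'm) fcx) \<Rightarrow> bool" where
  "phi_recursion scale r eta prec \<phi> \<longleftrightarrow>
     (\<forall>I \<alpha> j. j < r \<longrightarrow> Poly_Mapping.keys \<alpha> \<subseteq> ncrit r eta prec j \<longrightarrow>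
        \<phi> (F_elt eta I \<alpha> j) =
          (if phi0 scale r eta prec I \<alpha> j = 0 then 0
           else phi0 scale r eta prec I \<alpha> j
                - \<phi> (d_F scale (phi0 scale r eta prec I \<alpha> j) - F_elt eta I \<alpha> j)))"

definition phi ::
  "(('n::{finite, linorder}, 'k::field) mpoly \<Rightarrow> 'm::ab_group_add \<Rightarrow> 'm) \<Rightarrow> nat \<Rightarrow>
   (('n, 'k) fmod \<Rightarrow> 'm) \<Rightarrow> ('n mon \<times> nat \<Rightarrow> 'n mon \<times> nat \<Rightarrow> bool) \<Rightarrow>
   ('n, 'm) fcx \<Rightarrow> ('n, 'm) fcx" where
  "phi scale r eta prec =
     (THE \<phi>. module_hom (F_scale scale) (F_scale scale) \<phi> \<and> phi_recursion scale r eta prec \<phi>)"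

definition proj_G ::
  "(('n::{finite, linorder}, 'k::field) mpoly \<Rightarrow> 'm::ab_group_add \<Rightarrow> 'm) \<Rightarrow> nat \<Rightarrow>
   (('n, 'k) fmod \<Rightarrow> 'm) \<Rightarrow> ('n mon \<times> nat \<Rightarrow> 'n mon \<times> nat \<Rightarrow> bool) \<Rightarrow>
   ('n, 'm) fcx \<Rightarrow> ('n, 'm) fcx" where
  "proj_G scale r eta prec =
     (THE \<pi>. module_hom (F_scale scale) (F_scale scale) \<pi> \<and>
        (\<forall>I \<alpha> j. j < r \<longrightarrow> Poly_Mapping.keys \<alpha> \<subseteq> ncrit r eta prec j \<longrightarrow>
           \<pi> (F_elt eta I \<alpha> j) =
             (if \<alpha> = 0 \<and> I \<subseteq> crit r eta prec j then F_elt eta I \<alpha> j else 0)))"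

definition G_mod ::
  "(('n::{finite, linorder}, 'k::field) mpoly \<Rightarrow> 'm::ab_group_add \<Rightarrow> 'm) \<Rightarrow> nat \<Rightarrow>
   (('n, 'k) fmod \<Rightarrow> 'm) \<Rightarrow> ('n mon \<times> nat \<Rightarrow> 'n mon \<times> nat \<Rightarrow> bool) \<Rightarrow>
   nat \<Rightarrow> ('n, 'm) fcx set" where
  "G_mod scale r eta prec p =
     module.span (F_scale scale)
       {F_elt eta I 0 j | I j. j < r \<and> I \<subseteq> crit r eta prec j \<and> card I = p}"

definition d_G ::
  "(('n::{finite, linorder}, 'k::field) mpoly \<Rightarrow> 'm::ab_group_add \<Rightarrow> 'm) \<Rightarrow> nat \<Rightarrow>
   (('n, 'k) fmod \<Rightarrow> 'm) \<Rightarrow> ('n mon \<times> nat \<Rightarrow> 'n mon \<times> nat \<Rightarrow> bool) \<Rightarrow>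
   ('n, 'm) fcx \<Rightarrow> ('n, 'm) fcx" where
  "d_G scale r eta prec u =
     proj_G scale r eta prec
       (d_F scale u - d_F scale (phi scale r eta prec (d_F scale u)))"

text \<open>The augmentation is \<open>\<eta>\<close> after the identification of \<open>free_mod r\<close> with \<open>G_mod scale r eta prec 0\<close> that sends
  \<open>g\<^sub>j\<close> to \<open>e\<^bsub>{}\<^esub> g\<^sub>j\<close>.\<close>

definition G0_embed ::
  "(('n::{finite, linorder}, 'k::field) mpoly \<Rightarrow> 'm::ab_group_add \<Rightarrow> 'm) \<Rightarrow> nat \<Rightarrow>
   (('n, 'k) fmod \<Rightarrow> 'm) \<Rightarrow> ('n, 'k) fmod \<Rightarrow> ('n, 'm) fcx" where
  "G0_embed scale r eta f = (\<Sum>j<r. F_scale scale (Poly_Mapping.lookup f j) (F_elt eta {} 0 j))"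

definition aug_G ::
  "(('n::{finite, linorder}, 'k::field) mpoly \<Rightarrow> 'm::ab_group_add \<Rightarrow> 'm) \<Rightarrow> nat \<Rightarrow>
   (('n, 'k) fmod \<Rightarrow> 'm) \<Rightarrow> ('n, 'm) fcx \<Rightarrow> 'm" where
  "aug_G scale r eta u = eta (the_inv_into (free_mod r) (G0_embed scale r eta) u)"

end

theory Submission
  imports Defs
begin

text \<open>The proof is algebraic discrete Morse theory over the field \<open>k\<close>. Let a complex have a \<open>k\<close>-basis
  that is split into \<open>U\<close>, \<open>D\<close> and \<open>C\<close>, with a bijection \<open>\<theta>\<close> from \<open>U\<close> to \<open>D\<close> such that, for \<open>b \<in> U\<close>,
  \<open>d b\<close> is a non-zero multiple of \<open>\<theta> b\<close> plus terms that lie in \<open>U \<union> C\<close> or that are smaller with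
  respect to a measure invariant under \<open>\<theta>\<close>. Then every \<open>x\<close> is congruent modulo \<open>\<langle>U \<union> C\<rangle>\<close>
  to \<open>d u\<close> for exactly one \<open>u \<in> \<langle>U\<rangle>\<close> (lemmas \<open>decomposition\<close> and \<open>d_injective\<close> of the locale
  \<open>matching\<close>); sending \<open>x\<close> to this \<open>u\<close> is a contraction of the complex onto a complex with basis \<open>C\<close>.

  This is used twice on \<open>F\<close>. Its \<open>k\<close>-basis is \<open>x\<^sup>\<beta> e\<^sub>I x\<^sup>\<alpha> g\<^sub>j\<close> with \<open>supp \<alpha> \<subseteq> ncrit(g\<^sub>j)\<close>; the
  elements \<open>x\<^sup>\<alpha> g\<^sub>j\<close> form a basis of \<open>M\<close> by Macaulay's argument: the initial module of \<open>ker \<eta>\<close> is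
  generated by the \<open>x\<^sub>i g\<^sub>j\<close> with \<open>i\<close> critical. Matching \<open>(\<beta>, I)\<close> with \<open>(\<beta> + e\<^sub>i, I - {i})\<close> for
  \<open>i = max I \<ge> max (supp \<beta>)\<close> leaves only \<open>1 \<otimes> M\<close> in homological degree 0, so \<open>F\<close> is a resolution of
  \<open>M\<close> (lemma \<open>F_exact\<close>). Matching \<open>(I, \<alpha>)\<close> with \<open>(I - {i}, \<alpha> + e\<^sub>i)\<close> for
  \<open>i = max (I \<inter> ncrit(g\<^sub>j)) \<ge> max (supp \<alpha>)\<close> is \<open>\<phi>\<^sub>0\<close> read backwards and leaves the basis
  \<open>e\<^sub>I g\<^sub>j\<close>, \<open>I \<subseteq> crit(g\<^sub>j)\<close>, of \<open>G\<close>. The measure is the number of terms below \<open>x\<^sub>I x\<^sup>\<alpha> g\<^sub>j\<close> in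
  the term order that have no larger degree: if \<open>i\<close> is critical, then \<open>x\<^sub>i x\<^sup>\<alpha> g\<^sub>j\<close> reduces to smaller terms. The contraction is the unique
  solution \<open>\<phi>\<close> of the recursion (lemmas \<open>phi_recursion_contr\<close> and \<open>phi_recursion_unique\<close>).

  If \<open>w \<in> \<langle>U \<union> C\<rangle>\<close> and \<open>\<phi> (d w) = 0\<close>, then \<open>(1 - d \<phi>) d (\<pi> w) = d w\<close> (lemma \<open>pd_pr\<close>). This identity
  transfers \<open>d \<circ> d = 0\<close> and exactness from \<open>F\<close> to \<open>G\<close>. Minimality holds because \<open>x\<^sub>i m\<close> never involves
  the basis elements \<open>g\<^sub>j\<close> of \<open>M\<close>, as \<open>ker \<eta>\<close> lies in \<open>\<Oplus>\<^sub>j \<mm> g\<^sub>j\<close>: hence no boundary of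
  \<open>F\<close> involves a basis element \<open>e\<^sub>I g\<^sub>j\<close> with constant coefficient.\<close>

section \<open>Vector spaces with coordinates\<close>

text \<open>A vector space with a basis \<open>bas i\<close> (\<open>i \<in> K\<close>); \<open>cf x i\<close> is the coordinate of \<open>x\<close> at
  \<open>bas i\<close>. Coordinates outside \<open>K\<close> vanish.\<close>

locale coords =
  fixes K :: "'i set" and ks :: "'k::field \<Rightarrow> 'v::ab_group_add \<Rightarrow> 'v"
    and cf :: "'v \<Rightarrow> 'i \<Rightarrow> 'k" and bas :: "'i \<Rightarrow> 'v"
  assumes cf_add: "cf (x + y) i = cf x i + cf y i"
    and cf_ks: "cf (ks c x) i = c * cf x i"
    and finite_supp0: "finite {i. cf x i \<noteq> 0}"
    and supp_K0: "cf x i \<noteq> 0 \<Longrightarrow> i \<in> K"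
    and cf_bas: "i \<in> K \<Longrightarrow> cf (bas i) j = (if j = i then 1 else 0)"
    and cf_eqI: "(\<And>i. cf x i = cf y i) \<Longrightarrow> x = y"
begin

text \<open>The indices of the non-zero coordinates.\<close>

definition supp :: "'v \<Rightarrow> 'i set" where
  "supp x = {i. cf x i \<noteq> 0}"

text \<open>The coordinate subspace spanned by the basis vectors with index in \<open>T\<close>.\<close>

definition supported :: "'i set \<Rightarrow> 'v set" where
  "supported T = {x. supp x \<subseteq> T}"

text \<open>The projection onto \<open>supported T\<close> along the other basis vectors.\<close>

definition restr :: "'i set \<Rightarrow> 'v \<Rightarrow> 'v" where
  "restr T x = (\<Sum>i\<in>supp x \<inter> T. ks (cf x i) (bas i))"

text \<open>\<open>k\<close>-linear endomorphisms.\<close>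

definition klin :: "('v \<Rightarrow> 'v) \<Rightarrow> bool" where
  "klin f \<longleftrightarrow> (\<forall>x y. f (x + y) = f x + f y) \<and> (\<forall>c x. f (ks c x) = ks c (f x))"

lemma finite_supp [simp]: "finite (supp x)"
  by (simp add: supp_def finite_supp0)

lemma supp_K: "supp x \<subseteq> K"
  using supp_K0 by (auto simp: supp_def)

lemma in_supp_K: "i \<in> supp x \<Longrightarrow> i \<in> K"
  using supp_K by blast

lemma cf_zero [simp]: "cf 0 i = 0"
  using cf_add[of 0 0 i] by (metis add.right_neutral add_left_cancel)

lemma cf_uminus: "cf (- x) i = - cf x i"
  using cf_add[of x "- x" i] by (simp add: add_eq_0_iff)

lemma cf_diff: "cf (x - y) i = cf x i - cf y i"
  using cf_add[of x "- y" i] by (simp add: cf_uminus)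

lemma cf_sum: "cf (\<Sum>a\<in>A. f a) i = (\<Sum>a\<in>A. cf (f a) i)"
  by (induction A rule: infinite_finite_induct) (auto simp: cf_add)

lemma ks_ks: "ks a (ks b x) = ks (a * b) x"
  by (rule cf_eqI) (simp add: cf_ks)

lemma ks_one [simp]: "ks 1 x = x"
  by (rule cf_eqI) (simp add: cf_ks)

lemma ks_zero [simp]: "ks 0 x = 0" "ks c 0 = 0"
  by (rule cf_eqI, simp add: cf_ks)+

lemma cf_restr: "cf (restr T x) i = (if i \<in> T then cf x i else 0)"
proof -
  have "cf (restr T x) i = (\<Sum>a\<in>supp x \<inter> T. cf x a * (if i = a then 1 else 0))"
    unfolding restr_def cf_sum cf_ks
    by (rule sum.cong) (use in_supp_K in \<open>auto simp: cf_bas\<close>)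
  also have "\<dots> = (\<Sum>a\<in>supp x \<inter> T. (if i = a then cf x a else 0))"
    by (rule sum.cong) auto
  finally show ?thesis
    by (auto simp: supp_def finite_supp0 sum.delta)
qed

lemma expand: "x = (\<Sum>i\<in>supp x. ks (cf x i) (bas i))"
proof -
  have "x = restr UNIV x" by (rule cf_eqI) (simp add: cf_restr)
  then show ?thesis by (simp add: restr_def)
qed

lemma supportedI: "(\<And>i. cf x i \<noteq> 0 \<Longrightarrow> i \<in> T) \<Longrightarrow> x \<in> supported T"
  by (auto simp: supported_def supp_def)

lemma supportedD: "x \<in> supported T \<Longrightarrow> cf x i \<noteq> 0 \<Longrightarrow> i \<in> T"
  by (auto simp: supported_def supp_def)

lemma supported_mono: "x \<in> supported T \<Longrightarrow> T \<subseteq> T' \<Longrightarrow> x \<in> supported T'"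
  by (auto simp: supported_def)

lemma supported_Int: "x \<in> supported T \<Longrightarrow> x \<in> supported T' \<Longrightarrow> x \<in> supported (T \<inter> T')"
  by (auto simp: supported_def)

lemma supported_zero [simp]: "0 \<in> supported T"
  by (auto intro: supportedI)

lemma supported_add: "x \<in> supported T \<Longrightarrow> y \<in> supported T \<Longrightarrow> x + y \<in> supported T"
proof (rule supportedI)
  fix i assume xy: "x \<in> supported T" "y \<in> supported T" and "cf (x + y) i \<noteq> 0"
  then have "cf x i \<noteq> 0 \<or> cf y i \<noteq> 0" by (auto simp: cf_add)
  then show "i \<in> T" using xy supportedD by blast
qed

lemma supported_uminus: "x \<in> supported T \<Longrightarrow> - x \<in> supported T"
  by (rule supportedI) (auto simp: cf_uminus dest: supportedD)

lemma supported_diff: "x \<in> supported T \<Longrightarrow> y \<in> supported T \<Longrightarrow> x - y \<in> supported T"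
  using supported_add[of x T "- y"] supported_uminus by simp

lemma supported_ks: "x \<in> supported T \<Longrightarrow> ks c x \<in> supported T"
  by (rule supportedI) (auto simp: cf_ks dest: supportedD)

lemma supported_sum: "(\<And>a. a \<in> A \<Longrightarrow> f a \<in> supported T) \<Longrightarrow> (\<Sum>a\<in>A. f a) \<in> supported T"
  by (induction A rule: infinite_finite_induct) (auto simp: supported_add)

lemma supported_bas: "i \<in> T \<Longrightarrow> i \<in> K \<Longrightarrow> bas i \<in> supported T"
  by (rule supportedI) (auto simp: cf_bas split: if_splits)

lemma supported_restr: "restr T x \<in> supported T"
  by (rule supportedI) (auto simp: cf_restr split: if_splits)

lemma supported_supp: "x \<in> supported (supp x)"
  by (simp add: supported_def)

lemma supported_empty: "x \<in> supported {} \<Longrightarrow> x = 0"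
  by (rule cf_eqI) (use supportedD in auto)

lemma restr_supported: "x \<in> supported T \<Longrightarrow> restr T x = x"
  by (rule cf_eqI) (auto simp: cf_restr dest: supportedD)

lemma restr_disjoint: "x \<in> supported T \<Longrightarrow> T \<inter> T' = {} \<Longrightarrow> restr T' x = 0"
  by (rule cf_eqI) (auto simp: cf_restr dest: supportedD)

lemma klin_restr: "klin (restr T)"
  unfolding klin_def by (intro conjI allI; rule cf_eqI) (auto simp: cf_restr cf_add cf_ks)

lemma klin_add: "klin f \<Longrightarrow> f (x + y) = f x + f y"
  and klin_ks: "klin f \<Longrightarrow> f (ks c x) = ks c (f x)"
  by (auto simp: klin_def)

lemma klin_zero: "klin f \<Longrightarrow> f 0 = 0"
  using klin_add[of f 0 0] by simp

lemma klin_uminus: "klin f \<Longrightarrow> f (- x) = - f x"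
  using klin_add[of f x "- x"] klin_zero[of f] by (simp add: add_eq_0_iff)

lemma klin_diff: "klin f \<Longrightarrow> f (x - y) = f x - f y"
  using klin_add[of f x "- y"] klin_uminus[of f] by simp

lemma klin_sum: "klin f \<Longrightarrow> f (\<Sum>a\<in>A. g a) = (\<Sum>a\<in>A. f (g a))"
  by (induction A rule: infinite_finite_induct) (auto simp: klin_add klin_zero)

lemma klin_expand: "klin f \<Longrightarrow> f x = (\<Sum>i\<in>supp x. ks (cf x i) (f (bas i)))"
  using arg_cong[OF expand[of x], of f] by (simp add: klin_sum klin_ks)

lemma klin_eqI:
  assumes "klin f" "klin g" "\<And>i. i \<in> K \<Longrightarrow> f (bas i) = g (bas i)"
  shows "f x = g x"
  unfolding klin_expand[OF assms(1), of x] klin_expand[OF assms(2), of x]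
  by (rule sum.cong) (use in_supp_K assms(3) in auto)

lemma klin_supported:
  assumes "klin f" "x \<in> supported T" "\<And>i. i \<in> T \<Longrightarrow> i \<in> K \<Longrightarrow> f (bas i) \<in> supported T'"
  shows "f x \<in> supported T'"
  unfolding klin_expand[OF assms(1), of x]
  by (rule supported_sum, rule supported_ks, rule assms(3))
     (use assms(2) supp_K in \<open>auto simp: supported_def\<close>)

lemma supported_induct [consumes 1, case_names zero add basis]:
  assumes "x \<in> supported T" "P 0" "\<And>x y. P x \<Longrightarrow> P y \<Longrightarrow> P (x + y)"
    "\<And>c i. i \<in> T \<Longrightarrow> i \<in> K \<Longrightarrow> P (ks c (bas i))"
  shows "P x"
proof -
  have "P (\<Sum>i\<in>A. ks (cf x i) (bas i))" if "A \<subseteq> supp x" for A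
  proof -
    have "finite A" using that finite_supp finite_subset by blast
    then show ?thesis using that
    proof (induction A)
      case (insert a A)
      then have "a \<in> T" "a \<in> K" using assms(1) supp_K by (auto simp: supported_def)
      with insert show ?case by (auto intro: assms(3,4))
    qed (simp add: assms(2))
  qed
  from this[of "supp x"] show ?thesis by (simp add: expand[symmetric])
qed

text \<open>Any function \<open>deg\<close> on the indices gives a grading in which \<open>bas i\<close> has degree \<open>deg i\<close>.\<close>

lemma homogeneous_decomposition:
  fixes deg :: "'i \<Rightarrow> int"
  shows "\<exists>!c :: int \<Rightarrow>\<^sub>0 'v. (\<forall>e. Poly_Mapping.lookup c e \<in> supported {i. deg i = e}) \<and>
           x = (\<Sum>e\<in>Poly_Mapping.keys c. Poly_Mapping.lookup c e)"
proof (rule ex_ex1I)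
  define h where "h e = restr {i. deg i = e} x" for e
  have h0: "h e = 0" if "e \<notin> deg ` supp x" for e
    unfolding h_def by (rule restr_disjoint[OF supported_supp]) (use that in auto)
  have fin: "finite {e. h e \<noteq> 0}"
    by (rule finite_subset[of _ "deg ` supp x"]) (use h0 in auto)
  define c where "c = Poly_Mapping.Abs_poly_mapping h"
  have lc: "Poly_Mapping.lookup c = h" unfolding c_def using fin by simp
  have kc: "Poly_Mapping.keys c = {e. h e \<noteq> 0}"
    by (auto simp: in_keys_iff lc)
  have "x = (\<Sum>e\<in>Poly_Mapping.keys c. h e)"
  proof (rule cf_eqI)
    fix i
    have "cf (\<Sum>e\<in>Poly_Mapping.keys c. h e) i = (\<Sum>e\<in>Poly_Mapping.keys c. if e = deg i then cf x i else 0)"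
      unfolding cf_sum by (rule sum.cong) (auto simp: h_def cf_restr)
    also have "\<dots> = (if deg i \<in> Poly_Mapping.keys c then cf x i else 0)" by simp
    also have "\<dots> = cf x i"
    proof (cases "deg i \<in> Poly_Mapping.keys c")
      case False
      then have "h (deg i) = 0" by (simp add: kc)
      then have "cf (h (deg i)) i = 0" by simp
      then show ?thesis using False by (simp add: h_def cf_restr)
    qed simp
    finally show "cf x i = cf (\<Sum>e\<in>Poly_Mapping.keys c. h e) i" ..
  qed
  then show "\<exists>c. (\<forall>e. Poly_Mapping.lookup c e \<in> supported {i. deg i = e}) \<and>
           x = (\<Sum>e\<in>Poly_Mapping.keys c. Poly_Mapping.lookup c e)"
    using supported_restr by (intro exI[of _ c]) (auto simp: lc h_def)
next
  have char: "Poly_Mapping.lookup c e = restr {i. deg i = e} x"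
    if c: "(\<forall>e. Poly_Mapping.lookup c e \<in> supported {i. deg i = e})"
          "x = (\<Sum>e\<in>Poly_Mapping.keys c. Poly_Mapping.lookup c e)" for c e
  proof (rule cf_eqI)
    fix i
    have other: "cf (Poly_Mapping.lookup c e') i = 0" if "e' \<noteq> deg i" for e'
      using c(1) that by (auto dest: supportedD)
    have "cf x i = (\<Sum>e'\<in>Poly_Mapping.keys c. if e' = deg i then cf (Poly_Mapping.lookup c (deg i)) i else 0)"
      by (subst c(2), unfold cf_sum, rule sum.cong) (auto simp: other)
    also have "\<dots> = cf (Poly_Mapping.lookup c (deg i)) i"
      by (auto simp: not_in_keys_iff_lookup_eq_zero)
    finally show "cf (Poly_Mapping.lookup c e) i = cf (restr {i. deg i = e} x) i"
      by (auto simp: cf_restr other)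
  qed
  show "c = c'" if
    "(\<forall>e. Poly_Mapping.lookup c e \<in> supported {i. deg i = e}) \<and>
           x = (\<Sum>e\<in>Poly_Mapping.keys c. Poly_Mapping.lookup c e)"
    "(\<forall>e. Poly_Mapping.lookup c' e \<in> supported {i. deg i = e}) \<and>
           x = (\<Sum>e\<in>Poly_Mapping.keys c'. Poly_Mapping.lookup c' e)" for c c'
    using char[OF that(1)[THEN conjunct1] that(1)[THEN conjunct2]]
      char[OF that(2)[THEN conjunct1] that(2)[THEN conjunct2]]
    by (intro poly_mapping_eqI) simp
qed

end


section \<open>Matchings on a based complex\<close>

text \<open>The basis indices outside \<open>U \<union> C\<close> are matched by \<open>\<theta>\<close> with those in \<open>U\<close>, and
  modulo \<open>U \<union> C\<close> the map \<open>d\<close> sends \<open>bas i\<close>, for \<open>i \<in> U\<close>, to a non-zero multiple of \<open>bas (\<theta> i)\<close> up to basis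
  vectors of smaller measure. The labels \<open>lab\<close> carry whatever grading is to be tracked: on \<open>U\<close>,
  \<open>d\<close> maps label \<open>sh l\<close> to label \<open>l\<close>. That \<open>d\<close> is a differential is not needed.\<close>

locale matching = coords K ks cf bas
  for K :: "'i set" and ks :: "'k::field \<Rightarrow> 'v::ab_group_add \<Rightarrow> 'v"
    and cf :: "'v \<Rightarrow> 'i \<Rightarrow> 'k" and bas :: "'i \<Rightarrow> 'v" +
  fixes d :: "'v \<Rightarrow> 'v" and U C :: "'i set" and \<theta> :: "'i \<Rightarrow> 'i" and \<nu> :: "'i \<Rightarrow> nat"
    and lab :: "'i \<Rightarrow> 'l" and sh :: "'l \<Rightarrow> 'l"
  assumes klin_d: "klin d"
    and U_K: "U \<subseteq> K" and C_K: "C \<subseteq> K" and U_C: "U \<inter> C = {}"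
    and theta_inj: "inj_on \<theta> U"
    and theta_image: "\<theta> ` U = K - (U \<union> C)"
    and nu_theta: "i \<in> U \<Longrightarrow> \<nu> (\<theta> i) = \<nu> i"
    and unit: "i \<in> U \<Longrightarrow> cf (d (bas i)) (\<theta> i) \<noteq> 0"
    and triangular: "i \<in> U \<Longrightarrow> cf (d (bas i)) j \<noteq> 0 \<Longrightarrow> j = \<theta> i \<or> j \<in> U \<union> C \<or> \<nu> j < \<nu> i"
    and lab_d: "i \<in> U \<Longrightarrow> cf (d (bas i)) j \<noteq> 0 \<Longrightarrow> lab i = sh (lab j)"
    and inj_sh: "inj sh"
begin

text \<open>The system is triangular: at an index \<open>i\<close> of maximal measure in the support of \<open>u\<close>, only
  \<open>bas i\<close> contributes to the coordinate of \<open>d u\<close> at \<open>\<theta> i\<close>.\<close>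

lemma d_injective:
  assumes u: "u \<in> supported U" and du: "d u \<in> supported (U \<union> C)"
  shows "u = 0"
proof (rule ccontr)
  assume "u \<noteq> 0"
  then have ne: "supp u \<noteq> {}" using supported_empty[of u] by (auto simp: supported_def)
  have "Max (\<nu> ` supp u) \<in> \<nu> ` supp u" using ne by simp
  then obtain i where i: "i \<in> supp u" and im: "\<nu> i = Max (\<nu> ` supp u)" by auto
  have mx: "\<nu> j \<le> \<nu> i" if "j \<in> supp u" for j using that im by simp
  have iU: "i \<in> U" using i u by (auto simp: supported_def)
  have tn: "\<theta> i \<notin> U \<union> C" using theta_image iU by auto
  have zero: "cf (d (bas j)) (\<theta> i) = 0" if j: "j \<in> supp u" "j \<noteq> i" for j
  proof (rule ccontr)
    assume nz: "\<not> ?thesis"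
    have jU: "j \<in> U" using j u by (auto simp: supported_def)
    from triangular[OF jU nz] tn have "\<theta> i = \<theta> j \<or> \<nu> i < \<nu> j"
      using nu_theta[OF iU] by auto
    then show False using theta_inj iU jU j mx[OF j(1)] by (auto dest: inj_onD)
  qed
  have "cf (d u) (\<theta> i) = (\<Sum>j\<in>supp u. cf u j * cf (d (bas j)) (\<theta> i))"
    by (subst klin_expand[OF klin_d]) (simp add: cf_sum cf_ks)
  also have "\<dots> = (\<Sum>j\<in>supp u. if j = i then cf u i * cf (d (bas i)) (\<theta> i) else 0)"
    by (rule sum.cong) (auto simp: zero)
  also have "\<dots> = cf u i * cf (d (bas i)) (\<theta> i)" using i by simp
  finally have "cf (d u) (\<theta> i) \<noteq> 0" using unit[OF iU] i by (auto simp: supp_def)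
  then show False using du tn by (auto dest: supportedD)
qed

text \<open>By induction on the measure: \<open>bas (\<theta> k)\<close> differs from a multiple of \<open>d (bas k)\<close> by
  basis vectors in \<open>U \<union> C\<close> or of smaller measure.\<close>

lemma decomposition:
  assumes "x \<in> supported {i. lab i \<in> L}"
  shows "\<exists>u. u \<in> supported {i\<in>U. lab i \<in> sh ` L} \<and> x - d u \<in> supported {i\<in>U \<union> C. lab i \<in> L}"
    (is "?Q x")
proof -
  have add: "?Q (x + y)" if xy: "?Q x" "?Q y" for x y
  proof -
    from xy obtain u v where "u \<in> supported {i\<in>U. lab i \<in> sh ` L}" "x - d u \<in> supported {i\<in>U \<union> C. lab i \<in> L}"
      "v \<in> supported {i\<in>U. lab i \<in> sh ` L}" "y - d v \<in> supported {i\<in>U \<union> C. lab i \<in> L}" by blast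
    then show ?thesis
      by (intro exI[of _ "u + v"])
         (simp add: klin_add[OF klin_d] supported_add add_diff_add)
  qed
  have scal: "?Q (ks c x)" if x: "?Q x" for x c
  proof -
    from x obtain u where u: "u \<in> supported {i\<in>U. lab i \<in> sh ` L}" "x - d u \<in> supported {i\<in>U \<union> C. lab i \<in> L}"
      by blast
    have "ks c x - d (ks c u) = ks c (x - d u)"
      by (rule cf_eqI) (simp add: klin_ks[OF klin_d] cf_diff cf_ks algebra_simps)
    then show ?thesis using u by (intro exI[of _ "ks c u"]) (simp add: supported_ks)
  qed
  have zero: "?Q 0" by (rule exI[of _ 0]) (simp add: klin_zero[OF klin_d])
  have base: "?Q (bas i)" if "i \<in> K" "lab i \<in> L" for i
    using that
  proof (induction "\<nu> i" arbitrary: i rule: less_induct)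
    case less
    show ?case
    proof (cases "i \<in> U \<union> C")
      case True
      then show ?thesis using less.prems
        by (intro exI[of _ 0]) (auto simp: klin_zero[OF klin_d] intro!: supported_bas)
    next
      case False
      then obtain k where k: "k \<in> U" "i = \<theta> k" using less.prems theta_image by blast
      define a where "a = cf (d (bas k)) i"
      have a: "a \<noteq> 0" using unit k by (simp add: a_def)
      define y where "y = bas i - ks (1 / a) (d (bas k))"
      have labk: "lab k = sh (lab i)" using lab_d[OF k(1)] a by (simp add: a_def)
      have "?Q y"
      proof -
        have "y \<in> supported {j\<in>K. lab j \<in> L \<and> (j \<in> U \<union> C \<or> \<nu> j < \<nu> i)}"
        proof (rule supportedI)
          fix j assume j: "cf y j \<noteq> 0"
          have "j \<noteq> i" using j a less.prems by (auto simp: y_def cf_diff cf_ks cf_bas a_def)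
          then have nz: "cf (d (bas k)) j \<noteq> 0"
            using j less.prems by (auto simp: y_def cf_diff cf_ks cf_bas)
          have "sh (lab i) = sh (lab j)" using lab_d[OF k(1) nz] labk by simp
          then have "lab j \<in> L" using less.prems inj_sh by (simp add: inj_eq)
          moreover have "j \<in> U \<union> C \<or> \<nu> j < \<nu> i"
            using triangular[OF k(1) nz] \<open>j \<noteq> i\<close> k nu_theta by auto
          ultimately show "j \<in> {j\<in>K. lab j \<in> L \<and> (j \<in> U \<union> C \<or> \<nu> j < \<nu> i)}"
            using supp_K0[OF nz] by simp
        qed
        then show ?thesis
        proof (induction rule: supported_induct)
          case (basis c j)
          have "?Q (bas j)"
          proof (cases "j \<in> U \<union> C")
            case True
            then show ?thesis using basis
              by (intro exI[of _ 0]) (auto simp: klin_zero[OF klin_d] intro!: supported_bas)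
          qed (use basis less.hyps in auto)
          then show ?case by (rule scal)
        qed (use zero add in auto)
      qed
      moreover have "?Q (ks (1 / a) (d (bas k)))"
        using labk k less.prems U_K
        by (intro exI[of _ "ks (1 / a) (bas k)"]) (auto simp: klin_ks[OF klin_d] intro!: supported_ks supported_bas)
      ultimately have "?Q (y + ks (1 / a) (d (bas k)))" by (rule add)
      then show ?thesis by (simp add: y_def)
    qed
  qed
  from assms show ?thesis
  proof (induction rule: supported_induct)
    case (basis c i)
    then show ?case using base scal by simp
  qed (use zero add in auto)
qed

text \<open>Every \<open>x\<close> is congruent to \<open>d u\<close> modulo \<open>supported (U \<union> C)\<close> for exactly one \<open>u \<in> supported U\<close>;
  the contraction maps \<open>x\<close> to this \<open>u\<close>.\<close>

definition contr :: "'v \<Rightarrow> 'v" where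
  "contr x = (THE u. u \<in> supported U \<and> x - d u \<in> supported (U \<union> C))"

lemma contr_eqI:
  assumes "u \<in> supported U" "x - d u \<in> supported (U \<union> C)"
  shows "contr x = u"
  unfolding contr_def
proof (rule the_equality)
  fix v assume v: "v \<in> supported U \<and> x - d v \<in> supported (U \<union> C)"
  have "d (v - u) = (x - d u) - (x - d v)" by (simp add: klin_diff[OF klin_d])
  then have "d (v - u) \<in> supported (U \<union> C)" using v assms supported_diff by metis
  then have "v - u = 0" using v assms by (intro d_injective) (auto simp: supported_diff)
  then show "v = u" by simp
qed (use assms in simp)

lemma contr_lab:
  assumes "x \<in> supported {i. lab i \<in> L}"
  shows "contr x \<in> supported {i\<in>U. lab i \<in> sh ` L}"
    and "x - d (contr x) \<in> supported {i\<in>U \<union> C. lab i \<in> L}"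
proof -
  from decomposition[OF assms] obtain u where
    u: "u \<in> supported {i\<in>U. lab i \<in> sh ` L}" "x - d u \<in> supported {i\<in>U \<union> C. lab i \<in> L}" by blast
  have "contr x = u" by (rule contr_eqI) (use u in \<open>auto intro: supported_mono\<close>)
  then show "contr x \<in> supported {i\<in>U. lab i \<in> sh ` L}" 
    "x - d (contr x) \<in> supported {i\<in>U \<union> C. lab i \<in> L}" using u by auto
qed

lemma contr_in: "contr x \<in> supported U" "x - d (contr x) \<in> supported (U \<union> C)"
proof -
  have "x \<in> supported {i. lab i \<in> UNIV}" by (auto intro: supportedI)
  from contr_lab[OF this] show "contr x \<in> supported U" "x - d (contr x) \<in> supported (U \<union> C)"
    by (auto elim: supported_mono)
qed

lemma contr_d: "u \<in> supported U \<Longrightarrow> contr (d u) = u"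
  by (rule contr_eqI) auto

lemma contr_UC: "x \<in> supported (U \<union> C) \<Longrightarrow> contr x = 0"
  by (rule contr_eqI) (auto simp: klin_zero[OF klin_d])

lemma contr_add: "contr (x + y) = contr x + contr y"
proof (rule contr_eqI)
  have "x + y - d (contr x + contr y) = (x - d (contr x)) + (y - d (contr y))"
    by (simp add: klin_add[OF klin_d])
  then show "x + y - d (contr x + contr y) \<in> supported (U \<union> C)"
    using contr_in supported_add by metis
qed (simp add: contr_in supported_add)

end


section \<open>Monomials and polynomials\<close>

lemma keys_add_nat: "Poly_Mapping.keys (a + b) = Poly_Mapping.keys a \<union> Poly_Mapping.keys b"
  for a b :: "'a \<Rightarrow>\<^sub>0 nat"
  by (auto simp: in_keys_iff lookup_add)

lemma lookup_vexp: "Poly_Mapping.lookup (vexp i) j = (if i = j then 1 else 0)"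
  by (simp add: vexp_def lookup_single when_def)

lemma keys_vexp [simp]: "Poly_Mapping.keys (vexp i) = {i}"
  by (simp add: vexp_def)

lemma vexp_nonzero [simp]: "vexp i \<noteq> 0"
  by (metis keys_vexp keys_zero insert_not_empty)

lemma diff_vexp_add: "i \<in> Poly_Mapping.keys \<alpha> \<Longrightarrow> \<alpha> - vexp i + vexp i = \<alpha>"
  by (rule poly_mapping_eqI) (auto simp: lookup_add lookup_minus lookup_vexp in_keys_iff)

lemma mdeg_zero [simp]: "mdeg 0 = 0"
  by (simp add: mdeg_def)

lemma mdeg_add: "mdeg (\<alpha> + \<beta>) = mdeg \<alpha> + mdeg \<beta>"
  by (simp add: mdeg_def lookup_add sum.distrib)

lemma mdeg_vexp [simp]: "mdeg (vexp i) = 1"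
  by (simp add: mdeg_def lookup_vexp)

lemma finite_mdeg_le: "finite {\<alpha> :: ('n::finite) mon. mdeg \<alpha> \<le> d}"
proof -
  have le: "Poly_Mapping.lookup \<alpha> i \<le> d" if "mdeg \<alpha> \<le> d" for \<alpha> :: "'n mon" and i
    using member_le_sum[of i UNIV "Poly_Mapping.lookup \<alpha>"] that by (simp add: mdeg_def)
  have "finite {f :: 'n \<Rightarrow> nat. \<forall>x. (x \<in> UNIV \<longrightarrow> f x \<in> {..d}) \<and> (x \<notin> UNIV \<longrightarrow> f x = 0)}"
    by (rule finite_set_of_finite_funs) auto
  moreover have "Poly_Mapping.lookup ` {\<alpha> :: 'n mon. mdeg \<alpha> \<le> d}
      \<subseteq> {f. \<forall>x. (x \<in> UNIV \<longrightarrow> f x \<in> {..d}) \<and> (x \<notin> UNIV \<longrightarrow> f x = 0)}"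
    using le by auto
  ultimately have "finite (Poly_Mapping.lookup ` {\<alpha> :: 'n mon. mdeg \<alpha> \<le> d})"
    by (rule finite_subset[rotated])
  then show ?thesis
    by (rule finite_imageD) (auto intro!: inj_onI poly_mapping_eqI)
qed

lemma poly_mapping_expand:
  fixes p :: "'a \<Rightarrow>\<^sub>0 'b::comm_monoid_add"
  shows "p = (\<Sum>k\<in>Poly_Mapping.keys p. Poly_Mapping.single k (Poly_Mapping.lookup p k))"
  by (rule poly_mapping_eqI)
     (auto simp: lookup_sum lookup_single when_def not_in_keys_iff_lookup_eq_zero)

lemma poly_mapping_additive_induct [case_names zero add single]:
  fixes p :: "'a \<Rightarrow>\<^sub>0 'b::comm_monoid_add"
  assumes "P 0" "\<And>p q. P p \<Longrightarrow> P q \<Longrightarrow> P (p + q)" "\<And>k b. P (Poly_Mapping.single k b)"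
  shows "P p"
proof -
  have "P (\<Sum>k\<in>A. Poly_Mapping.single k (Poly_Mapping.lookup p k))" for A
    by (induction A rule: infinite_finite_induct) (auto intro: assms)
  then show ?thesis using poly_mapping_expand[of p] by metis
qed

lemma single_mult_eq: "Poly_Mapping.single \<gamma> c * p =
    (\<Sum>\<alpha>\<in>Poly_Mapping.keys p. Poly_Mapping.single (\<gamma> + \<alpha>) (c * Poly_Mapping.lookup p \<alpha>))"
  for p :: "('n, 'k::field) mpoly"
  by (subst (1) poly_mapping_expand[of p]) (simp add: sum_distrib_left mult_single)

lemma lookup_single_mult: "Poly_Mapping.lookup (Poly_Mapping.single \<gamma> c * p) (\<gamma> + \<alpha>) =
    c * Poly_Mapping.lookup p \<alpha>"
  for p :: "('n, 'k::field) mpoly"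
  by (auto simp: single_mult_eq lookup_sum lookup_single when_def not_in_keys_iff_lookup_eq_zero)

lemma lookup_single_mult_neq:
  fixes p :: "('n, 'k::field) mpoly"
  assumes "\<And>\<alpha>. \<beta> \<noteq> \<gamma> + \<alpha>"
  shows "Poly_Mapping.lookup (Poly_Mapping.single \<gamma> c * p) \<beta> = 0"
  unfolding single_mult_eq lookup_sum lookup_single when_def using assms
  by (intro sum.neutral) metis

lemma lookup_const_mult: "Poly_Mapping.lookup (const c * p) \<alpha> = c * Poly_Mapping.lookup p \<alpha>"
  for p :: "('n, 'k::field) mpoly"
  using lookup_single_mult[of 0 c p \<alpha>] by (simp add: const_def)

lemma lookup_var_mult_zero: "Poly_Mapping.lookup (var i * p) 0 = 0"
  for p :: "('n, 'k::field) mpoly"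
  unfolding var_def monom_def
proof (rule lookup_single_mult_neq)
  fix \<alpha> :: "'n mon"
  have "i \<in> Poly_Mapping.keys (vexp i + \<alpha>)" by (simp add: keys_add_nat)
  then show "0 \<noteq> vexp i + \<alpha>" by (metis keys_zero empty_iff)
qed

lemma const_mult: "const a * const b = const (a * b)"
  by (simp add: const_def mult_single)

lemma const_add: "const a + const b = const (a + b)"
  by (simp add: const_def single_add)

lemma const_one [simp]: "const 1 = 1"
  by (simp add: const_def)

lemma const_zero [simp]: "const 0 = 0"
  by (simp add: const_def)

lemma const_uminus: "const (- a) = - const a"
  by (simp add: const_def single_uminus)

lemma const_monom: "const c * monom \<alpha> = Poly_Mapping.single \<alpha> c"
  by (simp add: const_def monom_def mult_single)

lemma monom_mult: "monom \<alpha> * monom \<beta> = monom (\<alpha> + \<beta>)"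
  by (simp add: monom_def mult_single)

lemma monom_zero [simp]: "monom 0 = 1"
  by (simp add: monom_def)

lemma module_mult: "module ((*) :: ('n, 'k::field) mpoly \<Rightarrow> _ \<Rightarrow> _)"
  by unfold_locales (auto simp: algebra_simps)

lemma irrelevant_constant_coeff:
  assumes "p \<in> irrelevant"
  shows "Poly_Mapping.lookup p 0 = 0"
proof -
  interpret R: module "(*) :: ('n, 'k::field) mpoly \<Rightarrow> _ \<Rightarrow> _" by (rule module_mult)
  from assms have "p \<in> R.span {var i | i. True}" by (simp add: irrelevant_def)
  then show ?thesis
    by (induction rule: R.span_induct_alt)
       (auto simp: lookup_add mult.commute[of _ "var _"] lookup_var_mult_zero)
qed

lemma monom_irrelevant:
  fixes \<alpha> :: "'n mon"
  assumes "\<alpha> \<noteq> 0"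
  shows "(monom \<alpha> :: ('n, 'k::field) mpoly) \<in> irrelevant"
proof -
  interpret R: module "(*) :: ('n, 'k::field) mpoly \<Rightarrow> _ \<Rightarrow> _" by (rule module_mult)
  from assms obtain i where i: "i \<in> Poly_Mapping.keys \<alpha>"
    by (metis poly_mapping_eqI lookup_zero in_keys_iff)
  have "(monom \<alpha> :: ('n, 'k) mpoly) = monom (\<alpha> - vexp i) * var i"
    using diff_vexp_add[OF i] by (simp add: var_def monom_mult)
  moreover have "(monom (\<alpha> - vexp i) * var i :: ('n, 'k) mpoly) \<in> irrelevant"
    unfolding irrelevant_def by (intro R.span_scale R.span_base) auto
  ultimately show ?thesis by simp
qed


section \<open>The free module\<close>

lemma lookup_free_scale: "Poly_Mapping.lookup (free_scale p f) j = p * Poly_Mapping.lookup f j"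
  by (auto simp: free_scale_def Poly_Mapping.map.rep_eq when_def)

lemma module_free_scale: "module free_scale"
  by unfold_locales
     (auto intro!: poly_mapping_eqI simp: lookup_free_scale lookup_add algebra_simps)

text \<open>The free module has the terms \<open>x\<^sup>\<alpha> g\<^sub>j\<close> as a \<open>k\<close>-basis; \<open>fcf f t\<close> is the coefficient of \<open>f\<close> at
  the term \<open>t\<close> and \<open>fbas t\<close> is this term as an element. All \<open>j\<close> are admitted, so \<open>free_mod r\<close> is
  the coordinate subspace with \<open>j < r\<close>.\<close>

definition fcf :: "('n, 'k::field) fmod \<Rightarrow> 'n mon \<times> nat \<Rightarrow> 'k" where
  "fcf f t = Poly_Mapping.lookup (Poly_Mapping.lookup f (snd t)) (fst t)"

definition fbas :: "'n mon \<times> nat \<Rightarrow> ('n, 'k::field) fmod" where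
  "fbas t = fterm (fst t) (snd t)"

lemma finite_terms: "finite (terms f)"
proof -
  have "terms f \<subseteq> (\<Union>j\<in>Poly_Mapping.keys f. (\<lambda>\<alpha>. (\<alpha>, j)) ` Poly_Mapping.keys (Poly_Mapping.lookup f j))"
  proof
    fix t assume "t \<in> terms f"
    then obtain \<alpha> j where t: "t = (\<alpha>, j)" "\<alpha> \<in> Poly_Mapping.keys (Poly_Mapping.lookup f j)"
      by (auto simp: terms_def)
    then have "j \<in> Poly_Mapping.keys f" by (auto simp: in_keys_iff)
    with t show "t \<in> (\<Union>j\<in>Poly_Mapping.keys f. (\<lambda>\<alpha>. (\<alpha>, j)) ` Poly_Mapping.keys (Poly_Mapping.lookup f j))"
      by auto
  qed
  then show ?thesis by (rule finite_subset) auto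
qed

lemma terms_fcf: "terms f = {t. fcf f t \<noteq> 0}"
  by (auto simp: terms_def fcf_def in_keys_iff)

lemma fcf_fbas: "fcf (fbas t) u = (if u = t then 1 else 0)"
  by (cases t; cases u) (auto simp: fcf_def fbas_def fterm_def monom_def lookup_single when_def)

interpretation fr: coords UNIV "\<lambda>c. free_scale (const c)" fcf fbas
proof
  fix x y :: "('n, 'k::field) fmod" assume eq: "\<And>t. fcf x t = fcf y t"
  show "x = y"
  proof (intro poly_mapping_eqI)
    fix j \<alpha>
    show "Poly_Mapping.lookup (Poly_Mapping.lookup x j) \<alpha> = Poly_Mapping.lookup (Poly_Mapping.lookup y j) \<alpha>"
      using eq[of "(\<alpha>, j)"] by (simp add: fcf_def)
  qed
next
  show "finite {t. fcf f t \<noteq> 0}" for f :: "('n, 'k::field) fmod"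
    using finite_terms[of f] by (simp add: terms_fcf)
qed (simp_all add: fcf_fbas, simp_all add: fcf_def lookup_add lookup_free_scale lookup_const_mult)

lemma terms_supp: "terms f = fr.supp f"
  by (simp add: terms_fcf fr.supp_def)

lemma free_mod_iff: "f \<in> free_mod r \<longleftrightarrow> (\<forall>j. Poly_Mapping.lookup f j \<noteq> 0 \<longrightarrow> j < r)"
  by (auto simp: free_mod_def in_keys_iff)

lemma free_mod_eq: "free_mod r = fr.supported {t. snd t < r}"
proof (intro set_eqI iffI)
  fix f :: "('n, 'k::field) fmod"
  assume "f \<in> free_mod r"
  then show "f \<in> fr.supported {t. snd t < r}"
    by (intro fr.supportedI) (metis (mono_tags, lifting) free_mod_iff fcf_def lookup_zero mem_Collect_eq)
next
  fix f :: "('n, 'k::field) fmod"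
  assume f: "f \<in> fr.supported {t. snd t < r}"
  show "f \<in> free_mod r" unfolding free_mod_iff
  proof (intro allI impI)
    fix j assume "Poly_Mapping.lookup f j \<noteq> 0"
    then obtain \<alpha> where "Poly_Mapping.lookup (Poly_Mapping.lookup f j) \<alpha> \<noteq> 0"
      by (metis poly_mapping_eqI lookup_zero)
    then show "j < r" using fr.supportedD[OF f, of "(\<alpha>, j)"] by (simp add: fcf_def)
  qed
qed

lemma free_mod_add: "f \<in> free_mod r \<Longrightarrow> g \<in> free_mod r \<Longrightarrow> f + g \<in> free_mod r"
  by (simp add: free_mod_eq fr.supported_add)

lemma free_mod_scale: "f \<in> free_mod r \<Longrightarrow> free_scale p f \<in> free_mod r"
  unfolding free_mod_iff lookup_free_scale by (metis mult_zero_right)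

lemma fbas_free_mod: "snd t < r \<Longrightarrow> fbas t \<in> free_mod r"
  by (simp add: free_mod_eq fr.supported_bas)

lemma free_scale_monom_fbas: "free_scale (monom \<gamma>) (fbas (\<alpha>, j)) = fbas (\<gamma> + \<alpha>, j)"
  by (rule poly_mapping_eqI)
     (auto simp: lookup_free_scale fbas_def fterm_def lookup_single when_def monom_mult)

lemma terms_free_scale:
  assumes "t \<in> terms (free_scale p f)"
  shows "\<exists>\<gamma> \<alpha>. \<gamma> \<in> Poly_Mapping.keys p \<and> (\<alpha>, snd t) \<in> terms f \<and> fst t = \<gamma> + \<alpha>"
proof -
  have "fst t \<in> Poly_Mapping.keys (p * Poly_Mapping.lookup f (snd t))"
    using assms by (auto simp: terms_def lookup_free_scale)
  then have "fst t \<in> {a + b | a b. a \<in> Poly_Mapping.keys p \<and> b \<in> Poly_Mapping.keys (Poly_Mapping.lookup f (snd t))}"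
    using keys_mult by blast
  then show ?thesis by (auto simp: terms_def)
qed

lemma fcf_free_scale_monom: "fcf (free_scale (monom \<gamma>) f) (\<gamma> + \<alpha>, j) = fcf f (\<alpha>, j)"
  using lookup_single_mult[of \<gamma> 1] by (simp add: fcf_def lookup_free_scale monom_def)


section \<open>Graded modules\<close>

text \<open>The homogeneous components form a direct sum.\<close>

lemma graded_module_independent:
  fixes x :: "int \<Rightarrow> 'm::ab_group_add"
  assumes gm: "graded_module scale Mg" and fin: "finite E"
    and mem: "\<And>e. e \<in> E \<Longrightarrow> x e \<in> Mg e" and zero: "(\<Sum>e\<in>E. x e) = 0" and e: "e \<in> E"
  shows "x e = 0"
proof -
  define h where "h e = (if e \<in> E then x e else 0)" for e
  have fh: "finite {e. h e \<noteq> 0}" by (rule finite_subset[OF _ fin]) (auto simp: h_def)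
  define c where "c = Poly_Mapping.Abs_poly_mapping h"
  have lc: "Poly_Mapping.lookup c = h" unfolding c_def using fh by simp
  have "(\<Sum>e\<in>Poly_Mapping.keys c. Poly_Mapping.lookup c e) = (\<Sum>e\<in>E. x e)"
    by (rule sum.mono_neutral_cong_left[OF fin]) (auto simp: in_keys_iff lc h_def split: if_splits)
  then have 1: "0 = (\<Sum>e\<in>Poly_Mapping.keys c. Poly_Mapping.lookup c e)" using zero by simp
  have Mg0: "\<forall>e. 0 \<in> Mg e" using gm unfolding graded_module_def by blast
  have 2: "\<forall>e. Poly_Mapping.lookup c e \<in> Mg e" using mem Mg0 by (auto simp: lc h_def)
  have "\<exists>!c :: int \<Rightarrow>\<^sub>0 'm. (\<forall>e. Poly_Mapping.lookup c e \<in> Mg e) \<and>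
        0 = (\<Sum>e\<in>Poly_Mapping.keys c. Poly_Mapping.lookup c e)"
    using gm unfolding graded_module_def by blast
  moreover have "(\<forall>e. Poly_Mapping.lookup (0 :: int \<Rightarrow>\<^sub>0 'm) e \<in> Mg e) \<and>
        0 = (\<Sum>e\<in>Poly_Mapping.keys (0 :: int \<Rightarrow>\<^sub>0 'm). Poly_Mapping.lookup (0 :: int \<Rightarrow>\<^sub>0 'm) e)"
    using Mg0 by simp
  ultimately have "c = 0" using 1 2 by blast
  then have "h e = 0" using lc by (metis lookup_zero)
  then show ?thesis using e by (simp add: h_def)
qed


section \<open>The standard basis of a module with initially linear syzygies\<close>

lemma term_order_trans:
  assumes "term_order r prec" "prec x y" "prec y z" "snd x < r" "snd y < r" "snd z < r"
  shows "prec x z"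
  using assms(1)[unfolded term_order_def, THEN conjunct2, THEN conjunct1] assms(2-)
  by (metis prod.collapse)

lemma term_order_total:
  assumes "term_order r prec" "x \<noteq> y" "snd x < r" "snd y < r"
  shows "prec x y \<or> prec y x"
  using assms(1)[unfolded term_order_def, THEN conjunct2, THEN conjunct2, THEN conjunct1] assms(2-)
  by (metis prod.collapse)

lemma prec_maximum:
  assumes to: "term_order r prec" and fin: "finite A" and ne: "A \<noteq> {}" and A: "\<And>t. t \<in> A \<Longrightarrow> snd t < r"
  shows "\<exists>t\<in>A. \<forall>u\<in>A. u \<noteq> t \<longrightarrow> prec u t"
  using fin ne A
proof (induction rule: finite_ne_induct)
  case (insert a F)
  have "\<exists>t\<in>F. \<forall>u\<in>F. u \<noteq> t \<longrightarrow> prec u t" by (rule insert.IH) (simp add: insert.prems)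
  then obtain t where t: "t \<in> F" "\<And>u. u \<in> F \<Longrightarrow> u \<noteq> t \<Longrightarrow> prec u t" by blast
  have trans: "prec x z" if "prec x y" "prec y z" "snd x < r" "snd y < r" "snd z < r" for x y z
    using to that by (rule term_order_trans)
  have "a \<noteq> t" using insert t by auto
  then have "prec a t \<or> prec t a"
    using insert.prems t(1) by (intro term_order_total[OF to]) auto
  then show ?case
  proof
    assume "prec a t"
    then show ?thesis using t by auto
  next
    assume "prec t a"
    then have "\<forall>u\<in>insert a F. u \<noteq> a \<longrightarrow> prec u a"
      using t trans insert.prems by (metis insert_iff)
    then show ?thesis by blast
  qed
qed auto

text \<open>A graded module with a presentation that has initially linear syzygies.\<close>

locale initially_linear =
  fixes scale :: "('n::{finite, linorder}, 'k::field) mpoly \<Rightarrow> 'm::ab_group_add \<Rightarrow> 'm"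
    and Mg :: "int \<Rightarrow> 'm set"
    and r :: nat
    and dg :: "nat \<Rightarrow> int"
    and eta :: "('n, 'k) fmod \<Rightarrow> 'm"
    and prec :: "'n mon \<times> nat \<Rightarrow> 'n mon \<times> nat \<Rightarrow> bool"
  assumes graded: "graded_module scale Mg"
    and presentation: "graded_presentation scale Mg r dg eta"
    and order: "term_order r prec"
    and linear: "initially_linear_syzygies r eta prec"
begin

sublocale M: module scale
  using graded by (simp add: graded_module_def)

sublocale fs: module "free_scale :: ('n, 'k) mpoly \<Rightarrow> _"
  by (rule module_free_scale)

lemma prec_irrefl: "snd t < r \<Longrightarrow> \<not> prec t t"
  using order unfolding term_order_def by (cases t) auto

lemma prec_trans: "prec x y \<Longrightarrow> prec y z \<Longrightarrow> snd x < r \<Longrightarrow> snd y < r \<Longrightarrow> snd z < r \<Longrightarrow> prec x z"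
  using order by (rule term_order_trans)

lemma prec_mult: "prec (\<alpha>, i) (\<beta>, j) \<Longrightarrow> i < r \<Longrightarrow> j < r \<Longrightarrow> prec (\<gamma> + \<alpha>, i) (\<gamma> + \<beta>, j)"
proof -
  assume "prec (\<alpha>, i) (\<beta>, j)" "i < r" "j < r"
  then have "prec (\<alpha> + \<gamma>, i) (\<beta> + \<gamma>, j)" using order unfolding term_order_def by blast
  then show ?thesis by (simp add: add.commute)
qed

lemma prec_increase: "\<gamma> \<noteq> 0 \<Longrightarrow> i < r \<Longrightarrow> prec (\<alpha>, i) (\<alpha> + \<gamma>, i)"
  using order unfolding term_order_def by auto

lemma eta_add: "f \<in> free_mod r \<Longrightarrow> h \<in> free_mod r \<Longrightarrow> eta (f + h) = eta f + eta h"
  and eta_scale: "f \<in> free_mod r \<Longrightarrow> eta (free_scale p f) = scale p (eta f)"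
  using presentation by (auto simp: graded_presentation_def linear_on_def)

lemma free_mod_zero: "0 \<in> free_mod r"
  by (simp add: free_mod_def)

lemma eta_zero [simp]: "eta 0 = 0"
  using eta_add[OF free_mod_zero free_mod_zero] by simp

lemma free_mod_diff: "f \<in> free_mod r \<Longrightarrow> h \<in> free_mod r \<Longrightarrow> f - h \<in> free_mod r"
  by (simp add: free_mod_eq fr.supported_diff)

lemma eta_diff: "f \<in> free_mod r \<Longrightarrow> h \<in> free_mod r \<Longrightarrow> eta (f - h) = eta f - eta h"
  using eta_add[of "f - h" h] free_mod_diff[of f h] by (simp add: algebra_simps)

lemma free_mod_sum: "(\<And>a. a \<in> A \<Longrightarrow> f a \<in> free_mod r) \<Longrightarrow> (\<Sum>a\<in>A. f a) \<in> free_mod r"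
  by (simp add: free_mod_eq fr.supported_sum)

lemma eta_sum:
  assumes "\<And>a. a \<in> A \<Longrightarrow> f a \<in> free_mod r"
  shows "eta (\<Sum>a\<in>A. f a) = (\<Sum>a\<in>A. eta (f a))"
  using assms
  by (induction A rule: infinite_finite_induct) (auto simp: eta_add free_mod_sum)

text \<open>The degree of the term \<open>x\<^sup>\<alpha> g\<^sub>j\<close>.\<close>

definition tdeg :: "'n mon \<times> nat \<Rightarrow> int" where
  "tdeg t = int (mdeg (fst t)) + dg (snd t)"

lemma eta_homog: "f \<in> fr.supported {t. snd t < r \<and> tdeg t = e} \<Longrightarrow> eta f \<in> Mg e"
proof -
  assume f: "f \<in> fr.supported {t. snd t < r \<and> tdeg t = e}"
  have "f \<in> free_homog r dg e"
    using f by (auto simp: free_homog_def free_mod_eq terms_supp fr.supported_def tdeg_def)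
  then show ?thesis using presentation by (auto simp: graded_presentation_def)
qed

lemma syz_iff: "f \<in> syz r eta \<longleftrightarrow> f \<in> free_mod r \<and> eta f = 0"
  by (simp add: syz_def)

lemma homogeneous_sum:
  fixes f :: "('n, 'k) fmod"
  shows "f = (\<Sum>e\<in>tdeg ` fr.supp f. fr.restr {t. tdeg t = e} f)"
proof (rule fr.cf_eqI)
  fix t
  have "fcf (\<Sum>e\<in>tdeg ` fr.supp f. fr.restr {t. tdeg t = e} f) t
      = (\<Sum>e\<in>tdeg ` fr.supp f. if e = tdeg t then fcf f t else 0)"
    unfolding fr.cf_sum by (rule sum.cong) (auto simp: fr.cf_restr)
  also have "\<dots> = fcf f t"
  proof (cases "t \<in> fr.supp f")
    case False
    then have "fcf f t = 0" by (simp add: fr.supp_def)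
    then show ?thesis by simp
  qed simp
  finally show "fcf f t = fcf (\<Sum>e\<in>tdeg ` fr.supp f. fr.restr {t. tdeg t = e} f) t" ..
qed

text \<open>\<open>\<eta>\<close> maps the component of \<open>f\<close> of degree \<open>e\<close> to the component of \<open>\<eta> f\<close> of degree \<open>e\<close>. It
  vanishes if \<open>\<eta> f\<close> is homogeneous of another degree or zero.\<close>

lemma eta_component_zero:
  assumes f: "f \<in> free_mod r" and mem: "eta f \<in> Mg e'" and e: "e \<noteq> e' \<or> eta f = 0"
  shows "eta (fr.restr {t. tdeg t = e} f) = 0"
proof -
  let ?h = "\<lambda>e. fr.restr {t. tdeg t = e} f"
  have sup: "?h e \<in> fr.supported {t. snd t < r \<and> tdeg t = e}" for e
    using f fr.supportedD[of f "{t. snd t < r}"]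
    by (intro fr.supportedI) (auto simp: fr.cf_restr free_mod_eq split: if_splits)
  have fm: "?h e \<in> free_mod r" for e
    using sup[of e] by (auto simp: free_mod_eq elim: fr.supported_mono)
  define E where "E = insert e' (insert e (tdeg ` fr.supp f))"
  define x where "x a = eta (?h a) - (if a = e' then eta f else 0)" for a
  have out: "?h a = 0" if "a \<notin> tdeg ` fr.supp f" for a
    by (rule fr.restr_disjoint[OF fr.supported_supp]) (use that in auto)
  have "(\<Sum>a\<in>E. ?h a) = (\<Sum>a\<in>tdeg ` fr.supp f. ?h a)"
    by (rule sum.mono_neutral_right) (auto simp: E_def out)
  then have "(\<Sum>a\<in>E. ?h a) = f" using homogeneous_sum[of f] by simp
  then have "(\<Sum>a\<in>E. eta (?h a)) = eta f" using eta_sum[of E ?h] fm by simp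
  then have "(\<Sum>a\<in>E. x a) = 0"
    by (simp add: x_def sum_subtractf E_def)
  moreover have "x a \<in> Mg a" for a
  proof -
    have 1: "eta (?h a) \<in> Mg a" using sup by (rule eta_homog)
    have neg: "- y \<in> Mg a" if "y \<in> Mg a" for y a
    proof -
      have h: "(- 1 :: ('n, 'k) mpoly) \<in> homog 0"
      proof -
        have "(- 1 :: ('n, 'k) mpoly) = const (- 1)" by (simp add: const_uminus)
        then show ?thesis by (auto simp: homog_def const_def split: if_splits)
      qed
      have "scale (- 1) y \<in> Mg (int 0 + a)"
        using graded h that unfolding graded_module_def by blast
      then show ?thesis by simp
    qed
    have "u + v \<in> Mg a" if "u \<in> Mg a" "v \<in> Mg a" for u v
      using graded that unfolding graded_module_def by blast
    from this[OF 1 neg] 1 show ?thesis using mem by (auto simp: x_def)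
  qed
  ultimately have "x e = 0"
    by (intro graded_module_independent[OF graded, of E x e]) (auto simp: E_def)
  then show ?thesis using e by (auto simp: x_def split: if_splits)
qed

lemma syz_component: "f \<in> syz r eta \<Longrightarrow> fr.restr {t. tdeg t = e} f \<in> syz r eta"
proof -
  assume f: "f \<in> syz r eta"
  have "0 \<in> Mg e" using graded by (auto simp: graded_module_def)
  then have "eta (fr.restr {t. tdeg t = e} f) = 0"
    using f by (intro eta_component_zero[of f e]) (auto simp: syz_iff)
  moreover have "fr.restr {t. tdeg t = e} f \<in> free_mod r"
    using f fr.supportedD[of f "{t. snd t < r}"]
    by (auto intro!: fr.supportedI simp: syz_iff fr.cf_restr free_mod_eq split: if_splits)
  ultimately show ?thesis by (simp add: syz_iff)
qed

text \<open>The leading terms of syzygies; they are the terms of the initial module, and a term is one of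
  them if and only if it is divisible by some \<open>x\<^sub>i g\<^sub>j\<close> with \<open>i\<close> critical for \<open>g\<^sub>j\<close>.\<close>

definition lead_terms :: "('n mon \<times> nat) set" where
  "lead_terms = {t. \<exists>f\<in>syz r eta. is_lead_term prec f t}"

lemma lead_less: "f \<in> free_mod r \<Longrightarrow> is_lead_term prec f t \<Longrightarrow> snd t < r"
  unfolding is_lead_term_def terms_supp free_mod_eq fr.supported_def by auto

lemma lead_terms_mult: "(\<alpha>, j) \<in> lead_terms \<Longrightarrow> (\<gamma> + \<alpha>, j) \<in> lead_terms"
proof -
  assume "(\<alpha>, j) \<in> lead_terms"
  then obtain f where f: "f \<in> syz r eta" "is_lead_term prec f (\<alpha>, j)" by (auto simp: lead_terms_def)
  have j: "j < r" using f lead_less[of f "(\<alpha>, j)"] by (simp add: syz_iff)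
  have lt: "u \<in> terms f \<Longrightarrow> snd u < r" for u
    using f(1) by (auto simp: syz_iff free_mod_eq terms_supp fr.supported_def)
  have "free_scale (monom \<gamma>) f \<in> syz r eta"
    using f by (simp add: syz_iff free_mod_scale eta_scale)
  moreover have "is_lead_term prec (free_scale (monom \<gamma>) f) (\<gamma> + \<alpha>, j)"
    unfolding is_lead_term_def
  proof (intro conjI ballI impI)
    show "(\<gamma> + \<alpha>, j) \<in> terms (free_scale (monom \<gamma>) f)"
      using f(2) by (simp add: is_lead_term_def terms_fcf fcf_free_scale_monom)
  next
    fix u assume u: "u \<in> terms (free_scale (monom \<gamma>) f)" "u \<noteq> (\<gamma> + \<alpha>, j)"
    from terms_free_scale[OF u(1)] obtain \<beta> where
      b: "(\<beta>, snd u) \<in> terms f" "fst u = \<gamma> + \<beta>" by (auto simp: monom_def)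
    then have "(\<beta>, snd u) \<noteq> (\<alpha>, j)" using u(2) by (cases u) auto
    then have "prec (\<beta>, snd u) (\<alpha>, j)" using f(2) b by (auto simp: is_lead_term_def)
    from prec_mult[OF this, of \<gamma>] show "prec u (\<gamma> + \<alpha>, j)"
      using b lt[OF b(1)] j by (metis prod.collapse snd_conv)
  qed
  ultimately show ?thesis by (auto simp: lead_terms_def)
qed

lemma terms_span:
  assumes f: "f \<in> fs.span X" and X: "\<And>x t. x \<in> X \<Longrightarrow> t \<in> terms x \<Longrightarrow> t \<in> T"
    and T: "\<And>\<alpha> j \<gamma>. (\<alpha>, j) \<in> T \<Longrightarrow> (\<gamma> + \<alpha>, j) \<in> T"
  shows "terms f \<subseteq> T"
  using f
proof (induction rule: fs.span_induct_alt)
  case base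
  then show ?case by (simp add: terms_supp fr.supp_def)
next
  case (step c x y)
  have "t \<in> T" if t: "t \<in> terms (free_scale c x)" for t
    using terms_free_scale[OF t] X[OF step(1)] T by (metis prod.collapse)
  then have "terms (free_scale c x) \<subseteq> T" by blast
  then show ?case
    using step fr.supported_add[of "free_scale c x" T y] by (simp add: fr.supported_def terms_supp)
qed

lemma terms_fterm [simp]: "terms (fterm \<alpha> j :: ('n, 'k) fmod) = {(\<alpha>, j)}"
proof -
  have "fcf (fterm \<alpha> j :: ('n, 'k) fmod) u = (if u = (\<alpha>, j) then 1 else 0)" for u
    using fcf_fbas[of "(\<alpha>, j)" u] by (simp add: fbas_def)
  then show ?thesis by (auto simp: terms_fcf)
qed

lemma initial_module_iff: "fterm \<alpha> j \<in> initial_module prec (syz r eta) \<longleftrightarrow> (\<alpha>, j) \<in> lead_terms"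
proof
  assume "fterm \<alpha> j \<in> initial_module prec (syz r eta)"
  then have "fterm \<alpha> j \<in> fs.span {fterm \<alpha> j | \<alpha> j. \<exists>f\<in>syz r eta. is_lead_term prec f (\<alpha>, j)}"
    by (simp add: initial_module_def)
  then have "terms (fterm \<alpha> j :: ('n, 'k) fmod) \<subseteq> lead_terms"
    by (rule terms_span) (auto simp: lead_terms_mult, auto simp: lead_terms_def)
  then show "(\<alpha>, j) \<in> lead_terms" by simp
next
  assume "(\<alpha>, j) \<in> lead_terms"
  then show "fterm \<alpha> j \<in> initial_module prec (syz r eta)"
    unfolding initial_module_def by (intro fs.span_base) (auto simp: lead_terms_def)
qed

lemma lead_terms_iff: "(\<alpha>, j) \<in> lead_terms \<longleftrightarrow> (\<exists>i\<in>Poly_Mapping.keys \<alpha>. i \<in> crit r eta prec j)"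
proof
  assume "(\<alpha>, j) \<in> lead_terms"
  from linear obtain X where X: "X \<subseteq> {fterm (vexp i) j | i j. j < r}"
    "initial_module prec (syz r eta) = fs.span X"
    by (auto simp: initially_linear_syzygies_def)
  let ?T = "{(\<alpha>, j). \<exists>i\<in>Poly_Mapping.keys \<alpha>. fterm (vexp i) j \<in> X}"
  have "fterm \<alpha> j \<in> fs.span X" using \<open>(\<alpha>, j) \<in> lead_terms\<close> X(2) initial_module_iff by simp
  then have "terms (fterm \<alpha> j :: ('n, 'k) fmod) \<subseteq> ?T"
    by (rule terms_span) (use X(1) in \<open>force simp: keys_add_nat\<close>)+
  then obtain i where "i \<in> Poly_Mapping.keys \<alpha>" "fterm (vexp i) j \<in> X" by auto
  moreover from this have "i \<in> crit r eta prec j"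
    using X(2) fs.span_base[of _ X] by (simp add: crit_def)
  ultimately show "\<exists>i\<in>Poly_Mapping.keys \<alpha>. i \<in> crit r eta prec j" by blast
next
  assume "\<exists>i\<in>Poly_Mapping.keys \<alpha>. i \<in> crit r eta prec j"
  then obtain i where i: "i \<in> Poly_Mapping.keys \<alpha>" "i \<in> crit r eta prec j" by blast
  then have "(vexp i, j) \<in> lead_terms" by (simp add: crit_def initial_module_iff)
  from lead_terms_mult[OF this, of "\<alpha> - vexp i"] show "(\<alpha>, j) \<in> lead_terms"
    using diff_vexp_add[OF i(1)] by simp
qed

text \<open>The standard terms: those that are not leading terms of syzygies.\<close>

definition std :: "('n mon \<times> nat) set" where
  "std = {(\<alpha>, j). j < r \<and> Poly_Mapping.keys \<alpha> \<subseteq> ncrit r eta prec j}"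

lemma std_iff: "t \<in> std \<longleftrightarrow> snd t < r \<and> t \<notin> lead_terms"
  by (cases t) (auto simp: std_def ncrit_def lead_terms_iff)

lemma supported_std_free_mod: "f \<in> fr.supported std \<Longrightarrow> f \<in> free_mod r"
  by (auto simp: free_mod_eq std_iff elim: fr.supported_mono)

text \<open>A non-zero syzygy made of standard terms would have a standard leading term.\<close>

lemma std_independent:
  assumes f: "f \<in> fr.supported std" and "eta f = 0"
  shows "f = 0"
proof (rule ccontr)
  assume "f \<noteq> 0"
  then have ne: "fr.supp f \<noteq> {}" using fr.supported_empty[of f] by (auto simp: fr.supported_def)
  have sf: "fr.supp f \<subseteq> std" using f by (simp add: fr.supported_def)
  obtain t where "t \<in> fr.supp f" "\<forall>u\<in>fr.supp f. u \<noteq> t \<longrightarrow> prec u t"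
    using prec_maximum[OF order fr.finite_supp ne] sf std_iff by blast
  then have "is_lead_term prec f t" by (simp add: is_lead_term_def terms_supp)
  moreover have "f \<in> syz r eta" using assms supported_std_free_mod by (simp add: syz_iff)
  ultimately have "t \<in> lead_terms" by (auto simp: lead_terms_def)
  then show False using sf \<open>t \<in> fr.supp f\<close> std_iff by blast
qed

text \<open>The number of smaller terms of no larger degree. Since the degree is bounded, this number is
  finite, which gives induction along \<open>prec\<close> inside bounded degree.\<close>

definition tmeas :: "'n mon \<times> nat \<Rightarrow> nat" where
  "tmeas t = card {s. snd s < r \<and> tdeg s \<le> tdeg t \<and> prec s t}"

lemma tmeas_less:
  assumes "prec s t" "tdeg s \<le> tdeg t" "snd s < r" "snd t < r"
  shows "tmeas s < tmeas t"
  unfolding tmeas_def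
proof (rule psubset_card_mono)
  have "{s. snd s < r \<and> tdeg s \<le> tdeg t \<and> prec s t}
      \<subseteq> (\<Union>j<r. {\<alpha>. mdeg \<alpha> \<le> nat (tdeg t - dg j)} \<times> {j})"
    by (auto simp: tdeg_def)
  then show "finite {s. snd s < r \<and> tdeg s \<le> tdeg t \<and> prec s t}"
    by (rule finite_subset) (auto simp: finite_mdeg_le)
  have "{u. snd u < r \<and> tdeg u \<le> tdeg s \<and> prec u s} \<subseteq> {u. snd u < r \<and> tdeg u \<le> tdeg t \<and> prec u t}"
    using assms prec_trans by fastforce
  moreover have "s \<notin> {u. snd u < r \<and> tdeg u \<le> tdeg s \<and> prec u s}" using assms prec_irrefl by auto
  moreover have "s \<in> {u. snd u < r \<and> tdeg u \<le> tdeg t \<and> prec u t}" using assms by auto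
  ultimately show "{u. snd u < r \<and> tdeg u \<le> tdeg s \<and> prec u s} \<subset> {u. snd u < r \<and> tdeg u \<le> tdeg t \<and> prec u t}"
    by blast
qed

text \<open>Reduction modulo syzygies: a non-standard term is congruent to a combination of
  smaller standard terms of the same degree.\<close>

lemma reduce_term:
  assumes "snd t < r"
  shows "\<exists>h. h \<in> fr.supported {u\<in>std. tdeg u = tdeg t \<and> (u = t \<or> prec u t) \<and> (t \<notin> std \<longrightarrow> prec u t)}
            \<and> eta h = eta (fbas t)"
  using assms
proof (induction "tmeas t" arbitrary: t rule: less_induct)
  case less
  show ?case
  proof (cases "t \<in> std")
    case True
    then show ?thesis by (intro exI[of _ "fbas t"]) (auto intro!: fr.supported_bas)
  next
    case False
    then have "t \<in> lead_terms" using less.prems std_iff by blast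
    then obtain f0 where f0: "f0 \<in> syz r eta" "is_lead_term prec f0 t" by (auto simp: lead_terms_def)
    \<comment> \<open>A homogeneous syzygy with leading term \<open>t\<close>.\<close>
    define f where "f = fr.restr {u. tdeg u = tdeg t} f0"
    have f: "f \<in> syz r eta" unfolding f_def using f0(1) by (rule syz_component)
    define a where "a = fcf f t"
    have a: "a \<noteq> 0" using f0(2) by (simp add: a_def f_def fr.cf_restr is_lead_term_def terms_fcf)
    define y where "y = fbas t - free_scale (const (1 / a)) f"
    have fm: "f \<in> free_mod r" using f by (simp add: syz_iff)
    have ey: "eta y = eta (fbas t)"
      using f less.prems by (simp add: y_def eta_diff fbas_free_mod free_mod_scale fm eta_scale syz_iff)
    let ?S = "{u. snd u < r \<and> tdeg u = tdeg t \<and> prec u t}"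
    have y: "y \<in> fr.supported ?S"
    proof (rule fr.supportedI)
      fix u assume u: "fcf y u \<noteq> 0"
      have ut: "u \<noteq> t" using u a by (auto simp: y_def fr.cf_diff fr.cf_ks fcf_fbas a_def)
      then have "fcf f u \<noteq> 0" using u by (auto simp: y_def fr.cf_diff fr.cf_ks fcf_fbas)
      then have "tdeg u = tdeg t" "u \<in> terms f0" "snd u < r"
        using fm fr.supportedD[of f "{t. snd t < r}" u]
        by (auto simp: f_def fr.cf_restr terms_fcf free_mod_eq split: if_splits)
      then show "u \<in> ?S" using f0(2) ut by (auto simp: is_lead_term_def)
    qed
    let ?T = "{u\<in>std. tdeg u = tdeg t \<and> prec u t}"
    have "y \<in> free_mod r \<and> (\<exists>h. h \<in> fr.supported ?T \<and> eta h = eta y)"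
      using y
    proof (induction rule: fr.supported_induct)
      case zero
      show ?case by (auto simp: free_mod_zero intro!: exI[of _ 0])
    next
      case (add x y)
      then obtain h k where h: "h \<in> fr.supported ?T" "eta h = eta x" "k \<in> fr.supported ?T" "eta k = eta y"
        by blast
      have "h \<in> free_mod r" "k \<in> free_mod r"
        using h by (auto intro: supported_std_free_mod fr.supported_mono)
      then show ?case using add h
        by (intro conjI exI[of _ "h + k"]) (auto simp: eta_add free_mod_add fr.supported_add)
    next
      case (basis c u)
      then have "tmeas u < tmeas t" using less.prems by (auto intro: tmeas_less)
      from less.hyps[OF this] basis obtain h where
        h: "h \<in> fr.supported {v\<in>std. tdeg v = tdeg u \<and> (v = u \<or> prec v u) \<and> (u \<notin> std \<longrightarrow> prec v u)}"
        "eta h = eta (fbas u)" by auto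
      have hm: "h \<in> free_mod r"
        using h by (auto intro: supported_std_free_mod fr.supported_mono)
      have "prec v t" if "v \<in> std" "v = u \<or> prec v u" for v
        using that basis(1) less.prems std_iff[of v] prec_trans[of v u t] by auto
      then have "h \<in> fr.supported ?T"
        by (intro fr.supported_mono[OF h(1)]) (use basis in auto)
      then show ?case using basis h hm
        by (intro conjI exI[of _ "free_scale (const c) h"])
           (auto simp: fr.supported_ks eta_scale fbas_free_mod free_mod_scale)
    qed
    then obtain h where "h \<in> fr.supported ?T" "eta h = eta y" by blast
    then show ?thesis using False ey
      by (intro exI[of _ h]) (auto elim: fr.supported_mono)
  qed
qed

lemma reduce:
  assumes "f \<in> free_mod r"
  shows "\<exists>h. h \<in> fr.supported std \<and> eta h = eta f"
proof -
  have "f \<in> fr.supported {t. snd t < r}" using assms by (simp add: free_mod_eq)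
  then have "f \<in> free_mod r \<and> (\<exists>h. h \<in> fr.supported std \<and> eta h = eta f)"
  proof (induction rule: fr.supported_induct)
    case zero
    show ?case by (auto simp: free_mod_zero intro!: exI[of _ 0])
  next
    case (add x y)
    then obtain h k where h: "h \<in> fr.supported std" "eta h = eta x" "k \<in> fr.supported std" "eta k = eta y"
      by blast
    then show ?case using add
      by (intro conjI exI[of _ "h + k"])
         (auto simp: eta_add free_mod_add fr.supported_add supported_std_free_mod)
  next
    case (basis c u)
    then obtain h where h: "h \<in> fr.supported std" "eta h = eta (fbas u)"
      using reduce_term[of u] by (auto intro: fr.supported_mono)
    then show ?case using basis
      by (intro conjI exI[of _ "free_scale (const c) h"])
         (auto simp: fr.supported_ks eta_scale fbas_free_mod free_mod_scale supported_std_free_mod)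
  qed
  then show ?thesis by blast
qed

text \<open>The normal form of an element of \<open>M\<close>: its unique preimage that is a combination of standard
  terms.\<close>

definition nf :: "'m \<Rightarrow> ('n, 'k) fmod" where
  "nf m = (THE h. h \<in> fr.supported std \<and> eta h = m)"

lemma nf_eqI: "h \<in> fr.supported std \<Longrightarrow> eta h = m \<Longrightarrow> nf m = h"
  unfolding nf_def
proof (rule the_equality)
  fix k assume h: "h \<in> fr.supported std" "eta h = m" and k: "k \<in> fr.supported std \<and> eta k = m"
  have "k - h = 0"
    using h k by (intro std_independent) (auto simp: fr.supported_diff eta_diff supported_std_free_mod)
  then show "k = h" by simp
qed simp

lemma nf_supported: "nf m \<in> fr.supported std"
  and eta_nf [simp]: "eta (nf m) = m"
proof -
  have "m \<in> eta ` free_mod r" using presentation by (auto simp: graded_presentation_def)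
  then obtain h where h: "h \<in> fr.supported std" "eta h = m" using reduce by blast
  then have "nf m = h" by (rule nf_eqI)
  then show "nf m \<in> fr.supported std" "eta (nf m) = m" using h by auto
qed

lemma nf_free_mod: "nf m \<in> free_mod r"
  by (simp add: nf_supported supported_std_free_mod)

text \<open>The coordinates of \<open>M\<close> in the basis of the standard terms \<open>g t\<close>. The element \<open>g t\<close> is defined
  for all terms \<open>t\<close>.\<close>

definition cM :: "'m \<Rightarrow> 'n mon \<times> nat \<Rightarrow> 'k" where
  "cM m t = fcf (nf m) t"

definition g :: "'n mon \<times> nat \<Rightarrow> 'm" where
  "g t = eta (fbas t)"

sublocale mc: coords std "\<lambda>c. scale (const c)" cM g
proof
  show "cM (x + y) t = cM x t + cM y t" for x y t
  proof -
    have "nf (x + y) = nf x + nf y"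
      by (rule nf_eqI) (auto simp: nf_supported fr.supported_add eta_add nf_free_mod)
    then show ?thesis by (simp add: cM_def fr.cf_add)
  qed
  show "cM (scale (const c) x) t = c * cM x t" for c x t
  proof -
    have "nf (scale (const c) x) = free_scale (const c) (nf x)"
      by (rule nf_eqI) (auto simp: nf_supported fr.supported_ks eta_scale nf_free_mod)
    then show ?thesis by (simp add: cM_def fr.cf_ks)
  qed
  show "finite {t. cM x t \<noteq> 0}" for x
    using fr.finite_supp0 by (simp add: cM_def)
  show "t \<in> std" if "cM x t \<noteq> 0" for x t
    using fr.supportedD[OF nf_supported] that unfolding cM_def .
  show "cM (g t) u = (if u = t then 1 else 0)" if "t \<in> std" for t u
  proof -
    have "nf (g t) = fbas t"
      by (rule nf_eqI) (use that in \<open>auto simp: g_def intro!: fr.supported_bas\<close>)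
    then show ?thesis by (simp add: cM_def fcf_fbas)
  qed
  show "x = y" if "\<And>t. cM x t = cM y t" for x y
  proof -
    have "nf x = nf y" by (rule fr.cf_eqI) (use that in \<open>simp add: cM_def\<close>)
    then show ?thesis by (metis eta_nf)
  qed
qed

lemma scale_monom_g: "snd t < r \<Longrightarrow> scale (monom \<gamma>) (g t) = g (\<gamma> + fst t, snd t)"
  using arg_cong[OF free_scale_monom_fbas[of \<gamma> "fst t" "snd t"], of eta]
  by (simp add: g_def eta_scale fbas_free_mod)

text \<open>The expansion of an arbitrary term in the basis of standard terms. That a non-standard term, such
  as a critical variable times a standard term, involves only smaller terms is what makes the matching
  for \<open>\<phi>\<close> triangular.\<close>

lemma cM_g:
  assumes "snd t < r" "cM (g t) u \<noteq> 0"
  shows "u \<in> std" "tdeg u = tdeg t" "t \<notin> std \<Longrightarrow> prec u t"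
proof -
  from reduce_term[OF assms(1)] obtain h where
    h: "h \<in> fr.supported {u\<in>std. tdeg u = tdeg t \<and> (u = t \<or> prec u t) \<and> (t \<notin> std \<longrightarrow> prec u t)}"
     "eta h = eta (fbas t)" by blast
  then have "nf (g t) = h" by (intro nf_eqI) (auto simp: g_def elim: fr.supported_mono)
  then have "fcf h u \<noteq> 0" using assms by (simp add: cM_def)
  from fr.supportedD[OF h(1) this] show "u \<in> std" "tdeg u = tdeg t" "t \<notin> std \<Longrightarrow> prec u t" by auto
qed

text \<open>The submodule \<open>\<mm> M\<close> does not involve the generators: the difference between \<open>x\<^sub>i\<close> times the
  normal form of \<open>m\<close> and the normal form of \<open>x\<^sub>i m\<close> is a syzygy, and syzygies have coefficients in
  \<open>\<mm>\<close>.\<close>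

lemma cM_var_zero: "cM (scale (var i) m) (0, j) = 0"
proof (cases "j < r")
  case True
  let ?f = "free_scale (var i) (nf m) - nf (scale (var i) m)"
  have "?f \<in> syz r eta"
    by (simp add: syz_iff free_mod_diff free_mod_scale nf_free_mod eta_diff eta_scale)
  then have "Poly_Mapping.lookup ?f j \<in> irrelevant"
    using linear True by (auto simp: initially_linear_syzygies_def)
  then have "Poly_Mapping.lookup (Poly_Mapping.lookup ?f j) 0 = 0" by (rule irrelevant_constant_coeff)
  then show ?thesis
    by (simp add: cM_def fcf_def lookup_minus lookup_free_scale lookup_var_mult_zero)
next
  case False
  then have "(0, j) \<notin> std" by (simp add: std_def)
  then show ?thesis using mc.supp_K0 by blast
qed

lemma Mg_iff: "m \<in> Mg e \<longleftrightarrow> m \<in> mc.supported {t. tdeg t = e}"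
proof
  assume m: "m \<in> Mg e"
  show "m \<in> mc.supported {t. tdeg t = e}"
  proof (rule mc.supportedI)
    fix t assume nz: "cM m t \<noteq> 0"
    show "t \<in> {t. tdeg t = e}"
    proof (rule ccontr)
      assume "\<not> ?thesis"
      then have ne: "tdeg t \<noteq> e" by simp
      let ?h = "fr.restr {u. tdeg u = tdeg t} (nf m)"
      have "eta ?h = 0"
        by (rule eta_component_zero[of _ e]) (use m ne in \<open>auto simp: nf_free_mod\<close>)
      moreover have "?h \<in> fr.supported std"
        using fr.supportedD[OF nf_supported]
        by (intro fr.supportedI) (auto simp: fr.cf_restr split: if_splits)
      ultimately have "?h = 0" using std_independent by blast
      then have "fcf ?h t = 0" by simp
      then show False using nz by (simp add: cM_def fr.cf_restr)
    qed
  qed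
next
  assume m: "m \<in> mc.supported {t. tdeg t = e}"
  have "nf m \<in> fr.supported {t. snd t < r \<and> tdeg t = e}"
    using mc.supportedD[OF m] fr.supportedD[OF nf_supported] std_iff
    by (intro fr.supportedI) (auto simp: cM_def)
  from eta_homog[OF this] show "m \<in> Mg e" by simp
qed

end


section \<open>The complex \<open>F\<close>\<close>

lemma sum_antisymmetric:
  fixes a :: "'i \<Rightarrow> 'i \<Rightarrow> 'b::ab_group_add"
  assumes "finite I" "\<And>i j. i \<in> I \<Longrightarrow> j \<in> I \<Longrightarrow> i \<noteq> j \<Longrightarrow> a i j = - a j i"
  shows "(\<Sum>i\<in>I. \<Sum>j\<in>I - {i}. a i j) = 0"
  using assms
proof (induction I)
  case (insert k I)
  have "(\<Sum>j\<in>insert k I - {i}. a i j) = a i k + (\<Sum>j\<in>I - {i}. a i j)" if "i \<in> I" for i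
  proof -
    have "insert k I - {i} = insert k (I - {i})" using that insert.hyps by auto
    then show ?thesis using insert.hyps by simp
  qed
  then have "(\<Sum>i\<in>I. \<Sum>j\<in>insert k I - {i}. a i j) = (\<Sum>i\<in>I. a i k) + (\<Sum>i\<in>I. \<Sum>j\<in>I - {i}. a i j)"
    by (simp add: sum.distrib)
  moreover have "(\<Sum>i\<in>I. \<Sum>j\<in>I - {i}. a i j) = 0"
    by (rule insert.IH) (rule insert.prems, auto)
  moreover have "(\<Sum>j\<in>insert k I - {k}. a k j) = (\<Sum>j\<in>I. - a j k)"
  proof (rule sum.cong)
    show "insert k I - {k} = I" using insert.hyps by auto
    show "a k j = - a j k" if "j \<in> I" for j
      by (rule insert.prems) (use that insert.hyps in auto)
  qed
  ultimately show ?case using insert.hyps by (simp add: sum_negf)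
qed simp

text \<open>The sign \<open>\<epsilon>(i; I)\<close> as a scalar.\<close>

definition sg :: "'n::linorder \<Rightarrow> 'n set \<Rightarrow> 'k::field" where
  "sg i I = (- 1) ^ card {j \<in> I. j < i}"

lemma eps_const: "eps i I = const (sg i I)"
proof -
  have "(- 1) ^ k = (const ((- 1) ^ k) :: ('n, 'k::field) mpoly)" for k :: nat
    by (induction k) (simp_all add: const_uminus)
  then show ?thesis by (simp add: eps_def sg_def)
qed

lemma sg_nonzero [simp]: "sg i I \<noteq> 0"
  by (simp add: sg_def)

lemma sg_antisym:
  fixes i j :: "'n::{finite, linorder}"
  assumes "i \<in> I" "j \<in> I" "i \<noteq> j"
  shows "sg i I * sg j (I - {i}) = - (sg j I * sg i (I - {j}) :: 'k::field)"
proof -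
  have *: "sg i I * sg j (I - {i}) = - (sg j I * sg i (I - {j}) :: 'k)"
    if "i \<in> I" "j \<in> I" "i < j" for i j :: 'n
  proof -
    have 1: "{k \<in> I - {j}. k < i} = {k \<in> I. k < i}" using that by auto
    have 2: "{k \<in> I. k < j} = insert i {k \<in> I - {i}. k < j}" using that by auto
    have "card {k \<in> I. k < j} = Suc (card {k \<in> I - {i}. k < j})"
      unfolding 2 by (rule card_insert_disjoint) auto
    then show ?thesis unfolding sg_def 1 by simp
  qed
  show ?thesis
  proof (cases "i < j")
    case False
    then have "j < i" using assms by simp
    from *[OF assms(2,1) this] show ?thesis by simp
  qed (use * assms in blast)
qed

context initially_linear
begin

abbreviation FS :: "('n, 'k) mpoly \<Rightarrow> ('n, 'm) fcx \<Rightarrow> ('n, 'm) fcx" where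
  "FS \<equiv> F_scale scale"

abbreviation sc :: "'k \<Rightarrow> 'm \<Rightarrow> 'm" where
  "sc c \<equiv> scale (const c)"

lemma FS_single_right:
  "FS p (Poly_Mapping.single (\<beta>, I) m) =
     (\<Sum>\<gamma>\<in>Poly_Mapping.keys p. Poly_Mapping.single (\<gamma> + \<beta>, I) (sc (Poly_Mapping.lookup p \<gamma>) m))"
  by (cases "m = 0") (simp_all add: F_scale_def)

lemma FS_expand: "FS p u = (\<Sum>b\<in>Poly_Mapping.keys u. FS p (Poly_Mapping.single b (Poly_Mapping.lookup u b)))"
proof -
  have "FS p u = (\<Sum>\<gamma>\<in>Poly_Mapping.keys p. \<Sum>b\<in>Poly_Mapping.keys u.
      Poly_Mapping.single (\<gamma> + fst b, snd b) (sc (Poly_Mapping.lookup p \<gamma>) (Poly_Mapping.lookup u b)))"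
    unfolding F_scale_def by (intro sum.cong refl) auto
  also have "\<dots> = (\<Sum>b\<in>Poly_Mapping.keys u. \<Sum>\<gamma>\<in>Poly_Mapping.keys p.
      Poly_Mapping.single (\<gamma> + fst b, snd b) (sc (Poly_Mapping.lookup p \<gamma>) (Poly_Mapping.lookup u b)))"
    by (rule sum.swap)
  also have "\<dots> = (\<Sum>b\<in>Poly_Mapping.keys u. FS p (Poly_Mapping.single b (Poly_Mapping.lookup u b)))"
    by (intro sum.cong refl) (auto simp: FS_single_right)
  finally show ?thesis .
qed

lemma FS_single_add: "FS p (Poly_Mapping.single b (m + m')) = FS p (Poly_Mapping.single b m) + FS p (Poly_Mapping.single b m')"
  by (cases b, simp only: FS_single_right) (simp only: M.scale_right_distrib single_add sum.distrib)

lemma FS_zero_right [simp]: "FS p 0 = 0"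
  by (simp add: F_scale_def)

lemma FS_add_right: "FS p (u + v) = FS p u + FS p v"
  unfolding FS_expand[of p "u + v"] FS_expand[of p u] FS_expand[of p v]
  by (rule setsum_keys_plus_distrib) (simp_all add: FS_single_add)

lemma FS_add_left: "FS (p + q) u = FS p u + FS q u"
proof (induction u rule: poly_mapping_additive_induct)
  case (single b m)
  obtain \<beta> I where b: "b = (\<beta>, I)" by (cases b)
  show ?case unfolding b FS_single_right
    by (rule setsum_keys_plus_distrib[where f = "\<lambda>\<gamma> c. Poly_Mapping.single (\<gamma> + \<beta>, I) (sc c m)"])
       (simp_all add: M.scale_left_distrib single_add flip: const_add)
qed (simp_all add: FS_add_right)

lemma FS_single: "FS (Poly_Mapping.single \<gamma> c) (Poly_Mapping.single (\<beta>, I) m) = Poly_Mapping.single (\<gamma> + \<beta>, I) (sc c m)"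
  by (cases "c = 0") (simp_all add: FS_single_right)

lemma FS_zero_left [simp]: "FS 0 u = 0"
  by (simp add: F_scale_def)

lemma FS_FS: "FS p (FS q u) = FS (p * q) u"
proof (induction u rule: poly_mapping_additive_induct)
  case (single b m)
  obtain \<beta> I where b: "b = (\<beta>, I)" by (cases b)
  show ?case
  proof (induction q rule: poly_mapping_additive_induct)
    case (single \<gamma>' c')
    then show ?case
    proof (induction p rule: poly_mapping_additive_induct)
      case (single \<gamma> c)
      then show ?case by (simp add: b FS_single mult_single const_mult add.assoc)
    qed (simp_all add: FS_add_left algebra_simps)
  qed (simp_all add: FS_add_left FS_add_right algebra_simps)
qed (simp_all add: FS_add_right)

lemma module_FS: "module FS"
proof
  show "FS 1 u = u" for u
  proof (induction u rule: poly_mapping_additive_induct)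
    case (single b m)
    then show ?case using FS_single[of 0 1 "fst b" "snd b" m] by simp
  qed (simp_all add: FS_add_right)
qed (simp_all add: FS_add_left FS_add_right FS_FS)

sublocale FM: module FS by (rule module_FS)

lemma lookup_FS_const: "Poly_Mapping.lookup (FS (const c) u) b = sc c (Poly_Mapping.lookup u b)"
proof (induction u rule: poly_mapping_additive_induct)
  case (single b' m)
  have "FS (const c) (Poly_Mapping.single b' m) = Poly_Mapping.single b' (sc c m)"
    using FS_single[of 0 c "fst b'" "snd b'" m] by (simp add: const_def)
  then show ?case by (simp add: lookup_single when_def)
qed (simp_all add: FS_add_right lookup_add M.scale_right_distrib)

text \<open>The \<open>k\<close>-basis of \<open>F\<close> consists of the \<open>x\<^sup>\<beta> e\<^sub>I x\<^sup>\<alpha> g\<^sub>j\<close> with \<open>x\<^sup>\<alpha> g\<^sub>j\<close> standard, encoded as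
  \<open>((\<beta>, I), (\<alpha>, j))\<close>.\<close>

definition KF :: "(('n mon \<times> 'n set) \<times> ('n mon \<times> nat)) set" where
  "KF = {\<kappa>. snd \<kappa> \<in> std}"

definition cF :: "('n, 'm) fcx \<Rightarrow> ('n mon \<times> 'n set) \<times> ('n mon \<times> nat) \<Rightarrow> 'k" where
  "cF u \<kappa> = cM (Poly_Mapping.lookup u (fst \<kappa>)) (snd \<kappa>)"

definition bF :: "('n mon \<times> 'n set) \<times> ('n mon \<times> nat) \<Rightarrow> ('n, 'm) fcx" where
  "bF \<kappa> = Poly_Mapping.single (fst \<kappa>) (g (snd \<kappa>))"

sublocale Fc: coords KF "\<lambda>c. FS (const c)" cF bF
proof
  show "cF (x + y) i = cF x i + cF y i" for x y i by (simp add: cF_def lookup_add mc.cf_add)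
  show "cF (FS (const c) x) i = c * cF x i" for c x i by (simp add: cF_def lookup_FS_const mc.cf_ks)
  show "i \<in> KF" if "cF x i \<noteq> 0" for x i using mc.supp_K0 that by (auto simp: cF_def KF_def)
  show "cF (bF i) j = (if j = i then 1 else 0)" if "i \<in> KF" for i j
    using that by (cases i; cases j) (auto simp: cF_def bF_def KF_def lookup_single when_def mc.cf_bas)
  show "x = y" if "\<And>i. cF x i = cF y i" for x y
  proof (rule poly_mapping_eqI, rule mc.cf_eqI)
    fix b t show "cM (Poly_Mapping.lookup x b) t = cM (Poly_Mapping.lookup y b) t"
      using that[of "(b, t)"] by (simp add: cF_def)
  qed
  show "finite {i. cF x i \<noteq> 0}" for x
  proof (rule finite_subset)
    show "{i. cF x i \<noteq> 0} \<subseteq> (SIGMA b:Poly_Mapping.keys x. mc.supp (Poly_Mapping.lookup x b))"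
    proof
      fix i assume "i \<in> {i. cF x i \<noteq> 0}"
      then have nz: "cM (Poly_Mapping.lookup x (fst i)) (snd i) \<noteq> 0" by (simp add: cF_def)
      then have "Poly_Mapping.lookup x (fst i) \<noteq> 0" using mc.cf_zero by metis
      then show "i \<in> (SIGMA b:Poly_Mapping.keys x. mc.supp (Poly_Mapping.lookup x b))"
        using nz by (cases i) (auto simp: mc.supp_def in_keys_iff)
    qed
  qed simp
qed

lemma F_elt_bF: "F_elt eta I \<alpha> j = bF ((0, I), (\<alpha>, j))"
  by (simp add: F_elt_def e_elt_def bF_def g_def fbas_def)

lemma FS_single_bF:
  "FS (Poly_Mapping.single \<gamma> c) (bF ((\<beta>, I), t)) = FS (const c) (bF ((\<gamma> + \<beta>, I), t))"
  by (simp add: bF_def const_def FS_single)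

lemma bF_shift: "bF ((\<beta>, I), t) = FS (monom \<beta>) (bF ((0, I), t))"
  using FS_single_bF[of \<beta> 1 0 I t] by (simp add: monom_def)

lemma supported_FS:
  assumes "x \<in> Fc.supported T" "\<And>\<beta> I t \<gamma>. ((\<beta>, I), t) \<in> T \<Longrightarrow> ((\<gamma> + \<beta>, I), t) \<in> T"
  shows "FS p x \<in> Fc.supported T"
  using assms(1)
proof (induction rule: Fc.supported_induct)
  case (basis c \<kappa>)
  obtain \<beta> I t where k: "\<kappa> = ((\<beta>, I), t)" by (metis prod.exhaust)
  show ?case
  proof (induction p rule: poly_mapping_additive_induct)
    case (single \<gamma> c')
    have "FS (Poly_Mapping.single \<gamma> c') (FS (const c) (bF \<kappa>)) = FS (const c) (FS (Poly_Mapping.single \<gamma> c') (bF \<kappa>))"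
      by (simp add: FS_FS mult.commute)
    also have "\<dots> = FS (const c) (FS (const c') (bF ((\<gamma> + \<beta>, I), t)))"
      by (simp add: k FS_single_bF)
    also have "\<dots> \<in> Fc.supported T"
      using basis assms(2) by (intro Fc.supported_ks Fc.supported_bas) (auto simp: k KF_def)
    finally show ?case .
  qed (simp_all add: FS_add_left Fc.supported_add distrib_right)
qed (simp_all add: FS_add_right Fc.supported_add)

lemma FS_linearI:
  assumes "Fc.klin f" and "\<And>\<gamma> x. f (FS (monom \<gamma>) x) = FS (monom \<gamma>) (f x)"
  shows "f (FS p x) = FS p (f x)"
proof (induction p rule: poly_mapping_additive_induct)
  case (single \<gamma> c)
  have "Poly_Mapping.single \<gamma> c = const c * monom \<gamma>" by (simp add: const_monom)
  then show ?case by (simp only: FS_FS[symmetric] Fc.klin_ks[OF assms(1)] assms(2))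
qed (simp_all add: FS_add_left Fc.klin_zero[OF assms(1)] Fc.klin_add[OF assms(1)])

lemma FS_linear_klin: "(\<And>x y. f (x + y) = f x + f y) \<Longrightarrow> (\<And>p x. f (FS p x) = FS p (f x)) \<Longrightarrow> Fc.klin f"
  by (simp add: Fc.klin_def)

abbreviation dF :: "('n, 'm) fcx \<Rightarrow> ('n, 'm) fcx" where
  "dF \<equiv> d_F scale"

text \<open>The differential of \<open>x\<^sup>\<beta> e\<^sub>I m\<close>.\<close>

definition dB :: "'n mon \<times> 'n set \<Rightarrow> 'm \<Rightarrow> ('n, 'm) fcx" where
  "dB b m = (\<Sum>i\<in>snd b. Poly_Mapping.single (fst b + vexp i, snd b - {i}) (sc (sg i (snd b)) m)
                - Poly_Mapping.single (fst b, snd b - {i}) (sc (sg i (snd b)) (scale (var i) m)))"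

lemma dB_add: "dB b (m + m') = dB b m + dB b m'"
  unfolding dB_def sum.distrib[symmetric]
  by (rule sum.cong) (simp_all add: M.scale_right_distrib single_add)

lemma dB_zero [simp]: "dB b 0 = 0"
  by (simp add: dB_def)

lemma dF_expand: "dF u = (\<Sum>b\<in>Poly_Mapping.keys u. dB b (Poly_Mapping.lookup u b))"
  unfolding d_F_def dB_def
proof (intro sum.cong refl, clarify)
  fix \<beta> :: "'n mon" and I :: "'n set"
  let ?m = "Poly_Mapping.lookup u (\<beta>, I)"
  have "FS (monom \<beta>) (FS (eps i I) (FS (var i) (e_elt (I - {i}) ?m) - e_elt (I - {i}) (scale (var i) ?m)))
      = Poly_Mapping.single (\<beta> + vexp i, I - {i}) (sc (sg i I) ?m)
          - Poly_Mapping.single (\<beta>, I - {i}) (sc (sg i I) (scale (var i) ?m))" for i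
    by (simp add: eps_const FM.scale_right_diff_distrib e_elt_def const_def monom_def var_def FS_single add.commute)
  then show "FS (monom \<beta>) (\<Sum>i\<in>I. FS (eps i I) (FS (var i) (e_elt (I - {i}) ?m) - e_elt (I - {i}) (scale (var i) ?m)))
    = (\<Sum>i\<in>snd (\<beta>, I). Poly_Mapping.single (fst (\<beta>, I) + vexp i, snd (\<beta>, I) - {i}) (sc (sg i (snd (\<beta>, I))) ?m)
          - Poly_Mapping.single (fst (\<beta>, I), snd (\<beta>, I) - {i}) (sc (sg i (snd (\<beta>, I))) (scale (var i) ?m)))"
    by (simp add: FM.scale_sum_right)
qed

lemma dF_add: "dF (u + v) = dF u + dF v"
  unfolding dF_expand by (rule setsum_keys_plus_distrib) (simp_all add: dB_add)

lemma dF_single: "dF (Poly_Mapping.single b m) = dB b m"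
  by (cases "m = 0") (simp_all add: dF_expand)

lemma dF_zero [simp]: "dF 0 = 0"
  by (simp add: dF_expand)

lemma dF_diff: "dF (u - v) = dF u - dF v"
  using dF_add[of "u - v" v] by (simp add: algebra_simps)

lemma dF_sum: "dF (\<Sum>a\<in>A. f a) = (\<Sum>a\<in>A. dF (f a))"
  by (induction A rule: infinite_finite_induct) (simp_all add: dF_add)

lemma dF_FS: "dF (FS p u) = FS p (dF u)"
proof (induction u rule: poly_mapping_additive_induct)
  case (single b m)
  obtain \<beta> I where b: "b = (\<beta>, I)" by (cases b)
  show ?case
  proof (induction p rule: poly_mapping_additive_induct)
    case (single \<gamma> c)
    show ?case unfolding b FS_single dF_single dB_def FM.scale_sum_right FM.scale_right_diff_distrib
      by (intro sum.cong arg_cong2[where f = "(-)"])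
         (simp_all add: FS_single M.scale_scale mult_ac add.assoc)
  qed (simp_all add: FS_add_left dF_add)
qed (simp_all add: FS_add_right dF_add)

lemma klin_dF: "Fc.klin dF"
  by (rule FS_linear_klin) (simp_all add: dF_add dF_FS)

lemma dF_dF: "dF (dF u) = 0"
proof (induction u rule: poly_mapping_additive_induct)
  case (single b m)
  obtain \<beta> I where b: "b = (\<beta>, I)" by (cases b)
  define W where "W i j = Poly_Mapping.single (\<beta> + vexp i + vexp j, I - {i} - {j}) m
     - Poly_Mapping.single (\<beta> + vexp i, I - {i} - {j}) (scale (var j) m)
     - Poly_Mapping.single (\<beta> + vexp j, I - {i} - {j}) (scale (var i) m)
     + Poly_Mapping.single (\<beta>, I - {i} - {j}) (scale (var i * var j) m)" for i j
  have W: "W i j = W j i" for i j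
  proof -
    have "I - {j} - {i} = I - {i} - {j}" "\<beta> + vexp j + vexp i = \<beta> + vexp i + vexp j"
      "var j * var i = (var i * var j :: ('n, 'k) mpoly)"
      by (auto simp: add_ac mult.commute)
    then show ?thesis unfolding W_def by (simp only:) (simp add: algebra_simps)
  qed
  define a where "a i j = FS (const (sg i I * sg j (I - {i}))) (W i j)" for i j
  have ss: "FS (const c * const c') (Poly_Mapping.single b' m')
      = Poly_Mapping.single b' (scale (const c * const c') m')" for b' c c' m'
    using FS_single[of 0 "c * c'" "fst b'" "snd b'" m'] by (simp add: const_mult) (simp add: const_def)
  have "dF (dF (Poly_Mapping.single b m)) =
      (\<Sum>i\<in>I. dB (\<beta> + vexp i, I - {i}) (sc (sg i I) m) - dB (\<beta>, I - {i}) (sc (sg i I) (scale (var i) m)))"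
    by (simp add: b dF_single dB_def[of "(\<beta>, I)"] dF_sum dF_diff)
  also have "\<dots> = (\<Sum>i\<in>I. \<Sum>j\<in>I - {i}. a i j)"
    unfolding dB_def fst_conv snd_conv sum_subtractf[symmetric]
  proof (intro sum.cong refl)
    fix i j
    show "Poly_Mapping.single (\<beta> + vexp i + vexp j, I - {i} - {j}) (sc (sg j (I - {i})) (sc (sg i I) m)) -
       Poly_Mapping.single (\<beta> + vexp i, I - {i} - {j}) (sc (sg j (I - {i})) (scale (var j) (sc (sg i I) m))) -
       (Poly_Mapping.single (\<beta> + vexp j, I - {i} - {j}) (sc (sg j (I - {i})) (sc (sg i I) (scale (var i) m))) -
        Poly_Mapping.single (\<beta>, I - {i} - {j}) (sc (sg j (I - {i})) (scale (var j) (sc (sg i I) (scale (var i) m))))) =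
       a i j"
      by (simp add: a_def W_def FM.scale_right_diff_distrib FM.scale_right_distrib ss
            const_mult[symmetric] mult_ac)
  qed
  also have "\<dots> = 0"
  proof (rule sum_antisymmetric)
    fix i j assume ij: "i \<in> I" "j \<in> I" "i \<noteq> j"
    show "a i j = - a j i"
      using sg_antisym[OF ij, where 'k = 'k] by (simp add: a_def W[of i j] const_uminus)
  qed simp
  finally show ?case .
qed (simp_all add: dF_add)

lemma cF_single: "cF (Poly_Mapping.single b m) (b', t) = (if b = b' then cM m t else 0)"
  by (simp add: cF_def lookup_single when_def)

lemma cF_dB: "cF (dB b m) (b', t) = (\<Sum>i\<in>snd b. sg i (snd b) *
    ((if (fst b + vexp i, snd b - {i}) = b' then cM m t else 0)
      - (if (fst b, snd b - {i}) = b' then cM (scale (var i) m) t else 0)))"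
  unfolding dB_def Fc.cf_sum
  by (intro sum.cong refl)
     (simp add: Fc.cf_diff cF_single mc.cf_ks right_diff_distrib del: M.scale_scale)

text \<open>The basis elements that occur in the differential of \<open>x\<^sup>\<beta> e\<^sub>I x\<^sup>\<alpha> g\<^sub>j\<close>: either \<open>x\<^sub>i\<close> goes into the
  left factor, or it acts on \<open>M\<close>.\<close>

lemma cF_d_bF_nonzero:
  assumes "\<kappa> \<in> KF" "cF (dF (bF \<kappa>)) \<kappa>' \<noteq> 0"
  obtains (lift) i where "i \<in> snd (fst \<kappa>)" "\<kappa>' = ((fst (fst \<kappa>) + vexp i, snd (fst \<kappa>) - {i}), snd \<kappa>)"
  | (act) i where "i \<in> snd (fst \<kappa>)" "fst \<kappa>' = (fst (fst \<kappa>), snd (fst \<kappa>) - {i})"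
      "cM (g (vexp i + fst (snd \<kappa>), snd (snd \<kappa>))) (snd \<kappa>') \<noteq> 0"
proof -
  obtain b t b' t' where k: "\<kappa> = (b, t)" "\<kappa>' = (b', t')" by (metis prod.exhaust)
  have t: "t \<in> std" using assms k by (simp add: KF_def)
  then have tr: "snd t < r" by (simp add: std_iff)
  have "cF (dB b (g t)) (b', t') \<noteq> 0" using assms k by (simp add: bF_def dF_single)
  then obtain i where i: "i \<in> snd b" and nz: "sg i (snd b) *
    ((if (fst b + vexp i, snd b - {i}) = b' then cM (g t) t' else 0)
      - (if (fst b, snd b - {i}) = b' then cM (scale (var i) (g t)) t' else 0)) \<noteq> 0"
    unfolding cF_dB by (meson sum.not_neutral_contains_not_neutral)
  then consider "(fst b + vexp i, snd b - {i}) = b'" "cM (g t) t' \<noteq> 0"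
    | "(fst b, snd b - {i}) = b'" "cM (scale (var i) (g t)) t' \<noteq> 0"
    by (auto split: if_splits)
  then show thesis
  proof cases
    case 1
    then have "t' = t" using mc.cf_bas[OF t] by (auto split: if_splits)
    then show thesis using 1 i k by (intro lift[of i]) auto
  next
    case 2
    then show thesis using i k scale_monom_g[OF tr, of "vexp i"] by (intro act[of i]) (auto simp: var_def)
  qed
qed

text \<open>The internal degree of a basis element; the label \<open>labF\<close> consists of the homological and the
  internal degree, and \<open>shF\<close> raises the homological degree by one.\<close>

definition degF :: "('n mon \<times> 'n set) \<times> ('n mon \<times> nat) \<Rightarrow> int" where
  "degF \<kappa> = int (mdeg (fst (fst \<kappa>))) + int (card (snd (fst \<kappa>))) + tdeg (snd \<kappa>)"

definition labF :: "('n mon \<times> 'n set) \<times> ('n mon \<times> nat) \<Rightarrow> nat \<times> int" where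
  "labF \<kappa> = (card (snd (fst \<kappa>)), degF \<kappa>)"

definition shF :: "nat \<times> int \<Rightarrow> nat \<times> int" where
  "shF l = (Suc (fst l), snd l)"

lemma inj_shF: "inj shF"
  by (auto simp: inj_def shF_def)

lemma tdeg_shift: "tdeg (\<gamma> + fst t, snd t) = int (mdeg \<gamma>) + tdeg t"
  by (simp add: tdeg_def mdeg_add)

lemma labF_dF:
  assumes "\<kappa> \<in> KF" "cF (dF (bF \<kappa>)) \<kappa>' \<noteq> 0"
  shows "labF \<kappa> = shF (labF \<kappa>')"
  using assms
proof (cases rule: cF_d_bF_nonzero)
  case (lift i)
  have "card (snd (fst \<kappa>)) = Suc (card (snd (fst \<kappa>) - {i}))"
    by (rule card.remove) (simp_all add: lift(1))
  then show ?thesis using lift by (simp add: labF_def shF_def degF_def mdeg_add)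
next
  case (act i)
  have "card (snd (fst \<kappa>)) = Suc (card (snd (fst \<kappa>) - {i}))"
    by (rule card.remove) (simp_all add: act(1))
  moreover have "snd (snd \<kappa>) < r" using assms(1) by (simp add: KF_def std_iff)
  then have "tdeg (snd \<kappa>') = 1 + tdeg (snd \<kappa>)"
    using cM_g(2)[OF _ act(3)] tdeg_shift[of "vexp i" "snd \<kappa>"] by simp
  ultimately show ?thesis using act by (simp add: labF_def shF_def degF_def)
qed

lemma F_grading_eq: "F_grading Mg e = Fc.supported {\<kappa>. degF \<kappa> = e}"
proof (intro set_eqI iffI)
  fix u :: "('n, 'm) fcx"
  assume u: "u \<in> F_grading Mg e"
  show "u \<in> Fc.supported {\<kappa>. degF \<kappa> = e}"
  proof (rule Fc.supportedI)
    fix \<kappa> assume nz: "cF u \<kappa> \<noteq> 0"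
    obtain \<beta> I t where k: "\<kappa> = ((\<beta>, I), t)" by (metis prod.exhaust)
    have nz': "cM (Poly_Mapping.lookup u (\<beta>, I)) t \<noteq> 0" using nz by (simp add: cF_def k)
    then have "Poly_Mapping.lookup u (\<beta>, I) \<noteq> 0" using mc.cf_zero by metis
    then have "(\<beta>, I) \<in> Poly_Mapping.keys u" by (simp add: in_keys_iff)
    then have "Poly_Mapping.lookup u (\<beta>, I) \<in> Mg (e - int (mdeg \<beta>) - int (card I))"
      using u by (auto simp: F_grading_def)
    then have "tdeg t = e - int (mdeg \<beta>) - int (card I)"
      using mc.supportedD[OF _ nz'] by (auto simp: Mg_iff)
    then show "\<kappa> \<in> {\<kappa>. degF \<kappa> = e}" by (simp add: degF_def k)
  qed
next
  fix u :: "('n, 'm) fcx"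
  assume u: "u \<in> Fc.supported {\<kappa>. degF \<kappa> = e}"
  have "Poly_Mapping.lookup u (\<beta>, I) \<in> Mg (e - int (mdeg \<beta>) - int (card I))" for \<beta> I
    unfolding Mg_iff
  proof (rule mc.supportedI)
    fix t assume "cM (Poly_Mapping.lookup u (\<beta>, I)) t \<noteq> 0"
    then have "degF ((\<beta>, I), t) = e"
      using Fc.supportedD[OF u, of "((\<beta>, I), t)"] by (simp add: cF_def)
    then show "t \<in> {t. tdeg t = e - int (mdeg \<beta>) - int (card I)}" by (simp add: degF_def)
  qed
  then show "u \<in> F_grading Mg e" by (auto simp: F_grading_def)
qed

lemma graded_module_F: "graded_module FS (F_grading Mg)"
  unfolding graded_module_def F_grading_eq
proof (intro conjI allI ballI)
  fix d e x and p :: "('n, 'k) mpoly"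
  assume p: "p \<in> homog d" and x: "x \<in> Fc.supported {\<kappa>. degF \<kappa> = e}"
  have sub: "FS (Poly_Mapping.single \<gamma> c) x \<in> Fc.supported {\<kappa>. degF \<kappa> = int d + e}" if "mdeg \<gamma> = d" for \<gamma> c
    using x
  proof (induction rule: Fc.supported_induct)
    case (basis a \<kappa>)
    obtain \<beta> I t where k: "\<kappa> = ((\<beta>, I), t)" by (metis prod.exhaust)
    have "FS (Poly_Mapping.single \<gamma> c) (FS (const a) (bF \<kappa>)) = FS (const a) (FS (Poly_Mapping.single \<gamma> c) (bF \<kappa>))"
      by (simp add: FS_FS mult.commute)
    also have "\<dots> = FS (const a) (FS (const c) (bF ((\<gamma> + \<beta>, I), t)))"
      by (simp add: k FS_single_bF)
    also have "\<dots> \<in> Fc.supported {\<kappa>. degF \<kappa> = int d + e}"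
      using basis that by (intro Fc.supported_ks Fc.supported_bas) (auto simp: k KF_def degF_def mdeg_add)
    finally show ?case .
  qed (simp_all add: FS_add_right Fc.supported_add)
  have "FS p x = (\<Sum>\<gamma>\<in>Poly_Mapping.keys p. FS (Poly_Mapping.single \<gamma> (Poly_Mapping.lookup p \<gamma>)) x)"
    by (subst poly_mapping_expand[of p]) (rule FM.scale_sum_left)
  also have "\<dots> \<in> Fc.supported {\<kappa>. degF \<kappa> = int d + e}"
    by (rule Fc.supported_sum, rule sub) (use p in \<open>auto simp: homog_def\<close>)
  finally show "FS p x \<in> Fc.supported {\<kappa>. degF \<kappa> = int d + e}" .
qed (rule module_FS, simp_all add: Fc.supported_add Fc.homogeneous_decomposition)

text \<open>The augmentation \<open>F\<^sub>0 = S \<otimes> M \<rightarrow> M\<close> given by the module structure.\<close>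

definition augF :: "('n, 'm) fcx \<Rightarrow> 'm" where
  "augF u = (\<Sum>b\<in>Poly_Mapping.keys u. if snd b = {} then scale (monom (fst b)) (Poly_Mapping.lookup u b) else 0)"

lemma augF_add: "augF (u + v) = augF u + augF v"
  unfolding augF_def
  by (rule setsum_keys_plus_distrib[where f = "\<lambda>b m. if snd b = {} then scale (monom (fst b)) m else 0"])
     (simp_all add: M.scale_right_distrib)

lemma augF_single: "augF (Poly_Mapping.single b m) = (if snd b = {} then scale (monom (fst b)) m else 0)"
  by (cases "m = 0") (simp_all add: augF_def)

lemma augF_zero [simp]: "augF 0 = 0"
  by (simp add: augF_def)

lemma augF_diff: "augF (u - v) = augF u - augF v"
  using augF_add[of "u - v" v] by (simp add: algebra_simps)

lemma augF_sum: "augF (\<Sum>a\<in>A. f a) = (\<Sum>a\<in>A. augF (f a))"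
  by (induction A rule: infinite_finite_induct) (simp_all add: augF_add)

lemma augF_FS: "augF (FS p u) = scale p (augF u)"
proof (induction u rule: poly_mapping_additive_induct)
  case (single b m)
  obtain \<beta> I where b: "b = (\<beta>, I)" by (cases b)
  show ?case
  proof (induction p rule: poly_mapping_additive_induct)
    case (single \<gamma> c)
    have "monom (\<gamma> + \<beta>) * const c = Poly_Mapping.single \<gamma> c * monom \<beta>"
      by (simp add: monom_def const_def mult_single)
    then show ?case by (simp add: b FS_single augF_single)
  qed (simp_all add: FS_add_left augF_add M.scale_left_distrib)
qed (simp_all add: FS_add_right augF_add M.scale_right_distrib)

lemma augF_dF: "augF (dF u) = 0"
proof (induction u rule: poly_mapping_additive_induct)
  case (single b m)
  have "scale (monom (\<beta> + vexp i)) (sc c m) = scale (monom \<beta>) (sc c (scale (var i) m))" for \<beta> i c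
    by (simp add: var_def monom_mult[symmetric] mult_ac)
  then show ?case
    by (auto simp: dF_single dB_def augF_sum augF_diff augF_single intro!: sum.neutral)
qed (simp_all add: dF_add augF_add)

end


section \<open>Sets whose maximum dominates an exponent\<close>

text \<open>The condition \<open>max J \<ge> max (supp \<alpha>)\<close> for a non-empty \<open>J\<close>. In both matchings below, the partner
  of such a pair moves the index \<open>max J\<close> from \<open>J\<close> into the exponent, and this operation is undone by
  moving the largest variable of the exponent back.\<close>

definition dominates :: "'n::{finite, linorder} set \<Rightarrow> 'n mon \<Rightarrow> bool" where
  "dominates J \<alpha> \<longleftrightarrow> (\<exists>i\<in>J. \<forall>l\<in>Poly_Mapping.keys \<alpha>. l \<le> i)"

lemma dominates_Max:
  assumes "dominates J \<alpha>"
  shows "Max J \<in> J" "\<And>l. l \<in> Poly_Mapping.keys \<alpha> \<Longrightarrow> l \<le> Max J"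
proof -
  from assms obtain i where i: "i \<in> J" "\<forall>l\<in>Poly_Mapping.keys \<alpha>. l \<le> i" by (auto simp: dominates_def)
  then show "Max J \<in> J" by (intro Max_in) auto
  have "i \<le> Max J" using i by simp
  then show "l \<le> Max J" if "l \<in> Poly_Mapping.keys \<alpha>" for l
    using i that \<open>i \<le> Max J\<close> order_trans by blast
qed

lemma dominates_moved:
  assumes "dominates J \<alpha>"
  shows "\<not> dominates (J - {Max J}) (\<alpha> + vexp (Max J))"
proof
  assume "dominates (J - {Max J}) (\<alpha> + vexp (Max J))"
  then obtain i where "i \<in> J" "i \<noteq> Max J" "Max J \<le> i"
    by (auto simp: dominates_def keys_add_nat)
  moreover have "i \<le> Max J" using \<open>i \<in> J\<close> by simp
  ultimately show False by simp
qed

lemma dominates_other: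
  assumes "dominates J \<alpha>" "i \<in> J" "i \<noteq> Max J"
  shows "dominates (J - {i}) (vexp i + \<alpha>)"
  unfolding dominates_def
proof (intro bexI ballI)
  show "Max J \<in> J - {i}" using dominates_Max(1)[OF assms(1)] assms by simp
  show "l \<le> Max J" if "l \<in> Poly_Mapping.keys (vexp i + \<alpha>)" for l
    using that dominates_Max(2)[OF assms(1)] assms by (auto simp: keys_add_nat)
qed

lemma not_dominates_zero: "\<not> dominates J 0 \<Longrightarrow> J = {}"
  by (auto simp: dominates_def)

lemma not_dominates:
  assumes "\<not> dominates J \<alpha>" "\<alpha> \<noteq> 0"
  defines "t \<equiv> Max (Poly_Mapping.keys \<alpha>)"
  shows "t \<in> Poly_Mapping.keys \<alpha>" "\<And>i. i \<in> J \<Longrightarrow> i < t" "Max (insert t J) = t"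
    "dominates (insert t J) (\<alpha> - vexp t)"
proof -
  have ne: "Poly_Mapping.keys \<alpha> \<noteq> {}"
    using assms(2) by (metis poly_mapping_eqI lookup_zero in_keys_iff empty_iff)
  then show t: "t \<in> Poly_Mapping.keys \<alpha>" by (simp add: t_def)
  show less: "i < t" if i: "i \<in> J" for i
  proof -
    obtain l where "l \<in> Poly_Mapping.keys \<alpha>" "i < l"
      using assms(1) i by (auto simp: dominates_def not_le)
    moreover have "l \<le> t" using calculation by (simp add: t_def)
    ultimately show ?thesis by simp
  qed
  show "Max (insert t J) = t" using less by (intro Max_eqI) (auto simp: less_imp_le)
  show "dominates (insert t J) (\<alpha> - vexp t)"
    unfolding dominates_def
  proof (intro bexI ballI)
    fix l assume "l \<in> Poly_Mapping.keys (\<alpha> - vexp t)"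
    then have "l \<in> Poly_Mapping.keys \<alpha>" by (auto simp: in_keys_iff lookup_minus)
    then show "l \<le> t" by (simp add: t_def)
  qed simp
qed

lemma dominates_move_inj:
  assumes "dominates J \<alpha>" "dominates J' \<alpha>'"
    and "J - {Max J} = J' - {Max J'}" "\<alpha> + vexp (Max J) = \<alpha>' + vexp (Max J')"
  shows "Max J = Max J'" "J = J'" "\<alpha> = \<alpha>'"
proof -
  have *: "Max (Poly_Mapping.keys (\<alpha> + vexp (Max J))) = Max J" if "dominates J \<alpha>" for J and \<alpha> :: "'a mon"
    using dominates_Max(2)[OF that] by (intro Max_eqI) (auto simp: keys_add_nat)
  show m: "Max J = Max J'" using *[OF assms(1)] *[OF assms(2)] assms(4) by simp
  show "J = J'" using assms(3) m dominates_Max(1)[OF assms(1)] dominates_Max(1)[OF assms(2)] by auto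
  show "\<alpha> = \<alpha>'" using assms(4) m by simp
qed


section \<open>The two matchings on \<open>F\<close>\<close>

context initially_linear
begin

abbreviation N :: "nat \<Rightarrow> 'n set" where
  "N \<equiv> ncrit r eta prec"

abbreviation CR :: "nat \<Rightarrow> 'n set" where
  "CR \<equiv> crit r eta prec"

text \<open>The matching that exhibits \<open>F\<close> as a resolution of \<open>M\<close>. It involves only the factor
  \<open>S \<otimes> \<Lambda>V\<close>, which carries the Koszul complex.\<close>

definition U_kos :: "(('n mon \<times> 'n set) \<times> ('n mon \<times> nat)) set" where
  "U_kos = {((\<beta>, I), t). t \<in> std \<and> dominates I \<beta>}"

text \<open>The unmatched elements: a basis of \<open>1 \<otimes> M\<close>.\<close>

definition C_kos :: "(('n mon \<times> 'n set) \<times> ('n mon \<times> nat)) set" where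
  "C_kos = {((\<beta>, I), t). t \<in> std \<and> \<beta> = 0 \<and> I = {}}"

text \<open>The partner of an element of \<open>U_kos\<close>.\<close>

definition \<theta>_kos :: "('n mon \<times> 'n set) \<times> ('n mon \<times> nat) \<Rightarrow> ('n mon \<times> 'n set) \<times> ('n mon \<times> nat)" where
  "\<theta>_kos = (\<lambda>((\<beta>, I), t). ((\<beta> + vexp (Max I), I - {Max I}), t))"

text \<open>The exterior degree is added so that moving a variable from \<open>I\<close> to \<open>\<beta>\<close> preserves the measure,
  while letting it act on \<open>M\<close> lowers it.\<close>

definition \<nu>_kos :: "('n mon \<times> 'n set) \<times> ('n mon \<times> nat) \<Rightarrow> nat" where
  "\<nu>_kos = (\<lambda>((\<beta>, I), t). mdeg \<beta> + card I)"

lemma card_minus: "i \<in> I \<Longrightarrow> card I = Suc (card (I - {i}))" for I :: "'n set"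
  by (rule card.remove) simp_all

lemma std_snd: "t \<in> std \<Longrightarrow> snd t < r"
  by (simp add: std_iff)

sublocale mkos: matching KF "\<lambda>c. FS (const c)" cF bF dF U_kos C_kos \<theta>_kos \<nu>_kos labF shF
proof
  show "Fc.klin dF" by (rule klin_dF)
  show "U_kos \<subseteq> KF" "C_kos \<subseteq> KF" by (auto simp: U_kos_def C_kos_def KF_def)
  show "U_kos \<inter> C_kos = {}" by (auto simp: U_kos_def C_kos_def dominates_def)
  show "inj_on \<theta>_kos U_kos"
    by (auto simp: inj_on_def U_kos_def \<theta>_kos_def dest: dominates_move_inj)
  show "\<theta>_kos ` U_kos = KF - (U_kos \<union> C_kos)"
  proof (intro set_eqI iffI)
    fix \<kappa> assume "\<kappa> \<in> \<theta>_kos ` U_kos"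
    then obtain \<beta> I t where k: "\<kappa> = ((\<beta> + vexp (Max I), I - {Max I}), t)" "t \<in> std" "dominates I \<beta>"
      by (auto simp: U_kos_def \<theta>_kos_def)
    have "Max I \<in> Poly_Mapping.keys (\<beta> + vexp (Max I))" by (simp add: keys_add_nat)
    then have "\<beta> + vexp (Max I) \<noteq> 0" by (metis keys_zero empty_iff)
    then show "\<kappa> \<in> KF - (U_kos \<union> C_kos)"
      using k dominates_moved by (auto simp: KF_def U_kos_def C_kos_def)
  next
    fix \<kappa> assume a: "\<kappa> \<in> KF - (U_kos \<union> C_kos)"
    obtain \<beta> I t where k: "\<kappa> = ((\<beta>, I), t)" by (metis prod.exhaust)
    have t: "t \<in> std" and nd: "\<not> dominates I \<beta>" using a by (auto simp: k KF_def U_kos_def)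
    have b: "\<beta> \<noteq> 0" using not_dominates_zero nd a t by (auto simp: k C_kos_def)
    let ?t = "Max (Poly_Mapping.keys \<beta>)"
    note n = not_dominates[OF nd b]
    have "?t \<notin> I" using n(2) by auto
    then have "\<theta>_kos ((\<beta> - vexp ?t, insert ?t I), t) = \<kappa>"
      using n by (simp add: k \<theta>_kos_def diff_vexp_add)
    moreover have "((\<beta> - vexp ?t, insert ?t I), t) \<in> U_kos" using n t by (simp add: U_kos_def)
    ultimately show "\<kappa> \<in> \<theta>_kos ` U_kos" by force
  qed
  show "\<nu>_kos (\<theta>_kos \<kappa>) = \<nu>_kos \<kappa>" if "\<kappa> \<in> U_kos" for \<kappa>
    using that card_minus[OF dominates_Max(1)] by (auto simp: U_kos_def \<theta>_kos_def \<nu>_kos_def mdeg_add simp del: card_Diff_insert)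
  show "cF (dF (bF \<kappa>)) (\<theta>_kos \<kappa>) \<noteq> 0" if U: "\<kappa> \<in> U_kos" for \<kappa>
  proof -
    obtain \<beta> I t where k: "\<kappa> = ((\<beta>, I), t)" "t \<in> std" "dominates I \<beta>" using U by (auto simp: U_kos_def)
    have M: "Max I \<in> I" using k dominates_Max by blast
    have "cF (dF (bF \<kappa>)) (\<theta>_kos \<kappa>) = (\<Sum>i\<in>I. if i = Max I then sg i I else 0)"
      unfolding k bF_def dF_single \<theta>_kos_def prod.case cF_dB
    proof (intro sum.cong)
      fix i assume i: "i \<in> I"
      have "(I - {i} = I - {Max I}) = (i = Max I)" using i M by auto
      moreover have "\<beta> \<noteq> \<beta> + vexp (Max I)" by simp
      ultimately show "sg i (snd (fst ((\<beta>, I), t))) *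
        ((if (fst (fst ((\<beta>, I), t)) + vexp i, snd (fst ((\<beta>, I), t)) - {i}) = (\<beta> + vexp (Max I), I - {Max I})
            then cM (g (snd ((\<beta>, I), t))) t else 0) -
         (if (fst (fst ((\<beta>, I), t)), snd (fst ((\<beta>, I), t)) - {i}) = (\<beta> + vexp (Max I), I - {Max I})
            then cM (scale (var i) (g (snd ((\<beta>, I), t)))) t else 0)) =
        (if i = Max I then sg i I else 0)"
        using k(2) by (auto simp: mc.cf_bas)
    qed simp
    then show ?thesis using M by simp
  qed
  show "\<kappa>' = \<theta>_kos \<kappa> \<or> \<kappa>' \<in> U_kos \<union> C_kos \<or> \<nu>_kos \<kappa>' < \<nu>_kos \<kappa>" if U: "\<kappa> \<in> U_kos" and nz: "cF (dF (bF \<kappa>)) \<kappa>' \<noteq> 0" for \<kappa> \<kappa>'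
  proof -
    obtain \<beta> I t where k: "\<kappa> = ((\<beta>, I), t)" "t \<in> std" "dominates I \<beta>" using U by (auto simp: U_kos_def)
    have "\<kappa> \<in> KF" using k by (simp add: KF_def)
    then show ?thesis using nz
    proof (cases rule: cF_d_bF_nonzero)
      case (lift i)
      show ?thesis
      proof (cases "i = Max I")
        case False
        then have "dominates (I - {i}) (vexp i + \<beta>)" using dominates_other k lift by auto
        then show ?thesis using lift k by (simp add: U_kos_def add.commute)
      qed (use lift k in \<open>simp add: \<theta>_kos_def\<close>)
    next
      case (act i)
      obtain t' where "\<kappa>' = ((\<beta>, I - {i}), t')" using act k by (cases \<kappa>') auto
      then show ?thesis using act k card_minus[of i I] by (simp add: \<nu>_kos_def)
    qed
  qed
  show "labF \<kappa> = shF (labF \<kappa>')" if "\<kappa> \<in> U_kos" "cF (dF (bF \<kappa>)) \<kappa>' \<noteq> 0" for \<kappa> \<kappa>'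
    using that by (intro labF_dF) (auto simp: U_kos_def KF_def)
  show "inj shF" by (rule inj_shF)
qed

text \<open>The \<open>p\<close>-th module \<open>F\<^sub>p\<close>.\<close>

definition Fp :: "nat \<Rightarrow> ('n, 'm) fcx set" where
  "Fp p = Fc.supported {\<kappa>. card (snd (fst \<kappa>)) = p}"

lemma Fp_lab: "Fp p = Fc.supported {\<kappa>. labF \<kappa> \<in> {p} \<times> UNIV}"
  by (simp add: Fp_def labF_def)

lemma shF_image: "shF ` ({p} \<times> UNIV) = {Suc p} \<times> UNIV" "shF ` (UNIV \<times> {e}) = {Suc p | p. True} \<times> {e}"
  by (force simp: shF_def image_iff)+

lemma dF_Fp: "x \<in> Fp (Suc p) \<Longrightarrow> dF x \<in> Fp p"
  unfolding Fp_def
  by (rule Fc.klin_supported[OF klin_dF], assumption, rule Fc.supportedI)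
     (use labF_dF in \<open>force simp: labF_def shF_def\<close>)

lemma dF_F0: "x \<in> Fp 0 \<Longrightarrow> dF x = 0"
proof -
  assume "x \<in> Fp 0"
  then have "dF x \<in> Fc.supported {}"
    unfolding Fp_def
    by (rule Fc.klin_supported[OF klin_dF], intro Fc.supportedI)
       (use labF_dF in \<open>force simp: labF_def shF_def\<close>)
  then show ?thesis by (rule Fc.supported_empty)
qed

text \<open>\<open>F\<close> is a resolution of \<open>M\<close>: modulo boundaries, a cycle lies in the span of \<open>U_kos \<union> C_kos\<close>.
  In positive degree there is no \<open>C_kos\<close>, and a cycle in the span of \<open>U_kos\<close> vanishes. In degree 0
  there is no \<open>U_kos\<close>, and the augmentation is injective on the span of \<open>C_kos\<close>.\<close>

lemma F_exact:
  assumes z: "z \<in> Fp p" and "dF z = 0" and a: "p = 0 \<Longrightarrow> augF z = 0"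
  shows "\<exists>w\<in>Fp (Suc p). z = dF w"
proof -
  let ?u = "mkos.contr z" and ?y = "z - dF (mkos.contr z)"
  have u: "?u \<in> Fp (Suc p)"
    using mkos.contr_lab(1)[OF z[unfolded Fp_lab]] unfolding shF_image Fp_lab
    by (rule Fc.supported_mono) auto
  have y: "?y \<in> Fc.supported {\<kappa>\<in>U_kos \<union> C_kos. card (snd (fst \<kappa>)) = p}"
    using mkos.contr_lab(2)[OF z[unfolded Fp_lab]] by (rule Fc.supported_mono) (auto simp: labF_def)
  have "?y = 0"
  proof (cases "p = 0")
    case False
    then have "?y \<in> Fc.supported U_kos"
      by (intro Fc.supported_mono[OF y]) (auto simp: C_kos_def)
    moreover have "dF ?y = 0" using assms by (simp add: dF_diff dF_dF)
    ultimately show ?thesis by (intro mkos.d_injective) simp_all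
  next
    case True
    have "?y \<in> Fc.supported C_kos"
      by (rule Fc.supported_mono[OF y]) (auto simp: True U_kos_def dominates_def)
    moreover have "x = Poly_Mapping.single (0, {}) (augF x)" if "x \<in> Fc.supported C_kos" for x
      using that
    proof (induction rule: Fc.supported_induct)
      case (basis c \<kappa>)
      then obtain t where "\<kappa> = ((0, {}), t)" by (auto simp: C_kos_def)
      then have "FS (const c) (bF \<kappa>) = Poly_Mapping.single (0, {}) (sc c (g t))"
        by (simp add: bF_def const_def FS_single)
      then show ?case by (simp add: augF_single)
    next
      case (add x y)
      show ?case unfolding augF_add single_add using add by (rule arg_cong2[where f = "(+)"])
    qed simp
    moreover have "augF ?y = 0" using a True by (simp add: augF_diff augF_dF)
    ultimately show ?thesis by (metis single_zero)
  qed
  then show ?thesis using u by (intro bexI[of _ ?u]) simp_all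
qed

text \<open>The matching given by \<open>\<phi>\<^sub>0\<close>: up to sign and multiplication by \<open>x\<^sup>\<beta>\<close>, the elements of \<open>U_phi\<close> are the
  non-zero values of \<open>\<phi>\<^sub>0\<close> on the basis, and \<open>\<theta>_phi\<close> recovers the argument.\<close>

definition U_phi :: "(('n mon \<times> 'n set) \<times> ('n mon \<times> nat)) set" where
  "U_phi = {((\<beta>, I), (\<alpha>, j)). (\<alpha>, j) \<in> std \<and> dominates (I \<inter> N j) \<alpha>}"

text \<open>The unmatched elements, up to multiplication by \<open>x\<^sup>\<beta>\<close>: the basis of \<open>G\<close>.\<close>

definition C_phi :: "(('n mon \<times> 'n set) \<times> ('n mon \<times> nat)) set" where
  "C_phi = {((\<beta>, I), (\<alpha>, j)). j < r \<and> \<alpha> = 0 \<and> I \<subseteq> CR j}"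

definition \<theta>_phi :: "('n mon \<times> 'n set) \<times> ('n mon \<times> nat) \<Rightarrow> ('n mon \<times> 'n set) \<times> ('n mon \<times> nat)" where
  "\<theta>_phi = (\<lambda>((\<beta>, I), (\<alpha>, j)). ((\<beta>, I - {Max (I \<inter> N j)}), (\<alpha> + vexp (Max (I \<inter> N j)), j)))"

text \<open>The basis element \<open>x\<^sup>\<beta> e\<^sub>I x\<^sup>\<alpha> g\<^sub>j\<close> is measured by the term \<open>x\<^sub>I x\<^sup>\<alpha> g\<^sub>j\<close>, in which the
  exterior variables are multiplied out; moving a variable from \<open>I\<close> to \<open>\<alpha>\<close> does not change it.\<close>

definition \<nu>_phi :: "('n mon \<times> 'n set) \<times> ('n mon \<times> nat) \<Rightarrow> nat" where
  "\<nu>_phi = (\<lambda>((\<beta>, I), (\<alpha>, j)). tmeas ((\<Sum>i\<in>I. vexp i) + \<alpha>, j))"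

lemma sum_vexp_minus: "i \<in> I \<Longrightarrow> (\<Sum>i\<in>I. vexp i) = vexp i + (\<Sum>i\<in>I - {i}. vexp i)" for I :: "'n set"
  by (rule sum.remove) simp_all

lemma zero_std: "j < r \<Longrightarrow> (0, j) \<in> std"
  by (simp add: std_def)

lemma std_add: "(\<alpha>, j) \<in> std \<Longrightarrow> i \<in> N j \<Longrightarrow> (\<alpha> + vexp i, j) \<in> std"
  by (auto simp: std_def keys_add_nat)

lemma std_diff: "(\<alpha>, j) \<in> std \<Longrightarrow> (\<alpha> - \<gamma>, j) \<in> std"
  by (auto simp: std_def in_keys_iff lookup_minus)

lemma std_keys: "(\<alpha>, j) \<in> std \<Longrightarrow> i \<in> Poly_Mapping.keys \<alpha> \<Longrightarrow> i \<in> N j"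
  by (auto simp: std_def)

sublocale mphi: matching KF "\<lambda>c. FS (const c)" cF bF dF U_phi C_phi \<theta>_phi \<nu>_phi labF shF
proof
  show "Fc.klin dF" by (rule klin_dF)
  show "U_phi \<subseteq> KF" "C_phi \<subseteq> KF" by (auto simp: U_phi_def C_phi_def KF_def zero_std)
  show "U_phi \<inter> C_phi = {}" by (auto simp: U_phi_def C_phi_def dominates_def ncrit_def)
  show "inj_on \<theta>_phi U_phi"
  proof (rule inj_onI)
    fix \<kappa> \<kappa>' assume a: "\<kappa> \<in> U_phi" "\<kappa>' \<in> U_phi" "\<theta>_phi \<kappa> = \<theta>_phi \<kappa>'"
    obtain \<beta> I \<alpha> j where k: "\<kappa> = ((\<beta>, I), (\<alpha>, j))" "dominates (I \<inter> N j) \<alpha>"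
      using a(1) by (auto simp: U_phi_def)
    obtain \<beta>' I' \<alpha>' j' where k': "\<kappa>' = ((\<beta>', I'), (\<alpha>', j'))" "dominates (I' \<inter> N j') \<alpha>'"
      using a(2) by (auto simp: U_phi_def)
    let ?M = "Max (I \<inter> N j)" and ?M' = "Max (I' \<inter> N j')"
    have e: "\<beta> = \<beta>'" "j' = j" "I - {?M} = I' - {?M'}" "\<alpha> + vexp ?M = \<alpha>' + vexp ?M'"
      using a(3) by (auto simp: \<theta>_phi_def k k')
    have "I \<inter> N j - {?M} = I' \<inter> N j' - {?M'}" using e by blast
    from dominates_move_inj[OF k(2) k'(2) this e(4)] have "?M = ?M'" "\<alpha> = \<alpha>'" by auto
    moreover have "?M \<in> I" "?M' \<in> I'" using dominates_Max(1)[OF k(2)] dominates_Max(1)[OF k'(2)] by auto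
    ultimately show "\<kappa> = \<kappa>'" using e by (auto simp: k k')
  qed
  show "\<theta>_phi ` U_phi = KF - (U_phi \<union> C_phi)"
  proof (intro set_eqI iffI)
    fix \<kappa> assume "\<kappa> \<in> \<theta>_phi ` U_phi"
    then obtain \<beta> I \<alpha> j where k: "\<kappa> = ((\<beta>, I - {Max (I \<inter> N j)}), (\<alpha> + vexp (Max (I \<inter> N j)), j))"
      "(\<alpha>, j) \<in> std" "dominates (I \<inter> N j) \<alpha>"
      by (auto simp: U_phi_def \<theta>_phi_def)
    let ?M = "Max (I \<inter> N j)"
    have "?M \<in> Poly_Mapping.keys (\<alpha> + vexp ?M)" by (simp add: keys_add_nat)
    then have "\<alpha> + vexp ?M \<noteq> 0" by (metis keys_zero empty_iff)
    moreover have "(\<alpha> + vexp ?M, j) \<in> std" using k dominates_Max(1)[OF k(3)] by (intro std_add) auto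
    moreover have "(I - {?M}) \<inter> N j = I \<inter> N j - {?M}" by blast
    ultimately show "\<kappa> \<in> KF - (U_phi \<union> C_phi)"
      using k dominates_moved[OF k(3)] by (auto simp: KF_def U_phi_def C_phi_def)
  next
    fix \<kappa> assume a: "\<kappa> \<in> KF - (U_phi \<union> C_phi)"
    obtain \<beta> I \<alpha> j where k: "\<kappa> = ((\<beta>, I), (\<alpha>, j))" by (metis prod.exhaust)
    have t: "(\<alpha>, j) \<in> std" and nd: "\<not> dominates (I \<inter> N j) \<alpha>" using a by (auto simp: k KF_def U_phi_def)
    have b: "\<alpha> \<noteq> 0"
    proof
      assume "\<alpha> = 0"
      moreover from this have "I \<inter> N j = {}" using not_dominates_zero nd by blast
      ultimately show False using a t by (auto simp: k C_phi_def ncrit_def std_iff)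
    qed
    let ?t = "Max (Poly_Mapping.keys \<alpha>)"
    note n = not_dominates[OF nd b]
    have tN: "?t \<in> N j" using std_keys[OF t n(1)] .
    then have "?t \<notin> I" using n(2)[of ?t] by auto
    moreover have "insert ?t I \<inter> N j = insert ?t (I \<inter> N j)" using tN by blast
    ultimately have "\<theta>_phi ((\<beta>, insert ?t I), (\<alpha> - vexp ?t, j)) = \<kappa>"
      using n by (simp add: k \<theta>_phi_def diff_vexp_add)
    moreover have "((\<beta>, insert ?t I), (\<alpha> - vexp ?t, j)) \<in> U_phi"
      using n(4) t tN by (simp add: U_phi_def std_diff)
    ultimately show "\<kappa> \<in> \<theta>_phi ` U_phi" by force
  qed
  show "\<nu>_phi (\<theta>_phi \<kappa>) = \<nu>_phi \<kappa>" if U: "\<kappa> \<in> U_phi" for \<kappa>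
  proof -
    obtain \<beta> I \<alpha> j where k: "\<kappa> = ((\<beta>, I), (\<alpha>, j))" "dominates (I \<inter> N j) \<alpha>"
      using U by (auto simp: U_phi_def)
    have "Max (I \<inter> N j) \<in> I" using dominates_Max(1)[OF k(2)] by blast
    from sum_vexp_minus[OF this] show ?thesis by (simp add: k \<nu>_phi_def \<theta>_phi_def add_ac)
  qed
  show "cF (dF (bF \<kappa>)) (\<theta>_phi \<kappa>) \<noteq> 0" if U: "\<kappa> \<in> U_phi" for \<kappa>
  proof -
    obtain \<beta> I \<alpha> j where k: "\<kappa> = ((\<beta>, I), (\<alpha>, j))" "(\<alpha>, j) \<in> std" "dominates (I \<inter> N j) \<alpha>"
      using U by (auto simp: U_phi_def)
    let ?M = "Max (I \<inter> N j)"
    have M: "?M \<in> I" "?M \<in> N j" using dominates_Max(1)[OF k(3)] by auto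
    have s: "(\<alpha> + vexp ?M, j) \<in> std" using k M by (intro std_add)
    have "cF (dF (bF \<kappa>)) (\<theta>_phi \<kappa>) = (\<Sum>i\<in>I. if i = ?M then - sg i I else 0)"
      unfolding k bF_def dF_single \<theta>_phi_def prod.case cF_dB fst_conv snd_conv
    proof (intro sum.cong refl)
      fix i assume i: "i \<in> I"
      have "(I - {i} = I - {?M}) = (i = ?M)" using i M by auto
      moreover have "scale (var ?M) (g (\<alpha>, j)) = g (\<alpha> + vexp ?M, j)"
        using scale_monom_g[of "(\<alpha>, j)" "vexp ?M"] std_snd[OF k(2)] by (simp add: var_def add.commute)
      ultimately show "sg i I *
        ((if (\<beta> + vexp i, I - {i}) = (\<beta>, I - {?M}) then cM (g (\<alpha>, j)) (\<alpha> + vexp ?M, j) else 0) -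
         (if (\<beta>, I - {i}) = (\<beta>, I - {?M}) then cM (scale (var i) (g (\<alpha>, j))) (\<alpha> + vexp ?M, j) else 0)) =
        (if i = ?M then - sg i I else 0)"
        using s by (auto simp: mc.cf_bas)
    qed
    then show ?thesis using M by simp
  qed
  show "\<kappa>' = \<theta>_phi \<kappa> \<or> \<kappa>' \<in> U_phi \<union> C_phi \<or> \<nu>_phi \<kappa>' < \<nu>_phi \<kappa>" if U: "\<kappa> \<in> U_phi" and nz: "cF (dF (bF \<kappa>)) \<kappa>' \<noteq> 0" for \<kappa> \<kappa>'
  proof -
    obtain \<beta> I \<alpha> j where k: "\<kappa> = ((\<beta>, I), (\<alpha>, j))" "(\<alpha>, j) \<in> std" "dominates (I \<inter> N j) \<alpha>"
      using U by (auto simp: U_phi_def)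
    have j: "j < r" using std_snd[OF k(2)] by simp
    have "\<kappa> \<in> KF" using k by (simp add: KF_def)
    then show ?thesis using nz
    proof (cases rule: cF_d_bF_nonzero)
      case (lift i)
      let ?\<tau> = "((\<Sum>l\<in>I - {i}. vexp l) + \<alpha>, j)"
      have i: "i \<in> I" using lift k by simp
      have e: "((\<Sum>l\<in>I. vexp l) + \<alpha>, j) = (fst ?\<tau> + vexp i, j)"
        using sum_vexp_minus[OF i] by (simp add: add_ac)
      have "tmeas ?\<tau> < tmeas ((\<Sum>l\<in>I. vexp l) + \<alpha>, j)"
        unfolding e
        by (rule tmeas_less) (use j prec_increase[of "vexp i" j] in \<open>auto simp: tdeg_def mdeg_add\<close>)
      then show ?thesis using lift k by (simp add: \<nu>_phi_def)
    next
      case (act i)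
      obtain \<alpha>' j' where k': "\<kappa>' = ((\<beta>, I - {i}), (\<alpha>', j'))" using act k by (cases \<kappa>') auto
      have i: "i \<in> I" and c: "cM (g (vexp i + \<alpha>, j)) (\<alpha>', j') \<noteq> 0" using act k k' by auto
      show ?thesis
      proof (cases "i \<in> N j")
        case True
        then have "(vexp i + \<alpha>, j) \<in> std" using std_add[OF k(2)] by (simp add: add.commute)
        then have eq: "\<alpha>' = vexp i + \<alpha>" "j' = j" and st: "(\<alpha>', j') \<in> std"
          using c by (auto simp: mc.cf_bas split: if_splits)
        show ?thesis
        proof (cases "i = Max (I \<inter> N j)")
          case True
          then show ?thesis by (simp add: k k' eq \<theta>_phi_def add.commute)
        next
          case False
          then have "dominates (I \<inter> N j - {i}) (vexp i + \<alpha>)"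
            using dominates_other[OF k(3)] i True by auto
          moreover have "I \<inter> N j - {i} = (I - {i}) \<inter> N j" by blast
          ultimately show ?thesis using st by (simp add: k k' eq U_phi_def)
        qed
      next
        case False
        then have ns: "(vexp i + \<alpha>, j) \<notin> std" by (auto simp: std_def keys_add_nat)
        have p: "prec (\<alpha>', j') (vexp i + \<alpha>, j)" and td: "tdeg (\<alpha>', j') = tdeg (vexp i + \<alpha>, j)"
          and j': "j' < r"
          using cM_g[of "(vexp i + \<alpha>, j)" "(\<alpha>', j')"] c j ns std_snd by auto
        let ?s = "\<Sum>l\<in>I - {i}. vexp l"
        have e: "((\<Sum>l\<in>I. vexp l) + \<alpha>, j) = (?s + (vexp i + \<alpha>), j)"
          using sum_vexp_minus[OF i] by (simp add: add_ac)
        have "tmeas (?s + \<alpha>', j') < tmeas ((\<Sum>l\<in>I. vexp l) + \<alpha>, j)"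
          unfolding e
          by (rule tmeas_less) (use p j j' td in \<open>auto simp: tdeg_def mdeg_add intro: prec_mult\<close>)
        then show ?thesis by (simp add: k k' \<nu>_phi_def)
      qed
    qed
  qed
  show "labF \<kappa> = shF (labF \<kappa>')" if "\<kappa> \<in> U_phi" "cF (dF (bF \<kappa>)) \<kappa>' \<noteq> 0" for \<kappa> \<kappa>'
    using that by (intro labF_dF) (auto simp: U_phi_def KF_def)
  show "inj shF" by (rule inj_shF)
qed

end


section \<open>The maps \<open>\<phi>\<close> and \<open>\<pi>\<close>\<close>

context initially_linear
begin

lemma bF_nonzero: "\<kappa> \<in> KF \<Longrightarrow> bF \<kappa> \<noteq> 0"
  using Fc.cf_bas[of \<kappa> \<kappa>] by auto

lemma FS_U_phi: "x \<in> Fc.supported U_phi \<Longrightarrow> FS p x \<in> Fc.supported U_phi"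
  by (rule supported_FS) (auto simp: U_phi_def)

lemma FS_U_C_phi: "x \<in> Fc.supported (U_phi \<union> C_phi) \<Longrightarrow> FS p x \<in> Fc.supported (U_phi \<union> C_phi)"
  by (rule supported_FS) (auto simp: U_phi_def C_phi_def)

lemma contr_FS: "mphi.contr (FS p x) = FS p (mphi.contr x)"
proof (rule mphi.contr_eqI)
  show "FS p (mphi.contr x) \<in> Fc.supported U_phi" by (rule FS_U_phi[OF mphi.contr_in(1)])
  have "FS p x - dF (FS p (mphi.contr x)) = FS p (x - dF (mphi.contr x))"
    by (simp add: dF_FS FM.scale_right_diff_distrib)
  then show "FS p x - dF (FS p (mphi.contr x)) \<in> Fc.supported (U_phi \<union> C_phi)"
    using FS_U_C_phi[OF mphi.contr_in(2)] by simp
qed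

lemma klin_contr: "Fc.klin mphi.contr"
  by (rule FS_linear_klin) (simp_all add: mphi.contr_add contr_FS)

lemma contr_diff: "mphi.contr (x - y) = mphi.contr x - mphi.contr y"
  by (rule Fc.klin_diff[OF klin_contr])

lemma phi0_moves:
  assumes "\<not> dominates (I \<inter> N j) \<alpha>" "\<alpha> \<noteq> 0"
  defines "t \<equiv> Max (Poly_Mapping.keys \<alpha>)"
  shows "phi0 scale r eta prec I \<alpha> j
    = FS (const (- sg t (insert t I))) (bF ((0, insert t I), (\<alpha> - vexp t, j)))"
  using not_dominates(2)[OF assms(1,2)] assms(2)
  by (auto simp: phi0_def top_index_def t_def F_elt_bF eps_const const_uminus)

lemma phi0_zero: "dominates (I \<inter> N j) \<alpha> \<or> \<alpha> = 0 \<Longrightarrow> phi0 scale r eta prec I \<alpha> j = 0"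
proof -
  assume a: "dominates (I \<inter> N j) \<alpha> \<or> \<alpha> = 0"
  have "\<not> (\<alpha> \<noteq> 0 \<and> (\<forall>i \<in> I \<inter> N j. i < top_index \<alpha>))"
  proof
    assume b: "\<alpha> \<noteq> 0 \<and> (\<forall>i \<in> I \<inter> N j. i < top_index \<alpha>)"
    then have d: "dominates (I \<inter> N j) \<alpha>" using a by blast
    have "Poly_Mapping.keys \<alpha> \<noteq> {}"
      using b by (metis poly_mapping_eqI lookup_zero in_keys_iff empty_iff)
    then have "top_index \<alpha> \<in> Poly_Mapping.keys \<alpha>" by (simp add: top_index_def)
    then have "top_index \<alpha> \<le> Max (I \<inter> N j)" using dominates_Max(2)[OF d] by blast
    moreover have "Max (I \<inter> N j) < top_index \<alpha>" using b dominates_Max(1)[OF d] by blast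
    ultimately show False by simp
  qed
  then show ?thesis unfolding phi0_def by auto
qed

lemma not_moved_U_C_phi:
  assumes "(\<alpha>, j) \<in> std" "dominates (I \<inter> N j) \<alpha> \<or> \<alpha> = 0"
  shows "((\<beta>, I), (\<alpha>, j)) \<in> U_phi \<union> C_phi"
proof (cases "dominates (I \<inter> N j) \<alpha>")
  case False
  then have "\<alpha> = 0" "I \<inter> N j = {}" using assms not_dominates_zero by auto
  then show ?thesis using assms by (auto simp: C_phi_def ncrit_def std_iff)
qed (use assms in \<open>simp add: U_phi_def\<close>)

lemma moved_U_phi:
  assumes "(\<alpha>, j) \<in> std" "\<not> dominates (I \<inter> N j) \<alpha>" "\<alpha> \<noteq> 0"
  defines "t \<equiv> Max (Poly_Mapping.keys \<alpha>)"
  shows "((0, insert t I), (\<alpha> - vexp t, j)) \<in> U_phi"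
proof -
  note n = not_dominates[OF assms(2,3)]
  have "insert t I \<inter> N j = insert t (I \<inter> N j)"
    using std_keys[OF assms(1) n(1)] by (auto simp: t_def)
  then show ?thesis using n(4) assms(1) by (simp add: U_phi_def std_diff t_def)
qed

lemma module_hom_contr: "module_hom FS FS mphi.contr"
  by (simp add: module_hom_iff module_FS mphi.contr_add contr_FS)

lemma phi_recursion_contr: "phi_recursion scale r eta prec mphi.contr"
  unfolding phi_recursion_def
proof (intro allI impI)
  fix I j and \<alpha> :: "'n mon"
  assume j: "j < r" "Poly_Mapping.keys \<alpha> \<subseteq> N j"
  then have std: "(\<alpha>, j) \<in> std" by (simp add: std_def)
  let ?p = "phi0 scale r eta prec I \<alpha> j"
  show "mphi.contr (F_elt eta I \<alpha> j) =
    (if ?p = 0 then 0 else ?p - mphi.contr (dF ?p - F_elt eta I \<alpha> j))"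
  proof (cases "dominates (I \<inter> N j) \<alpha> \<or> \<alpha> = 0")
    case True
    then have "F_elt eta I \<alpha> j \<in> Fc.supported (U_phi \<union> C_phi)"
      using not_moved_U_C_phi[OF std] mphi.U_K mphi.C_K unfolding F_elt_bF by (intro Fc.supported_bas) auto
    then show ?thesis using phi0_zero[OF True] by (simp add: mphi.contr_UC)
  next
    case False
    \<comment> \<open>Here \<open>\<phi>\<^sub>0\<close> lies in the span of \<open>U_phi\<close>, so the contraction inverts \<open>d\<^sub>F\<close> on it.\<close>
    define t where "t = Max (Poly_Mapping.keys \<alpha>)"
    let ?b = "bF ((0, insert t I), (\<alpha> - vexp t, j))"
    have p: "?p = FS (const (- sg t (insert t I))) ?b"
      using False by (simp add: phi0_moves t_def)
    have U: "((0, insert t I), (\<alpha> - vexp t, j)) \<in> U_phi"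
      using moved_U_phi[OF std] False by (simp add: t_def)
    then have "?b \<in> Fc.supported U_phi" using mphi.U_K by (auto intro: Fc.supported_bas)
    then have "?p \<in> Fc.supported U_phi" unfolding p by (rule Fc.supported_ks)
    then have "mphi.contr (dF ?p) = ?p" by (rule mphi.contr_d)
    moreover have "?p \<noteq> 0"
    proof -
      have "cF ?p ((0, insert t I), (\<alpha> - vexp t, j)) = - sg t (insert t I)"
        unfolding p Fc.cf_ks using U mphi.U_K by (auto simp: Fc.cf_bas)
      then have "cF ?p ((0, insert t I), (\<alpha> - vexp t, j)) \<noteq> 0" by simp
      then show ?thesis by auto
    qed
    ultimately show ?thesis by (simp add: contr_diff)
  qed
qed

lemma module_hom_klin: "module_hom FS FS f \<Longrightarrow> Fc.klin f"
  by (simp add: module_hom_iff Fc.klin_def)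

lemma module_hom_bF: "module_hom FS FS f \<Longrightarrow> f (bF ((\<beta>, I), t)) = FS (monom \<beta>) (f (bF ((0, I), t)))"
  by (subst bF_shift) (simp add: module_hom_iff)

text \<open>Any solution of the recursion vanishes on the span of \<open>U_phi \<union> C_phi\<close> and inverts \<open>d\<^sub>F\<close> on the
  span of \<open>U_phi\<close>; these two properties determine it.\<close>

lemma phi_recursion_unique:
  assumes hom: "module_hom FS FS f" and rec: "phi_recursion scale r eta prec f"
  shows "f = mphi.contr"
proof
  fix x
  note kl = module_hom_klin[OF hom]
  have fF: "f (bF ((0, I), (\<alpha>, j))) = (let p = phi0 scale r eta prec I \<alpha> j in
      if p = 0 then 0 else p - f (dF p - bF ((0, I), (\<alpha>, j))))" if "(\<alpha>, j) \<in> std" for I \<alpha> j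
    using rec that unfolding phi_recursion_def F_elt_bF std_def by (auto simp: Let_def)
  have zero: "f y = 0" if "y \<in> Fc.supported (U_phi \<union> C_phi)" for y
  proof -
    have "f y \<in> Fc.supported {}" using kl that
    proof (rule Fc.klin_supported)
      fix \<kappa> assume k: "\<kappa> \<in> U_phi \<union> C_phi" "\<kappa> \<in> KF"
      obtain \<beta> I \<alpha> j where e: "\<kappa> = ((\<beta>, I), (\<alpha>, j))" by (metis prod.exhaust)
      have "(\<alpha>, j) \<in> std" "dominates (I \<inter> N j) \<alpha> \<or> \<alpha> = 0"
        using k by (auto simp: e KF_def U_phi_def C_phi_def)
      then have "f (bF ((0, I), (\<alpha>, j))) = 0" using fF phi0_zero by (simp add: Let_def)
      then have "f (bF \<kappa>) = 0" using module_hom_bF[OF hom, of \<beta> I "(\<alpha>, j)"] by (simp add: e)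
      then show "f (bF \<kappa>) \<in> Fc.supported {}" by simp
    qed
    then show ?thesis by (rule Fc.supported_empty)
  qed
  have inv: "f (dF u) = u" if "u \<in> Fc.supported U_phi" for u
    using that
  proof (induction rule: Fc.supported_induct)
    case zero
    then show ?case by (simp add: Fc.klin_zero[OF kl])
  next
    case (add x y)
    then show ?case by (simp add: dF_add Fc.klin_add[OF kl])
  next
    case (basis c \<kappa>)
    obtain \<beta> I \<alpha> j where e: "\<kappa> = ((\<beta>, I), (\<alpha>, j))" "(\<alpha>, j) \<in> std" "dominates (I \<inter> N j) \<alpha>"
      using basis by (auto simp: U_phi_def)
    define M where "M = Max (I \<inter> N j)"
    \<comment> \<open>\<open>e\<^sub>I x\<^sup>\<alpha> g\<^sub>j\<close> is up to sign the value of \<open>\<phi>\<^sub>0\<close> at its partner \<open>e\<^bsub>I'\<^esub> x\<^bsup>\<alpha>'\<^esup> g\<^sub>j\<close>.\<close>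
    define I' \<alpha>' where "I' = I - {M}" and "\<alpha>' = \<alpha> + vexp M"
    have M: "M \<in> I" "M \<in> N j" using dominates_Max(1)[OF e(3)] by (auto simp: M_def)
    have "I' \<inter> N j = I \<inter> N j - {M}" by (auto simp: I'_def)
    then have nd: "\<not> dominates (I' \<inter> N j) \<alpha>'" using dominates_moved[OF e(3)] by (simp add: M_def \<alpha>'_def)
    have MK: "M \<in> Poly_Mapping.keys \<alpha>'" by (simp add: \<alpha>'_def keys_add_nat)
    then have ne: "\<alpha>' \<noteq> 0" by (metis keys_zero empty_iff)
    have mx: "Max (Poly_Mapping.keys \<alpha>') = M"
      using dominates_Max(2)[OF e(3)] by (intro Max_eqI) (auto simp: \<alpha>'_def keys_add_nat M_def)
    have std': "(\<alpha>', j) \<in> std" using e M by (simp add: \<alpha>'_def std_add)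
    define a where "a = (- sg M I :: 'k)"
    have a0: "a \<noteq> 0" by (simp add: a_def)
    let ?b = "bF ((0, I), (\<alpha>, j))"
    have ins: "insert M I' = I" using M by (auto simp: I'_def)
    have am: "\<alpha>' - vexp M = \<alpha>" by (simp add: \<alpha>'_def)
    have p: "phi0 scale r eta prec I' \<alpha>' j = FS (const a) ?b"
      using phi0_moves[OF nd ne] unfolding mx ins am a_def .
    have pn: "FS (const a) ?b \<noteq> 0"
    proof
      assume "FS (const a) ?b = 0"
      then have "FS (const (1 / a)) (FS (const a) ?b) = 0" by simp
      then have "?b = 0" using a0 by (simp only: Fc.ks_ks) simp
      then show False using bF_nonzero[of "((0, I), (\<alpha>, j))"] e by (simp add: KF_def)
    qed
    have "f (bF ((0, I'), (\<alpha>', j))) = FS (const a) ?b - f (dF (FS (const a) ?b) - bF ((0, I'), (\<alpha>', j)))"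
      using fF[OF std', of I'] pn by (simp add: p Let_def)
    then have "f (dF (FS (const a) ?b)) = FS (const a) ?b"
      by (simp add: Fc.klin_diff[OF kl])
    then have "FS (const a) (f (dF ?b)) = FS (const a) ?b"
      by (simp only: dF_FS Fc.klin_ks[OF kl])
    then have "FS (const (1 / a)) (FS (const a) (f (dF ?b))) = FS (const (1 / a)) (FS (const a) ?b)"
      by (rule arg_cong)
    then have 0: "f (dF ?b) = ?b" using a0 by (simp only: Fc.ks_ks) simp
    have sc: "f (FS q y) = FS q (f y)" for q y using hom by (simp add: module_hom_iff)
    show ?case unfolding e(1) bF_shift[of \<beta>] dF_FS sc 0 ..
  qed
  have "f x = f (x - dF (mphi.contr x)) + f (dF (mphi.contr x))"
    by (simp add: Fc.klin_diff[OF kl])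
  then show "f x = mphi.contr x"
    using zero[OF mphi.contr_in(2)[of x]] inv[OF mphi.contr_in(1)[of x]] by simp
qed

lemma phi_eq: "phi scale r eta prec = mphi.contr"
  unfolding phi_def
proof (rule the_equality)
  show "module_hom FS FS mphi.contr \<and> phi_recursion scale r eta prec mphi.contr"
    using module_hom_contr phi_recursion_contr by (rule conjI)
  show "f = mphi.contr" if "module_hom FS FS f \<and> phi_recursion scale r eta prec f" for f
    using that by (elim conjE) (rule phi_recursion_unique)
qed

text \<open>The projection \<open>\<pi>\<close> of \<open>F\<close> to \<open>G\<close>.\<close>

abbreviation pr :: "('n, 'm) fcx \<Rightarrow> ('n, 'm) fcx" where
  "pr \<equiv> Fc.restr C_phi"

lemma pr_FS: "pr (FS p x) = FS p (pr x)"
proof (rule FS_linearI)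
  show "Fc.klin pr" by (rule Fc.klin_restr)
  fix \<gamma> x
  have "pr (FS (monom \<gamma>) x) - FS (monom \<gamma>) (pr x) = pr (FS (monom \<gamma>) (x - pr x)) + (pr (FS (monom \<gamma>) (pr x)) - FS (monom \<gamma>) (pr x))"
    by (simp add: FM.scale_right_diff_distrib Fc.klin_diff[OF Fc.klin_restr])
  moreover have "FS (monom \<gamma>) (pr x) \<in> Fc.supported C_phi"
    by (rule supported_FS[OF Fc.supported_restr]) (auto simp: C_phi_def)
  moreover have "FS (monom \<gamma>) (x - pr x) \<in> Fc.supported (- C_phi)"
    by (rule supported_FS) (auto intro!: Fc.supportedI simp: Fc.cf_diff Fc.cf_restr C_phi_def split: if_splits)
  ultimately have "pr (FS (monom \<gamma>) x) - FS (monom \<gamma>) (pr x) = 0"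
    using Fc.restr_supported Fc.restr_disjoint[of _ "- C_phi" C_phi] by simp
  then show "pr (FS (monom \<gamma>) x) = FS (monom \<gamma>) (pr x)" by simp
qed

lemma pr_add: "pr (x + y) = pr x + pr y" and pr_diff: "pr (x - y) = pr x - pr y"
  using Fc.klin_add[OF Fc.klin_restr] Fc.klin_diff[OF Fc.klin_restr] by auto

lemma proj_G_eq: "proj_G scale r eta prec = pr"
  unfolding proj_G_def
proof (rule the_equality)
  have val: "pr (bF ((0, I), (\<alpha>, j))) = (if \<alpha> = 0 \<and> I \<subseteq> CR j then bF ((0, I), (\<alpha>, j)) else 0)"
    if "(\<alpha>, j) \<in> std" for I \<alpha> j
    by (rule Fc.cf_eqI)
       (use that std_snd[OF that] in \<open>auto simp: Fc.cf_restr Fc.cf_bas KF_def C_phi_def split: if_splits\<close>)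
  show "module_hom FS FS pr \<and> (\<forall>I \<alpha> j. j < r \<longrightarrow> Poly_Mapping.keys \<alpha> \<subseteq> N j \<longrightarrow>
      pr (F_elt eta I \<alpha> j) = (if \<alpha> = 0 \<and> I \<subseteq> CR j then F_elt eta I \<alpha> j else 0))"
    using val by (auto simp: module_hom_iff module_FS pr_FS pr_add F_elt_bF std_def)
  fix f assume f: "module_hom FS FS f \<and> (\<forall>I \<alpha> j. j < r \<longrightarrow> Poly_Mapping.keys \<alpha> \<subseteq> N j \<longrightarrow>
      f (F_elt eta I \<alpha> j) = (if \<alpha> = 0 \<and> I \<subseteq> CR j then F_elt eta I \<alpha> j else 0))"
  then have hom: "module_hom FS FS f" by blast
  have hpr: "module_hom FS FS pr" by (simp add: module_hom_iff module_FS pr_FS pr_add)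
  show "f = pr"
  proof
    fix x show "f x = pr x"
    proof (rule Fc.klin_eqI[OF module_hom_klin[OF hom] Fc.klin_restr])
      fix \<kappa> assume k: "\<kappa> \<in> KF"
      obtain \<beta> I \<alpha> j where e: "\<kappa> = ((\<beta>, I), (\<alpha>, j))" by (metis prod.exhaust)
      have s: "(\<alpha>, j) \<in> std" using k by (simp add: e KF_def)
      then have "f (bF ((0, I), (\<alpha>, j))) = pr (bF ((0, I), (\<alpha>, j)))"
        using f val by (simp add: F_elt_bF std_def)
      then show "f (bF \<kappa>) = pr (bF \<kappa>)"
        using module_hom_bF[OF hom, of \<beta> I "(\<alpha>, j)"] module_hom_bF[OF hpr, of \<beta> I "(\<alpha>, j)"]
        by (simp add: e)
    qed
  qed
qed


section \<open>The complex \<open>G\<close>\<close>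

text \<open>The module \<open>G\<^sub>p\<close> as a coordinate subspace of \<open>F\<close>, and its \<open>S\<close>-basis.\<close>

definition Gp :: "nat \<Rightarrow> ('n, 'm) fcx set" where
  "Gp p = Fc.supported {\<kappa>\<in>C_phi. card (snd (fst \<kappa>)) = p}"

definition Gbasis :: "nat \<Rightarrow> ('n, 'm) fcx set" where
  "Gbasis p = {F_elt eta I 0 j | I j. j < r \<and> I \<subseteq> CR j \<and> card I = p}"

lemma subspace_supported:
  assumes "\<And>\<beta> I t \<gamma>. ((\<beta>, I), t) \<in> T \<Longrightarrow> ((\<gamma> + \<beta>, I), t) \<in> T"
  shows "FM.subspace (Fc.supported T)"
  by (rule FM.subspaceI) (auto intro: Fc.supported_add supported_FS assms)

lemma Gbasis_span: "FM.span (Gbasis p) = Gp p"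
proof (rule FM.span_subspace)
  show "Gbasis p \<subseteq> Gp p"
    using zero_std by (auto simp: Gbasis_def Gp_def F_elt_bF C_phi_def KF_def intro!: Fc.supported_bas)
  show "FM.subspace (Gp p)"
    unfolding Gp_def by (rule subspace_supported) (auto simp: C_phi_def)
  show "Gp p \<subseteq> FM.span (Gbasis p)"
  proof
    fix x assume "x \<in> Gp p"
    then show "x \<in> FM.span (Gbasis p)" unfolding Gp_def
    proof (induction rule: Fc.supported_induct)
      case (basis c \<kappa>)
      then obtain \<beta> I j where k: "\<kappa> = ((\<beta>, I), (0, j))" "j < r" "I \<subseteq> CR j" "card I = p"
        by (auto simp: C_phi_def)
      have "bF ((0, I), (0, j)) \<in> Gbasis p"
        using k by (auto simp: Gbasis_def F_elt_bF)
      then show ?case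
        unfolding k bF_shift[of \<beta>] by (intro FM.span_scale FM.span_base)
    qed (simp_all add: FM.span_zero FM.span_add)
  qed
qed

lemma G_mod_eq: "G_mod scale r eta prec p = Gp p"
  unfolding G_mod_def Gbasis_span[symmetric] Gbasis_def ..

lemma finite_Gbasis: "finite (Gbasis p)"
  by (rule finite_subset[of _ "(\<lambda>(I, j). F_elt eta I 0 j) ` (UNIV \<times> {..<r})"]) (auto simp: Gbasis_def)

lemma cF_FS_bF:
  assumes "t \<in> std"
  shows "cF (FS p (bF ((0, I), t))) ((\<beta>, I'), t') = (if I' = I \<and> t' = t then Poly_Mapping.lookup p \<beta> else 0)"
proof (induction p rule: poly_mapping_additive_induct)
  case (single \<gamma> c)
  have "((\<gamma>, I), t) \<in> KF" using assms by (simp add: KF_def)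
  then show ?case
    unfolding FS_single_bF Fc.cf_ks by (auto simp: Fc.cf_bas lookup_single when_def)
qed (simp_all add: FS_add_left Fc.cf_add lookup_add)

lemma Gbasis_independent: "\<not> FM.dependent (Gbasis p)"
proof
  assume "FM.dependent (Gbasis p)"
  then obtain T u v where T: "finite T" "T \<subseteq> Gbasis p" "(\<Sum>w\<in>T. FS (u w) w) = 0" "v \<in> T" "u v \<noteq> 0"
    unfolding FM.dependent_explicit by blast
  then obtain I j where v: "v = bF ((0, I), (0, j))" "j < r" by (auto simp: Gbasis_def F_elt_bF)
  have "Poly_Mapping.lookup (u v) \<beta> = 0" for \<beta>
  proof -
    let ?i = "((\<beta>, I), ((0 :: 'n mon), j))"
    have "cF (FS (u w) w) ?i = (if w = v then Poly_Mapping.lookup (u v) \<beta> else 0)" if wT: "w \<in> T" for w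
    proof -
      obtain I' j' where w: "w = bF ((0, I'), (0, j'))" "j' < r"
        using wT T(2) by (auto simp: Gbasis_def F_elt_bF)
      have "(w = v) = (I' = I \<and> j' = j)"
      proof
        assume "w = v"
        then have "cF w ((0, I), (0, j)) = 1"
          using v zero_std by (simp add: Fc.cf_bas KF_def)
        then show "I' = I \<and> j' = j"
          using w zero_std by (simp add: Fc.cf_bas KF_def split: if_splits)
      qed (use v w in simp)
      then show ?thesis unfolding w using cF_FS_bF[OF zero_std[OF w(2)]] by auto
    qed
    then have "cF (\<Sum>w\<in>T. FS (u w) w) ?i = (\<Sum>w\<in>T. if w = v then Poly_Mapping.lookup (u v) \<beta> else 0)"
      unfolding Fc.cf_sum by (intro sum.cong) auto
    then show ?thesis using T by simp
  qed
  then have "u v = 0" by (intro poly_mapping_eqI) simp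
  then show False using T by simp
qed

text \<open>The chain \<open>d\<^sub>F x - d\<^sub>F (\<phi> (d\<^sub>F x))\<close>, whose image under \<open>\<pi>\<close> is the differential of \<open>G\<close>.\<close>

definition pd :: "('n, 'm) fcx \<Rightarrow> ('n, 'm) fcx" where
  "pd x = dF x - dF (mphi.contr (dF x))"

lemma d_G_eq: "d_G scale r eta prec x = pr (pd x)"
  by (simp add: d_G_def phi_eq proj_G_eq pd_def)

lemma dF_pd: "dF (pd x) = 0"
  by (simp add: pd_def dF_diff dF_dF)

lemma pd_U_C_phi: "pd x \<in> Fc.supported (U_phi \<union> C_phi)"
  unfolding pd_def by (rule mphi.contr_in(2))

lemma pd_add: "pd (x + y) = pd x + pd y"
  by (simp add: pd_def dF_add mphi.contr_add)

lemma pd_FS: "pd (FS p x) = FS p (pd x)"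
  by (simp add: pd_def dF_FS contr_FS FM.scale_right_diff_distrib)

lemma minus_pr: "x \<in> Fc.supported (U_phi \<union> C_phi) \<Longrightarrow> x - pr x \<in> Fc.supported U_phi"
  by (rule Fc.supportedI) (use Fc.supportedD in \<open>fastforce simp: Fc.cf_diff Fc.cf_restr split: if_splits\<close>)

lemma pr_U_phi: "x \<in> Fc.supported U_phi \<Longrightarrow> pr x = 0"
  by (rule Fc.restr_disjoint[OF _ mphi.U_C])

text \<open>The core of the comparison of \<open>G\<close> with \<open>F\<close>. The part \<open>w - \<pi> w\<close> of \<open>w\<close> in the span of \<open>U_phi\<close> is
  recovered from its boundary by \<open>\<phi>\<close>; therefore, if \<open>\<phi> (d\<^sub>F w) = 0\<close>, then \<open>\<phi> (d\<^sub>F (\<pi> w)) = \<pi> w - w\<close>.\<close>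

lemma pd_pr:
  assumes w: "w \<in> Fc.supported (U_phi \<union> C_phi)" and c: "mphi.contr (dF w) = 0"
  shows "pd (pr w) = dF w"
proof -
  let ?u = "w - pr w"
  have d: "dF (pr w) = dF w - dF ?u" by (simp add: dF_diff)
  have "mphi.contr (dF (pr w)) = - ?u"
    unfolding d contr_diff c mphi.contr_d[OF minus_pr[OF w]] by simp
  then show ?thesis by (simp add: pd_def dF_diff[symmetric])
qed

lemma dG_dG: "pr (pd (pr (pd x))) = 0"
proof -
  have "pd (pr (pd x)) = dF (pd x)"
    by (rule pd_pr[OF pd_U_C_phi]) (simp add: dF_pd Fc.klin_zero[OF klin_contr])
  then show ?thesis by (simp add: dF_pd Fc.klin_zero[OF Fc.klin_restr])
qed

lemma contr_Fp: "x \<in> Fp p \<Longrightarrow> mphi.contr x \<in> Fp (Suc p)"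
  using mphi.contr_lab(1)[of x "{p} \<times> UNIV"] unfolding shF_image Fp_lab
  by (rule Fc.supported_mono) auto

lemma Fp_diff: "x \<in> Fp p \<Longrightarrow> y \<in> Fp p \<Longrightarrow> x - y \<in> Fp p"
  by (simp add: Fp_def Fc.supported_diff)

lemma pd_Fp: "x \<in> Fp (Suc p) \<Longrightarrow> pd x \<in> Fp p"
  unfolding pd_def by (intro Fp_diff dF_Fp contr_Fp)

lemma pr_Gp: "x \<in> Fp p \<Longrightarrow> pr x \<in> Gp p"
  unfolding Gp_def
  by (rule Fc.supportedI) (auto simp: Fp_def Fc.cf_restr dest: Fc.supportedD split: if_splits)

lemma Gp_Fp: "x \<in> Gp p \<Longrightarrow> x \<in> Fp p"
  unfolding Gp_def Fp_def by (rule Fc.supported_mono) auto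

lemma Gp_C_phi: "x \<in> Gp p \<Longrightarrow> x \<in> Fc.supported C_phi"
  unfolding Gp_def by (rule Fc.supported_mono) auto

lemma dG_Gp: "x \<in> Gp (Suc p) \<Longrightarrow> pr (pd x) \<in> Gp p"
  by (intro pr_Gp pd_Fp Gp_Fp)

text \<open>Boundaries can be lifted to \<open>G\<close>: with \<open>z\<close> corrected by a boundary so that it lies in the span of
  \<open>U_phi \<union> C_phi\<close>, its projection to \<open>G\<close> is the required chain.\<close>

lemma boundary_lift:
  assumes x: "x \<in> Gp p" and z: "z \<in> Fp (Suc p)" "x - mphi.contr (dF x) = dF z"
  shows "\<exists>c\<in>Gp (Suc p). x = pr (pd c)"
proof -
  define w where "w = z - dF (mphi.contr z)"
  have w: "w \<in> Fc.supported (U_phi \<union> C_phi)" unfolding w_def by (rule mphi.contr_in(2))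
  have dw: "dF w = x - mphi.contr (dF x)" using z by (simp add: w_def dF_diff dF_dF)
  have wF: "w \<in> Fp (Suc p)" unfolding w_def using z by (intro Fp_diff dF_Fp contr_Fp)
  have u: "mphi.contr (dF x) \<in> Fc.supported U_phi" by (rule mphi.contr_in(1))
  have x1: "x \<in> Fc.supported C_phi" using x by (rule Gp_C_phi)
  have "x - mphi.contr (dF x) \<in> Fc.supported (U_phi \<union> C_phi)"
    by (intro Fc.supported_diff Fc.supported_mono[OF x1] Fc.supported_mono[OF u]) auto
  then have "mphi.contr (dF w) = 0" unfolding dw by (rule mphi.contr_UC)
  from pd_pr[OF w this] have "pr (pd (pr w)) = pr x - pr (mphi.contr (dF x))" by (simp add: dw pr_diff)
  also have "\<dots> = x" using Fc.restr_supported[OF x1] pr_U_phi[OF u] by simp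
  finally show ?thesis using pr_Gp[OF wF] by (intro bexI[of _ "pr w"]) simp_all
qed

text \<open>A cycle \<open>x\<close> of \<open>G\<close> becomes a cycle of \<open>F\<close> after subtracting \<open>\<phi> (d\<^sub>F x)\<close>.\<close>

lemma G_exact:
  assumes x: "x \<in> Gp (Suc p)" and z: "pr (pd x) = 0"
  shows "\<exists>c\<in>Gp (Suc (Suc p)). x = pr (pd c)"
proof -
  let ?y = "x - mphi.contr (dF x)"
  have y: "?y \<in> Fp (Suc p)"
    using x by (intro Fp_diff Gp_Fp contr_Fp dF_Fp)
  have "pd x \<in> Fc.supported U_phi" using minus_pr[OF pd_U_C_phi, of x] z by simp
  moreover have "dF (pd x) \<in> Fc.supported (U_phi \<union> C_phi)" by (simp add: dF_pd)
  ultimately have "pd x = 0" by (rule mphi.d_injective)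
  then have "dF ?y = 0" by (simp add: dF_diff pd_def)
  then obtain w where "w \<in> Fp (Suc (Suc p))" "?y = dF w" using F_exact[OF y] by blast
  then show ?thesis using boundary_lift[OF x] by blast
qed

lemma G_exact_0:
  assumes x: "x \<in> Gp 0" and z: "augF x = 0"
  shows "\<exists>c\<in>Gp (Suc 0). x = pr (pd c)"
proof -
  have d: "dF x = 0" using x Gp_Fp dF_F0 by blast
  then obtain w where "w \<in> Fp (Suc 0)" "x = dF w" using F_exact[OF Gp_Fp[OF x]] z by blast
  then show ?thesis using boundary_lift[OF x, of w] d Fc.klin_zero[OF klin_contr] by simp
qed

text \<open>In homological degree 0 the set \<open>U_phi\<close> is empty, so \<open>\<pi>\<close> does nothing there.\<close>

lemma augF_dG: "c \<in> Gp (Suc 0) \<Longrightarrow> augF (pr (pd c)) = 0"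
proof -
  assume c: "c \<in> Gp (Suc 0)"
  have "pd c \<in> Fp 0" using c by (intro pd_Fp Gp_Fp)
  then have "pd c \<in> Fc.supported ((U_phi \<union> C_phi) \<inter> {\<kappa>. card (snd (fst \<kappa>)) = 0})"
    unfolding Fp_def by (intro Fc.supported_Int pd_U_C_phi)
  then have "pd c \<in> Fc.supported C_phi"
    by (rule Fc.supported_mono) (auto simp: U_phi_def dominates_def)
  then have "pr (pd c) = pd c" by (rule Fc.restr_supported)
  then show ?thesis by (simp add: pd_def augF_diff augF_dF)
qed

lemma dF_no_constant: "cF (dF u) ((0, I), (0, j)) = 0"
proof (induction u rule: poly_mapping_additive_induct)
  case (single b m)
  have "fst b + vexp i \<noteq> 0" for i
  proof -
    have "i \<in> Poly_Mapping.keys (fst b + vexp i)" by (simp add: keys_add_nat)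
    then show ?thesis by (metis keys_zero empty_iff)
  qed
  then show ?case unfolding dF_single cF_dB by (intro sum.neutral) (simp add: cM_var_zero)
qed (simp_all add: dF_add Fc.cf_add)

lemma dG_minimal:
  assumes "x \<in> Gp (Suc p)"
  shows "pr (pd x) \<in> FM.span {FS a y | a y. a \<in> irrelevant \<and> y \<in> Gp p}"
proof -
  have "pr (pd x) \<in> Fc.supported {\<kappa>\<in>C_phi. card (snd (fst \<kappa>)) = p \<and> fst (fst \<kappa>) \<noteq> 0}"
  proof (rule Fc.supportedI)
    fix \<kappa> assume nz: "cF (pr (pd x)) \<kappa> \<noteq> 0"
    have "\<kappa> \<in> C_phi" "card (snd (fst \<kappa>)) = p"
      using Fc.supportedD[OF dG_Gp[OF assms, unfolded Gp_def] nz] by auto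
    moreover have "fst (fst \<kappa>) \<noteq> 0"
    proof
      assume "fst (fst \<kappa>) = 0"
      then obtain I j where "\<kappa> = ((0, I), (0, j))" using \<open>\<kappa> \<in> C_phi\<close> by (auto simp: C_phi_def)
      then have "cF (pd x) \<kappa> = 0" by (simp add: pd_def Fc.cf_diff dF_no_constant)
      then show False using nz \<open>\<kappa> \<in> C_phi\<close> by (simp add: Fc.cf_restr)
    qed
    ultimately show "\<kappa> \<in> {\<kappa>\<in>C_phi. card (snd (fst \<kappa>)) = p \<and> fst (fst \<kappa>) \<noteq> 0}" by blast
  qed
  then show ?thesis
  proof (induction rule: Fc.supported_induct)
    case (basis c \<kappa>)
    obtain \<beta> I t where k: "\<kappa> = ((\<beta>, I), t)" by (metis prod.exhaust)
    have "bF ((0, I), t) \<in> Gp p"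
      unfolding Gp_def using basis by (intro Fc.supported_bas) (auto simp: k C_phi_def KF_def)
    moreover have "(monom \<beta> :: ('n, 'k) mpoly) \<in> irrelevant" using basis by (intro monom_irrelevant) (simp add: k)
    ultimately show ?case
      unfolding k bF_shift[of \<beta>] by (intro FM.span_scale FM.span_base) blast
  qed (simp_all add: FM.span_zero FM.span_add)
qed

lemma dF_graded: "x \<in> F_grading Mg e \<Longrightarrow> dF x \<in> F_grading Mg e"
  unfolding F_grading_eq
  by (rule Fc.klin_supported[OF klin_dF], assumption, rule Fc.supportedI)
     (use labF_dF in \<open>force simp: labF_def shF_def\<close>)

lemma contr_graded: "x \<in> F_grading Mg e \<Longrightarrow> mphi.contr x \<in> F_grading Mg e"
proof -
  assume "x \<in> F_grading Mg e"
  then have "x \<in> Fc.supported {\<kappa>. labF \<kappa> \<in> UNIV \<times> {e}}"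
    by (simp add: F_grading_eq labF_def)
  from mphi.contr_lab(1)[OF this] show ?thesis
    unfolding F_grading_eq by (rule Fc.supported_mono) (auto simp: labF_def shF_def)
qed

lemma dG_graded: "x \<in> F_grading Mg e \<Longrightarrow> pr (pd x) \<in> F_grading Mg e"
proof -
  assume "x \<in> F_grading Mg e"
  then have "pd x \<in> F_grading Mg e"
    using dF_graded contr_graded unfolding pd_def F_grading_eq by (metis Fc.supported_diff)
  then show ?thesis unfolding F_grading_eq
    by (auto intro!: Fc.supportedI simp: Fc.cf_restr dest: Fc.supportedD split: if_splits)
qed


subsection \<open>The augmentation\<close>

lemma G0_embed_add: "G0_embed scale r eta (f + h) = G0_embed scale r eta f + G0_embed scale r eta h"
  by (simp add: G0_embed_def lookup_add FS_add_left sum.distrib)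

lemma cF_G0_embed:
  assumes "j < r"
  shows "cF (G0_embed scale r eta f) ((\<beta>, {}), (0, j)) = fcf f (\<beta>, j)"
proof -
  have "cF (G0_embed scale r eta f) ((\<beta>, {}), (0, j))
      = (\<Sum>i<r. if i = j then Poly_Mapping.lookup (Poly_Mapping.lookup f j) \<beta> else 0)"
    unfolding G0_embed_def Fc.cf_sum F_elt_bF
    by (rule sum.cong) (auto simp: cF_FS_bF zero_std)
  then show ?thesis using assms by (simp add: fcf_def)
qed

lemma inj_G0_embed: "inj_on (G0_embed scale r eta) (free_mod r)"
proof (rule inj_onI)
  fix f h :: "('n, 'k) fmod"
  assume f: "f \<in> free_mod r" and h: "h \<in> free_mod r" and eq: "G0_embed scale r eta f = G0_embed scale r eta h"
  show "f = h"
  proof (rule fr.cf_eqI)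
    fix t show "fcf f t = fcf h t"
    proof (cases "snd t < r")
      case True
      then show ?thesis using cF_G0_embed[of "snd t" f "fst t"] cF_G0_embed[of "snd t" h "fst t"] eq by simp
    next
      case False
      have "fcf f t = 0" "fcf h t = 0"
        using fr.supportedD[of _ "{t. snd t < r}" t] f h False by (auto simp: free_mod_eq)
      then show ?thesis by simp
    qed
  qed
qed

lemma G0_embed_in: "G0_embed scale r eta f \<in> Gp 0"
  unfolding G0_embed_def F_elt_bF Gbasis_span[symmetric]
  by (intro FM.span_sum FM.span_scale FM.span_base) (auto simp: Gbasis_def F_elt_bF)

lemma G0_embed_image: "G0_embed scale r eta ` free_mod r = Gp 0"
proof (intro equalityI subsetI)
  fix x assume "x \<in> Gp 0"
  then show "x \<in> G0_embed scale r eta ` free_mod r" unfolding Gp_def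
  proof (induction rule: Fc.supported_induct)
    case zero
    have "G0_embed scale r eta 0 = 0" by (simp add: G0_embed_def)
    then show ?case using free_mod_zero by (metis image_eqI)
  next
    case (add x y)
    then obtain f h where "x = G0_embed scale r eta f" "y = G0_embed scale r eta h" "f \<in> free_mod r" "h \<in> free_mod r"
      by blast
    then show ?case using G0_embed_add[of f h] free_mod_add by (metis image_eqI)
  next
    case (basis c \<kappa>)
    then obtain \<beta> j where k: "\<kappa> = ((\<beta>, {}), (0, j))" "j < r"
      by (auto simp: C_phi_def)
    let ?f = "Poly_Mapping.single j (Poly_Mapping.single \<beta> c) :: ('n, 'k) fmod"
    have "G0_embed scale r eta ?f = (\<Sum>i<r. if i = j then FS (Poly_Mapping.single \<beta> c) (bF ((0, {}), (0, j))) else 0)"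
      unfolding G0_embed_def F_elt_bF by (rule sum.cong) (auto simp: lookup_single when_def)
    also have "\<dots> = FS (const c) (bF \<kappa>)" using k by (simp add: FS_single_bF)
    finally have "FS (const c) (bF \<kappa>) = G0_embed scale r eta ?f" ..
    moreover have "?f \<in> free_mod r" using k by (auto simp: free_mod_def)
    ultimately show ?case by blast
  qed
qed (use G0_embed_in in auto)

text \<open>The augmentation of \<open>G\<close> is the restriction of that of \<open>F\<close>.\<close>

lemma augF_G0_embed:
  assumes "f \<in> free_mod r"
  shows "augF (G0_embed scale r eta f) = eta f"
proof -
  have "f = (\<Sum>j<r. free_scale (Poly_Mapping.lookup f j) (fbas (0, j)))"
  proof (rule poly_mapping_eqI)
    fix i
    have "Poly_Mapping.lookup (\<Sum>j<r. free_scale (Poly_Mapping.lookup f j) (fbas (0, j))) i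
        = (\<Sum>j<r. if j = i then Poly_Mapping.lookup f i else 0)"
      unfolding lookup_sum lookup_free_scale
      by (rule sum.cong) (auto simp: fbas_def fterm_def lookup_single when_def)
    then show "Poly_Mapping.lookup f i = Poly_Mapping.lookup (\<Sum>j<r. free_scale (Poly_Mapping.lookup f j) (fbas (0, j))) i"
      using assms by (auto simp: free_mod_iff)
  qed
  then have "eta f = eta (\<Sum>j<r. free_scale (Poly_Mapping.lookup f j) (fbas (0, j)))" by simp
  also have "\<dots> = (\<Sum>j<r. scale (Poly_Mapping.lookup f j) (g (0, j)))"
    by (subst eta_sum) (auto simp: free_mod_scale fbas_free_mod eta_scale g_def)
  also have "\<dots> = augF (G0_embed scale r eta f)"
    unfolding G0_embed_def augF_sum augF_FS F_elt_bF by (simp add: bF_def augF_single)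
  finally show ?thesis ..
qed

lemma aug_G_eq:
  assumes "x \<in> Gp 0"
  shows "aug_G scale r eta x = augF x"
proof -
  obtain f where f: "f \<in> free_mod r" "x = G0_embed scale r eta f"
    using assms G0_embed_image by blast
  then have "aug_G scale r eta x = eta f"
    by (simp add: aug_G_def the_inv_into_f_f[OF inj_G0_embed])
  then show ?thesis using f augF_G0_embed by simp
qed

lemma augF_surj: "augF ` Gp 0 = UNIV"
proof -
  have "augF ` Gp 0 = eta ` free_mod r"
    unfolding G0_embed_image[symmetric] image_image by (rule image_cong) (simp_all add: augF_G0_embed)
  then show ?thesis using presentation by (simp add: graded_presentation_def)
qed

lemma augF_graded:
  assumes "x \<in> Gp 0" "x \<in> F_grading Mg e"
  shows "augF x \<in> Mg e"
proof -
  have "x \<in> Fc.supported ({\<kappa>\<in>C_phi. card (snd (fst \<kappa>)) = 0} \<inter> {\<kappa>. degF \<kappa> = e})"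
    using assms unfolding Gp_def F_grading_eq by (rule Fc.supported_Int)
  then show ?thesis
  proof (induction rule: Fc.supported_induct)
    case zero
    show ?case using graded by (simp add: graded_module_def)
  next
    case (add x y)
    then show ?case using graded unfolding augF_add graded_module_def by blast
  next
    case (basis c \<kappa>)
    then obtain \<beta> j where k: "\<kappa> = ((\<beta>, {}), (0, j))" "j < r" and d: "degF \<kappa> = e"
      by (auto simp: C_phi_def)
    have "augF (FS (const c) (bF \<kappa>)) = sc c (scale (monom \<beta>) (g (0, j)))"
      unfolding augF_FS k by (simp add: bF_def augF_single)
    also have "\<dots> = sc c (g (\<beta>, j))" using scale_monom_g[of "(0, j)" \<beta>] k by simp
    also have "\<dots> = eta (free_scale (const c) (fbas (\<beta>, j)))"
      using k by (simp add: g_def eta_scale fbas_free_mod)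
    also have "\<dots> \<in> Mg e"
      using k d by (intro eta_homog fr.supported_ks fr.supported_bas) (auto simp: degF_def tdeg_def)
    finally show ?case .
  qed
qed

subsection \<open>The minimal free resolution\<close>

lemma minimal_free_resolution_G:
  "minimal_free_resolution scale Mg FS (F_grading Mg)
     (G_mod scale r eta prec) (d_G scale r eta prec) (aug_G scale r eta)"
  unfolding minimal_free_resolution_def G_mod_eq
proof (intro conjI allI)
  show "graded_module scale Mg" by (rule graded)
  show "graded_module FS (F_grading Mg)" by (rule graded_module_F)
  show "\<exists>B. finite B \<and> (\<forall>b\<in>B. \<exists>e. b \<in> F_grading Mg e) \<and> \<not> FM.dependent B \<and> FM.span B = Gp p" for p
  proof (intro exI[of _ "Gbasis p"] conjI ballI)
    fix b assume "b \<in> Gbasis p"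
    then obtain I j where b: "b = bF ((0, I), (0, j))" "j < r" by (auto simp: Gbasis_def F_elt_bF)
    then have "b \<in> F_grading Mg (degF ((0, I), (0, j)))"
      unfolding F_grading_eq by (auto simp: KF_def zero_std intro!: Fc.supported_bas)
    then show "\<exists>e. b \<in> F_grading Mg e" by blast
  qed (simp_all add: finite_Gbasis Gbasis_independent Gbasis_span)
  show "linear_on (Gp (Suc p)) FS FS (d_G scale r eta prec)" for p
    by (simp add: linear_on_def d_G_eq pd_add pr_add pd_FS pr_FS)
  show "d_G scale r eta prec ` Gp (Suc p) \<subseteq> Gp p" for p
    by (auto simp: d_G_eq dG_Gp)
  show "d_G scale r eta prec ` (Gp (Suc p) \<inter> F_grading Mg e) \<subseteq> F_grading Mg e" for p e
    by (auto simp: d_G_eq dG_graded)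
  have sub: "FM.subspace (Gp 0)" unfolding Gbasis_span[symmetric] by (rule FM.subspace_span)
  show "linear_on (Gp 0) FS scale (aug_G scale r eta)"
    unfolding linear_on_def
    using FM.subspace_add[OF sub] FM.subspace_scale[OF sub]
    by (simp add: aug_G_eq augF_add augF_FS)
  show "aug_G scale r eta ` (Gp 0 \<inter> F_grading Mg e) \<subseteq> Mg e" for e
    by (auto simp: aug_G_eq augF_graded)
  show "aug_G scale r eta ` Gp 0 = UNIV"
    using augF_surj aug_G_eq by (metis image_cong)
  show "{x \<in> Gp 0. aug_G scale r eta x = 0} = d_G scale r eta prec ` Gp 1"
  proof (intro equalityI subsetI)
    fix x assume "x \<in> {x \<in> Gp 0. aug_G scale r eta x = 0}"
    then have "x \<in> Gp 0" "augF x = 0" by (auto simp: aug_G_eq)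
    from G_exact_0[OF this] show "x \<in> d_G scale r eta prec ` Gp 1"
      by (auto simp: d_G_eq)
  next
    fix x assume "x \<in> d_G scale r eta prec ` Gp 1"
    then obtain c where "c \<in> Gp (Suc 0)" "x = pr (pd c)" by (auto simp: d_G_eq)
    then show "x \<in> {x \<in> Gp 0. aug_G scale r eta x = 0}"
      using dG_Gp[of c 0] augF_dG by (simp add: aug_G_eq)
  qed
  show "{x \<in> Gp (Suc p). d_G scale r eta prec x = 0} = d_G scale r eta prec ` Gp (Suc (Suc p))" for p
  proof (intro equalityI subsetI)
    fix x assume "x \<in> {x \<in> Gp (Suc p). d_G scale r eta prec x = 0}"
    then have "x \<in> Gp (Suc p)" "pr (pd x) = 0" by (auto simp: d_G_eq)
    from G_exact[OF this] show "x \<in> d_G scale r eta prec ` Gp (Suc (Suc p))"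
      by (auto simp: d_G_eq)
  qed (auto simp: d_G_eq dG_Gp dG_dG)
  show "d_G scale r eta prec ` Gp (Suc p) \<subseteq> FM.span {FS a y | a y. a \<in> irrelevant \<and> y \<in> Gp p}" for p
    by (auto simp: d_G_eq dG_minimal)
qed

end

theorem theorem1:
  fixes scale :: "('n::{finite, linorder}, 'k::field) mpoly \<Rightarrow> 'm::ab_group_add \<Rightarrow> 'm"
    and Mg :: "int \<Rightarrow> 'm set"
    and r :: nat
    and dg :: "nat \<Rightarrow> int"
    and eta :: "('n, 'k) fmod \<Rightarrow> 'm"
    and prec :: "'n mon \<times> nat \<Rightarrow> 'n mon \<times> nat \<Rightarrow> bool"
  assumes "graded_module scale Mg"
    and "finitely_generated scale"
    and "graded_presentation scale Mg r dg eta"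
    and "term_order r prec"
    and "initially_linear_syzygies r eta prec"
  shows "minimal_free_resolution scale Mg (F_scale scale) (F_grading Mg)
           (G_mod scale r eta prec) (d_G scale r eta prec) (aug_G scale r eta)"
proof -
  interpret initially_linear scale Mg r dg eta prec
    using assms by unfold_locales
  show ?thesis by (rule minimal_free_resolution_G)
qed

end
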